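(* Let $\Omega\subset\mathbb{R}^n$ ($n\ge2$) be a bounded domain with Lipschitz boundary, $\gamma,\beta\in C^1(\bar\Omega)$ with $1\le\gamma^-\le\gamma(x)\le\gamma^+<\infty$ and $1\le\beta^-\le\beta(x)<n$, and $\theta\in M_0(\Omega)$ with $\theta(x)\ge\gamma(x)+\beta(x)+\varepsilon_0$ a.e. for some $\varepsilon_0>0$. Let $p\in M_0(\Omega)$ and suppose that for some $\varepsilon>0$, $$p(x)+\varepsilon<\frac{n(\gamma(x)+\beta(x))}{n-\beta(x)},\qquad x\in\Omega.$$ Then the embedding $S_{1,\gamma(x),\beta(x),\theta(x)}(\Omega)\hookrightarrow L^{p(x)}(\Omega)$ holds and is compact, i.e. every sequence bounded with respect to $[\cdot]_{S_{\gamma,\beta,\theta}}$ has a subsequence converging in $L^{p(x)}(\Omega)$.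
   Context: $M_0(\Omega)$: measurable $p:\Omega\to[1,\infty]$ with $1\le p^-\le p\le p^+<\infty$ a.e. $D_i=\partial/\partial x_i$. $S_{1,\gamma(x),\beta(x),\theta(x)}(\Omega)=\{u\in L^1(\Omega):\int_\Omega|u|^{\theta(x)}dx+\sum_{i=1}^n\int_\Omega|u|^{\gamma(x)}|D_iu|^{\beta(x)}dx<\infty\}$ with pseudo-norm $[u]_{S_{\gamma,\beta,\theta}}=\inf\{\lambda>0:\int_\Omega|u/\lambda|^{\theta(x)}dx+\sum_{i=1}^n\int_\Omega\big|\,|u|^{\gamma(x)/\beta(x)}D_iu\,/\lambda^{\gamma(x)/\beta(x)+1}\big|^{\beta(x)}dx\le1\}$. *)

theory Defs
  imports "HOL-Analysis.Analysis"
begin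

type_synonym 'n fn = "real^'n \<Rightarrow> real"

text \<open>Omega is locally (near each boundary point) the region strictly below the graph
  of a Lipschitz function, in a suitably rotated coordinate system whose last axis is
  the unit vector e. A Lipschitz function of the n-1 coordinates orthogonal to e is
  represented as a Lipschitz function on real^n that is invariant along e.\<close>
definition lipschitz_boundary :: "(real^'n) set \<Rightarrow> bool" where
  "lipschitz_boundary \<Omega> \<longleftrightarrow>
     (\<forall>x0 \<in> frontier \<Omega>. \<exists>r>0. \<exists>e::real^'n. \<exists>g::'n fn. \<exists>L.
        norm e = 1 \<and> L-lipschitz_on UNIV g \<and> (\<forall>y t. g (y + t *\<^sub>R e) = g y) \<and>
        \<Omega> \<inter> ball x0 r = {x \<in> ball x0 r. x \<bullet> e < g x})"

definition bounded_lipschitz_domain :: "(real^'n) set \<Rightarrow> bool" where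
  "bounded_lipschitz_domain \<Omega> \<longleftrightarrow>
     open \<Omega> \<and> connected \<Omega> \<and> \<Omega> \<noteq> {} \<and> bounded \<Omega> \<and> lipschitz_boundary \<Omega>"

definition C1_closure :: "(real^'n) set \<Rightarrow> 'n fn \<Rightarrow> bool" where
  "C1_closure \<Omega> f \<longleftrightarrow> continuous_on (closure \<Omega>) f \<and>
     (\<exists>D::'n \<Rightarrow> 'n fn. (\<forall>i. continuous_on (closure \<Omega>) (D i)) \<and>
        (\<forall>x\<in>\<Omega>. (f has_derivative (\<lambda>h. \<Sum>i\<in>UNIV. h $ i * D i x)) (at x)))"

fun Ck :: "nat \<Rightarrow> 'n::finite fn \<Rightarrow> bool" where
  "Ck 0 f \<longleftrightarrow> continuous_on UNIV f"
| "Ck (Suc k) f \<longleftrightarrow> (\<exists>D::'n \<Rightarrow> 'n fn.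
      (\<forall>x. (f has_derivative (\<lambda>h. \<Sum>i\<in>UNIV. h $ i * D i x)) (at x)) \<and> (\<forall>i. Ck k (D i)))"

definition smooth :: "'n::finite fn \<Rightarrow> bool" where
  "smooth f \<longleftrightarrow> (\<forall>k. Ck k f)"

definition test_fun :: "(real^'n::finite) set \<Rightarrow> 'n fn \<Rightarrow> bool" where
  "test_fun \<Omega> \<phi> \<longleftrightarrow> smooth \<phi> \<and> compact (closure {x. \<phi> x \<noteq> 0}) \<and> closure {x. \<phi> x \<noteq> 0} \<subseteq> \<Omega>"

definition partial :: "'n::finite \<Rightarrow> 'n fn \<Rightarrow> 'n fn" where
  "partial i f x = frechet_derivative f (at x) (axis i 1)"

definition locally_integrable :: "(real^'n::finite) set \<Rightarrow> 'n fn \<Rightarrow> bool" where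
  "locally_integrable \<Omega> f \<longleftrightarrow> (\<forall>K. compact K \<and> K \<subseteq> \<Omega> \<longrightarrow> set_integrable lebesgue K f)"

definition weak_partial :: "(real^'n::finite) set \<Rightarrow> 'n fn \<Rightarrow> 'n \<Rightarrow> 'n fn \<Rightarrow> bool" where
  "weak_partial \<Omega> u i g \<longleftrightarrow> locally_integrable \<Omega> u \<and> locally_integrable \<Omega> g \<and>
     (\<forall>\<phi>. test_fun \<Omega> \<phi> \<longrightarrow>
        (LINT x:\<Omega>|lebesgue. u x * partial i \<phi> x) = - (LINT x:\<Omega>|lebesgue. g x * \<phi> x))"

definition has_weak_partials :: "(real^'n::finite) set \<Rightarrow> 'n fn \<Rightarrow> bool" where
  "has_weak_partials \<Omega> u \<longleftrightarrow> (\<forall>i. \<exists>g. weak_partial \<Omega> u i g)"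

definition Dw :: "(real^'n::finite) set \<Rightarrow> 'n \<Rightarrow> 'n fn \<Rightarrow> 'n fn" where
  "Dw \<Omega> i u = (SOME g. weak_partial \<Omega> u i g)"

definition M0 :: "(real^'n::finite) set \<Rightarrow> 'n fn \<Rightarrow> bool" where
  "M0 \<Omega> p \<longleftrightarrow> p \<in> borel_measurable (restrict_space lebesgue \<Omega>) \<and>
     (\<exists>P. AE x in lebesgue. x \<in> \<Omega> \<longrightarrow> 1 \<le> p x \<and> p x \<le> P)"

definition modular :: "(real^'n::finite) set \<Rightarrow> 'n fn \<Rightarrow> 'n fn \<Rightarrow> ennreal" where
  "modular \<Omega> p u = (\<integral>\<^sup>+ x \<in> \<Omega>. ennreal (\<bar>u x\<bar> powr p x) \<partial>lebesgue)"

definition Lpx :: "(real^'n::finite) set \<Rightarrow> 'n fn \<Rightarrow> 'n fn set" where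
  "Lpx \<Omega> p = {u. u \<in> borel_measurable (restrict_space lebesgue \<Omega>) \<and> modular \<Omega> p u < \<infinity>}"

definition lux_norm :: "(real^'n::finite) set \<Rightarrow> 'n fn \<Rightarrow> 'n fn \<Rightarrow> real" where
  "lux_norm \<Omega> p u = Inf {l::real. l > 0 \<and> modular \<Omega> p (\<lambda>x. u x / l) \<le> 1}"

definition S_space :: "(real^'n::finite) set \<Rightarrow> 'n fn \<Rightarrow> 'n fn \<Rightarrow> 'n fn \<Rightarrow> 'n fn set" where
  "S_space \<Omega> \<gamma> \<beta> \<theta> = {u. set_integrable lebesgue \<Omega> u \<and> has_weak_partials \<Omega> u \<and>
     modular \<Omega> \<theta> u
     + (\<Sum>i\<in>UNIV. \<integral>\<^sup>+ x \<in> \<Omega>. ennreal (\<bar>u x\<bar> powr \<gamma> x * \<bar>Dw \<Omega> i u x\<bar> powr \<beta> x) \<partial>lebesgue)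
     < \<infinity>}"

definition S_pnorm :: "(real^'n::finite) set \<Rightarrow> 'n fn \<Rightarrow> 'n fn \<Rightarrow> 'n fn \<Rightarrow> 'n fn \<Rightarrow> real" where
  "S_pnorm \<Omega> \<gamma> \<beta> \<theta> u = Inf {l::real. l > 0 \<and>
     modular \<Omega> \<theta> (\<lambda>x. u x / l)
     + (\<Sum>i\<in>UNIV. \<integral>\<^sup>+ x \<in> \<Omega>. ennreal (\<bar>\<bar>u x\<bar> powr (\<gamma> x / \<beta> x) * Dw \<Omega> i u x
            / l powr (\<gamma> x / \<beta> x + 1)\<bar> powr \<beta> x) \<partial>lebesgue) \<le> 1}"

end

theory Submission
  imports Defs "HOL-Complex_Analysis.Great_Picard" "HOL-Library.Diagonal_Subsequence"
begin

text \<open>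
  Near every point of the closure, the Lipschitz condition provides a cone \<open>x + (0,T] \<cdot> cball c d\<close> inside
  \<open>\<Omega>\<close>. Testing the weak gradient with a mollifier supported in this cone bounds, at almost every \<open>x\<close>, the
  distance of a function to its average at scale \<open>T\<close> by a dyadic sum of averages of the gradient. Integrating
  this sum gives the subcritical Sobolev inequality without any extension theorem.

  On a small ball the exponents are replaced by constants \<open>b \<le> \<beta>\<close> and \<open>s \<le> \<gamma> / \<beta>\<close>; the inequality is applied to
  a truncation of \<open>\<bar>u\<bar>\<^sup>s u\<close> that is flat on \<open>\<bar>u\<bar> < 1\<close>. A finite cover of the closure yields a uniform bound for
  the integral of \<open>\<bar>u\<bar>\<close> to the power \<open>p(x) + \<epsilon>/2\<close>. For compactness, \<open>F(u)\<close> with \<open>F' = min(\<bar>t\<bar>\<^sup>Q, 1)\<close> is bounded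
  in \<open>W\<^sup>1\<^sup>,\<^sup>1\<close>, so by the interior Rellich theorem a subsequence converges almost everywhere, and Vitali's
  argument upgrades this to convergence in the space with exponent \<open>p\<close>.
\<close>

section \<open>Smooth functions and mollifiers\<close>

lemma Ck_continuous: "Ck k f \<Longrightarrow> continuous_on UNIV f"
  by (cases k) (auto simp: continuous_on_eq_continuous_at dest: has_derivative_continuous)

lemma Ck_Suc_imp_Ck: "Ck (Suc k) f \<Longrightarrow> Ck k f"
proof (induction k arbitrary: f)
  case 0
  then show ?case using Ck_continuous[of "Suc 0" f] by simp
next
  case (Suc k)
  from Suc.prems obtain D where D: "\<forall>x. (f has_derivative (\<lambda>h. \<Sum>i\<in>UNIV. h $ i * D i x)) (at x)"
    "\<forall>i. Ck (Suc k) (D i)" by auto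
  with Suc.IH have "\<forall>i. Ck k (D i)" by blast
  with D(1) show ?case unfolding Ck.simps(2)[of k f] by blast
qed

lemma Ck_const: "Ck k (\<lambda>_. c)"
proof (induction k arbitrary: c)
  case (Suc k)
  show ?case unfolding Ck.simps by (rule exI[of _ "\<lambda>_ _. 0"]) (simp add: Suc)
qed simp

lemma Ck_nth: "Ck k (\<lambda>x. x $ (j::'n::finite))"
proof (cases k)
  case (Suc k)
  have sum_eq_nth: "(\<Sum>i\<in>UNIV. h $ i * (if i = j then 1 else 0)) = h $ j" for h :: "real^'n"
    by (simp add: if_distrib cong: if_cong)
  have "((\<lambda>x. x $ j) has_derivative (\<lambda>h. \<Sum>i\<in>UNIV. h $ i * (if i = j then 1 else 0))) (at x)" for x :: "real^'n"
    unfolding sum_eq_nth by (rule bounded_linear_imp_has_derivative) (rule bounded_linear_vec_nth)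
  then show ?thesis unfolding Suc Ck.simps
    by (intro exI[of _ "\<lambda>i x. if i = j then 1 else 0"]) (auto intro: Ck_const)
qed (simp add: continuous_intros)

lemma Ck_add: "Ck k f \<Longrightarrow> Ck k g \<Longrightarrow> Ck k (\<lambda>x. f x + g x)"
proof (induction k arbitrary: f g)
  case 0
  then show ?case by (simp add: continuous_intros)
next
  case (Suc k)
  then obtain D E where D: "\<forall>x. (f has_derivative (\<lambda>h. \<Sum>i\<in>UNIV. h $ i * D i x)) (at x)" "\<forall>i. Ck k (D i)"
    and E: "\<forall>x. (g has_derivative (\<lambda>h. \<Sum>i\<in>UNIV. h $ i * E i x)) (at x)" "\<forall>i. Ck k (E i)" by auto
  have "((\<lambda>x. f x + g x) has_derivative (\<lambda>h. \<Sum>i\<in>UNIV. h $ i * (D i x + E i x))) (at x)" for x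
    using has_derivative_add[OF D(1)[rule_format, of x] E(1)[rule_format, of x]]
    by (simp add: distrib_left sum.distrib)
  with D E Suc.IH show ?case unfolding Ck.simps
    by (intro exI[of _ "\<lambda>i x. D i x + E i x"]) auto
qed

lemma Ck_mult: "Ck k f \<Longrightarrow> Ck k g \<Longrightarrow> Ck k (\<lambda>x. f x * g x)"
proof (induction k arbitrary: f g)
  case 0
  then show ?case by (simp add: continuous_intros)
next
  case (Suc k)
  then obtain D E where D: "\<forall>x. (f has_derivative (\<lambda>h. \<Sum>i\<in>UNIV. h $ i * D i x)) (at x)" "\<forall>i. Ck k (D i)"
    and E: "\<forall>x. (g has_derivative (\<lambda>h. \<Sum>i\<in>UNIV. h $ i * E i x)) (at x)" "\<forall>i. Ck k (E i)" by auto
  have "((\<lambda>x. f x * g x) has_derivative (\<lambda>h. \<Sum>i\<in>UNIV. h $ i * (f x * E i x + D i x * g x))) (at x)" for x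
    using has_derivative_mult[OF D(1)[rule_format, of x] E(1)[rule_format, of x]]
    by (simp add: distrib_left sum.distrib sum_distrib_left sum_distrib_right mult_ac)
  moreover have "Ck k f" "Ck k g" using Suc.prems Ck_Suc_imp_Ck by auto
  ultimately show ?case using D E Suc.IH unfolding Ck.simps
    by (intro exI[of _ "\<lambda>i x. f x * E i x + D i x * g x"]) (auto intro!: Ck_add)
qed

lemma Ck_sum: "(\<And>j. j \<in> J \<Longrightarrow> Ck k (f j)) \<Longrightarrow> Ck k (\<lambda>x. \<Sum>j\<in>J. f j x)"
proof (induction J rule: infinite_finite_induct)
  case (insert j J)
  then show ?case by (simp add: Ck_add del: Ck.simps)
qed (simp_all add: Ck_const del: Ck.simps)

lemma Ck_compose_real:
  assumes H: "\<And>k t. (H k has_real_derivative H (Suc k) t) (at t)"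
  shows "Ck k f \<Longrightarrow> Ck k (\<lambda>x. H m (f x))"
proof (induction k arbitrary: m)
  case 0
  have "continuous_on UNIV (H m)"
    by (rule DERIV_continuous_on) (rule has_field_derivative_at_within[OF H])
  from continuous_on_compose2[OF this] 0 show ?case by simp
next
  case (Suc k)
  then obtain D where D: "\<forall>x. (f has_derivative (\<lambda>h. \<Sum>i\<in>UNIV. h $ i * D i x)) (at x)" "\<forall>i. Ck k (D i)"
    by auto
  have "((\<lambda>x. H m (f x)) has_derivative (\<lambda>h. \<Sum>i\<in>UNIV. h $ i * (H (Suc m) (f x) * D i x))) (at x)" for x
    using has_derivative_compose[OF D(1)[rule_format, of x] H[of m "f x", unfolded has_field_derivative_def]]
    by (simp add: sum_distrib_left algebra_simps)
  moreover have "Ck k (\<lambda>x. H (Suc m) (f x))" using Suc Ck_Suc_imp_Ck by blast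
  ultimately show ?case using D unfolding Ck.simps
    by (intro exI[of _ "\<lambda>i x. H (Suc m) (f x) * D i x"]) (auto intro!: Ck_mult)
qed

lemma Ck_compose_affine: "Ck k f \<Longrightarrow> Ck k (\<lambda>y. f (a *\<^sub>R (y - x)))"
proof (induction k arbitrary: f)
  case 0
  then show ?case by (auto intro!: continuous_intros continuous_on_compose2[of UNIV f])
next
  case (Suc k)
  then obtain D where D: "\<forall>x. (f has_derivative (\<lambda>h. \<Sum>i\<in>UNIV. h $ i * D i x)) (at x)" "\<forall>i. Ck k (D i)"
    by auto
  have "((\<lambda>y. a *\<^sub>R (y - x)) has_derivative (\<lambda>h. a *\<^sub>R h)) (at y)" for y
    by (auto intro!: derivative_eq_intros)
  from has_derivative_compose[OF this D(1)[rule_format]]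
  have "((\<lambda>y. f (a *\<^sub>R (y - x))) has_derivative (\<lambda>h. \<Sum>i\<in>UNIV. h $ i * (a * D i (a *\<^sub>R (y - x))))) (at y)" for y
    by (simp add: algebra_simps)
  with D Suc.IH show ?case unfolding Ck.simps
    by (intro exI[of _ "\<lambda>i y. a * D i (a *\<^sub>R (y - x))"]) (auto intro!: Ck_mult Ck_const)
qed

lemma smooth_continuous: "smooth f \<Longrightarrow> continuous_on UNIV f"
  using Ck_continuous[of 0 f] by (simp add: smooth_def del: Ck.simps)

lemma smooth_cmult: "smooth f \<Longrightarrow> smooth (\<lambda>x. C * f x)"
  by (simp add: smooth_def Ck_mult Ck_const del: Ck.simps)

lemma smooth_affine_coordinate_mult: "smooth f \<Longrightarrow> smooth (\<lambda>z. (a + b * z $ i) * f z)"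
  by (simp add: smooth_def Ck_mult Ck_add Ck_const Ck_nth del: Ck.simps)

lemma smooth_compose_affine: "smooth f \<Longrightarrow> smooth (\<lambda>y. f (a *\<^sub>R (y - x)))"
  by (simp add: smooth_def Ck_compose_affine del: Ck.simps)

lemma partial_eqI:
  assumes "(f has_derivative (\<lambda>h. \<Sum>i\<in>UNIV. h $ i * D i)) (at x)"
  shows "partial i f x = D i"
  unfolding partial_def frechet_derivative_at[OF assms, symmetric]
  by (simp add: axis_def if_distrib if_distribR cong: if_cong)

lemma
  assumes "smooth f"
  shows smooth_has_derivative: "(f has_derivative (\<lambda>h. \<Sum>i\<in>UNIV. h $ i * partial i f x)) (at x)"
    and smooth_continuous_partial: "continuous_on UNIV (partial i f)"
proof -
  from assms have "Ck (Suc 0) f" by (simp add: smooth_def del: Ck.simps)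
  then obtain D where D: "\<And>x. (f has_derivative (\<lambda>h. \<Sum>i\<in>UNIV. h $ i * D i x)) (at x)"
      "\<And>i. continuous_on UNIV (D i)"
    by auto
  from partial_eqI[OF D(1)] have "partial i f = D i" for i by auto
  with D show "(f has_derivative (\<lambda>h. \<Sum>i\<in>UNIV. h $ i * partial i f x)) (at x)"
      "continuous_on UNIV (partial i f)"
    by auto
qed

lemma partial_compose_affine:
  assumes "smooth f"
  shows "partial i (\<lambda>y. f (a *\<^sub>R (y - x))) y = a * partial i f (a *\<^sub>R (y - x))"
proof (rule partial_eqI)
  have "((\<lambda>y. a *\<^sub>R (y - x)) has_derivative (\<lambda>h. a *\<^sub>R h)) (at y)"
    by (auto intro!: derivative_eq_intros)
  from has_derivative_compose[OF this smooth_has_derivative[OF assms]]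
  show "((\<lambda>y. f (a *\<^sub>R (y - x))) has_derivative
      (\<lambda>h. \<Sum>i\<in>UNIV. h $ i * (a * partial i f (a *\<^sub>R (y - x))))) (at y)"
    by (simp add: algebra_simps)
qed

lemma partial_cmult:
  assumes "smooth f"
  shows "partial i (\<lambda>z. C * f z) z = C * partial i f z"
proof (rule partial_eqI)
  from has_derivative_mult_right[OF smooth_has_derivative[OF assms], of C]
  show "((\<lambda>z. C * f z) has_derivative (\<lambda>h. \<Sum>i\<in>UNIV. h $ i * (C * partial i f z))) (at z)"
    by (simp add: sum_distrib_left mult.left_commute)
qed

lemma partial_affine_coordinate_mult:
  fixes f :: "'n::finite fn"
  assumes "smooth f"
  shows "partial i (\<lambda>z. (a + b * z $ i) * f z) z = b * f z + (a + b * z $ i) * partial i f z"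
proof -
  have "((\<lambda>z. z $ i) has_derivative (\<lambda>h. h $ i)) (at z)"
    by (rule bounded_linear_imp_has_derivative[OF bounded_linear_vec_nth])
  then have "((\<lambda>z. (a + b * z $ i) * f z) has_derivative
      (\<lambda>h. (a + b * z $ i) * (\<Sum>j\<in>UNIV. h $ j * partial j f z) + b * h $ i * f z)) (at z)"
    by (auto intro!: derivative_eq_intros smooth_has_derivative[OF assms])
  moreover have "b * h $ i * f z = (\<Sum>j\<in>UNIV. h $ j * (if j = i then b * f z else 0))" for h :: "real^'n"
    by (simp add: if_distrib mult_ac cong: if_cong)
  ultimately have "((\<lambda>z. (a + b * z $ i) * f z) has_derivative
      (\<lambda>h. \<Sum>j\<in>UNIV. h $ j * ((a + b * z $ i) * partial j f z + (if j = i then b * f z else 0)))) (at z)"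
    by (simp only: distrib_left sum.distrib sum_distrib_left mult.left_commute)
  from partial_eqI[OF this, of i] show ?thesis by simp
qed

lemma partial_eq_0:
  assumes "open U" "x \<in> U" "\<And>y. y \<in> U \<Longrightarrow> f y = 0"
  shows "partial i f x = 0"
proof (rule partial_eqI[where D="\<lambda>_. 0", simplified])
  show "(f has_derivative (\<lambda>h. 0)) (at x)"
    by (rule has_derivative_transform_within_open[of "\<lambda>_. 0" _ _ _ U]) (use assms in auto)
qed

lemma smooth_compose_curve_derivative:
  assumes "smooth f" "(l has_vector_derivative v) (at s)"
  shows "((\<lambda>s. f (l s)) has_real_derivative (\<Sum>i\<in>UNIV. v $ i * partial i f (l s))) (at s)"
proof -
  have "((\<lambda>s. f (l s)) has_derivative (\<lambda>h. \<Sum>i\<in>UNIV. (h *\<^sub>R v) $ i * partial i f (l s))) (at s)"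
    by (rule has_derivative_compose[OF assms(2)[unfolded has_vector_derivative_def]
          smooth_has_derivative[OF assms(1)]])
  moreover have "(\<lambda>h. \<Sum>i\<in>UNIV. (h *\<^sub>R v) $ i * partial i f (l s)) = (*) (\<Sum>i\<in>UNIV. v $ i * partial i f (l s))"
    by (auto simp: fun_eq_iff sum_distrib_left sum_distrib_right ac_simps)
  ultimately show ?thesis unfolding has_field_derivative_def by simp
qed

lemma smooth_axis_derivative:
  assumes "smooth f" "(c has_real_derivative c') (at s)"
  shows "((\<lambda>s. f (x + c s *\<^sub>R axis i 1)) has_real_derivative c' * partial i f (x + c s *\<^sub>R axis i 1)) (at s)"
proof -
  have "((\<lambda>s. x + c s *\<^sub>R axis i 1) has_vector_derivative c' *\<^sub>R axis i 1) (at s)"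
    using assms(2) by (auto intro!: derivative_eq_intros)
  from smooth_compose_curve_derivative[OF assms(1) this] show ?thesis
    by (simp add: axis_def if_distrib if_distribR cong: if_cong)
qed

text \<open>For \<open>p = 1\<close> this is \<open>exp (- 1 / t)\<close>; the family is closed under differentiation.\<close>

definition flat_fun :: "real poly \<Rightarrow> real \<Rightarrow> real" where
  "flat_fun p t = (if t > 0 then poly p (1/t) * exp (- (1/t)) else 0)"

lemma poly_times_exp_tendsto_0: "((\<lambda>x::real. poly p x * exp (- x)) \<longlongrightarrow> 0) at_top"
proof -
  have poly_exp_eq: "poly p x * exp (- x) = (\<Sum>i\<le>degree p. coeff p i * (x ^ i / exp x))" for x
    by (simp add: poly_altdef sum_distrib_right exp_minus divide_inverse mult.assoc)
  have "((\<lambda>x. \<Sum>i\<le>degree p. coeff p i * (x ^ i / exp x)) \<longlongrightarrow> (\<Sum>i\<le>degree p. coeff p i * 0)) at_top"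
    by (intro tendsto_sum tendsto_mult tendsto_const tendsto_power_div_exp_0)
  then show ?thesis unfolding poly_exp_eq by simp
qed

lemma flat_fun_tendsto_0: "(flat_fun p \<longlongrightarrow> 0) (at 0)"
proof -
  have "((\<lambda>t. poly p (1/t) * exp (- (1/t))) \<longlongrightarrow> 0) (at_right 0)"
    using filterlim_compose[OF poly_times_exp_tendsto_0 filterlim_inverse_at_top_right]
    by (simp add: divide_inverse)
  then have "(flat_fun p \<longlongrightarrow> 0) (at_right 0)"
    by (rule Lim_transform_eventually) (auto simp: flat_fun_def eventually_at_filter)
  moreover have "(flat_fun p \<longlongrightarrow> 0) (at_left 0)"
    by (rule Lim_transform_eventually[OF tendsto_const]) (auto simp: flat_fun_def eventually_at_filter)
  ultimately show ?thesis by (simp add: filterlim_split_at)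
qed

lemma has_real_derivative_flat_fun:
  "(flat_fun p has_real_derivative flat_fun ([:0,0,1:] * (p - pderiv p)) t) (at t)"
proof (cases t "0::real" rule: linorder_cases)
  case less
  have "((\<lambda>_. 0) has_real_derivative 0) (at t)" by simp
  then have "(flat_fun p has_real_derivative 0) (at t)"
    by (rule has_field_derivative_transform_within_open[where S="{..<0}"]) (use less in \<open>auto simp: flat_fun_def\<close>)
  with less show ?thesis by (simp add: flat_fun_def)
next
  case greater
  have "((\<lambda>t. poly p (1/t) * exp (- (1/t))) has_real_derivative
     flat_fun ([:0,0,1:] * (p - pderiv p)) t) (at t)"
  proof -
    have "((\<lambda>t. 1/t) has_real_derivative - (1/t^2)) (at t)"
      using greater by (auto intro!: derivative_eq_intros simp: power2_eq_square field_simps)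
    from DERIV_mult[OF DERIV_chain2[OF poly_DERIV this] DERIV_fun_exp[OF DERIV_minus[OF this]], of p]
    show ?thesis by (rule DERIV_cong) (use greater in \<open>simp add: flat_fun_def power2_eq_square algebra_simps\<close>)
  qed
  then show ?thesis
    by (rule has_field_derivative_transform_within_open[where S="{0<..}"]) (use greater in \<open>auto simp: flat_fun_def\<close>)
next
  case equal
  have "((\<lambda>y. (flat_fun p y - flat_fun p 0) / (y - 0)) \<longlongrightarrow> 0) (at 0)"
    by (rule Lim_transform_eventually[OF flat_fun_tendsto_0[of "[:0,1:] * p"]])
      (auto simp: flat_fun_def eventually_at_filter)
  then show ?thesis unfolding has_field_derivative_iff equal by (simp add: flat_fun_def)
qed

lemma smooth_flat_fun:
  assumes "\<And>k. Ck k f" shows "Ck k (\<lambda>x. flat_fun p (f x))"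
proof -
  define P where "P k = ((\<lambda>p. [:0,0,1:] * (p - pderiv p)) ^^ k) p" for k
  have "Ck k (\<lambda>x. flat_fun (P 0) (f x))"
  proof (rule Ck_compose_real[where H="\<lambda>k. flat_fun (P k)" and m=0])
    show "(flat_fun (P k) has_real_derivative flat_fun (P (Suc k)) t) (at t)" for k t
      unfolding P_def funpow.simps o_apply by (rule has_real_derivative_flat_fun)
  qed (rule assms)
  then show ?thesis by (simp add: P_def)
qed

definition continuous_kernel :: "real^'n \<Rightarrow> real \<Rightarrow> 'n fn \<Rightarrow> bool" where
  "continuous_kernel c d \<eta> \<longleftrightarrow> continuous_on UNIV \<eta> \<and> (\<forall>z. z \<notin> cball c d \<longrightarrow> \<eta> z = 0)"

definition mollifier :: "real^'n::finite \<Rightarrow> real \<Rightarrow> 'n fn \<Rightarrow> bool" where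
  "mollifier c d \<phi> \<longleftrightarrow> smooth \<phi> \<and> continuous_kernel c d \<phi> \<and> (\<forall>z. 0 \<le> \<phi> z) \<and> integral\<^sup>L lborel \<phi> = 1"

lemma continuous_kernelD:
  assumes "continuous_kernel c d \<eta>"
  shows "continuous_on UNIV \<eta>" "z \<notin> cball c d \<Longrightarrow> \<eta> z = 0" "\<eta> \<in> borel_measurable borel"
  using assms by (auto simp: continuous_kernel_def intro: borel_measurable_continuous_onI)

lemma mollifierD:
  assumes "mollifier c d \<phi>"
  shows "smooth \<phi>" "continuous_kernel c d \<phi>" "0 \<le> \<phi> z" "integral\<^sup>L lborel \<phi> = 1"
  using assms by (auto simp: mollifier_def)

lemma continuous_kernel_affine_coordinate_mult:
  "continuous_kernel c d \<eta> \<Longrightarrow> continuous_kernel c d (\<lambda>z. (a + b * z $ i) * \<eta> z)"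
  by (auto simp: continuous_kernel_def intro!: continuous_intros)

lemma continuous_kernel_sum:
  "(\<And>i. continuous_kernel c d (\<eta> i)) \<Longrightarrow> continuous_kernel c d (\<lambda>z. \<Sum>i\<in>I. \<eta> i z)"
  by (auto simp: continuous_kernel_def intro!: continuous_intros sum.neutral)

lemma continuous_kernel_partial:
  assumes "smooth \<eta>" "continuous_kernel c d \<eta>"
  shows "continuous_kernel c d (partial i \<eta>)"
  unfolding continuous_kernel_def
  using smooth_continuous_partial[OF assms(1)] partial_eq_0[of "- cball c d" _ \<eta> i]
    continuous_kernelD(2)[OF assms(2)] by auto

definition sup_norm :: "('a \<Rightarrow> real) \<Rightarrow> real" where
  "sup_norm f = (SUP x. \<bar>f x\<bar>)"

lemma abs_le_sup_norm:
  assumes "continuous_kernel c d \<eta>"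
  shows "\<bar>\<eta> z\<bar> \<le> sup_norm \<eta>"
proof -
  have "compact (\<eta> ` cball c d)"
    by (intro compact_continuous_image continuous_on_subset[OF continuous_kernelD(1)[OF assms]]) auto
  then obtain B where B: "B > 0" "\<And>z. z \<in> cball c d \<Longrightarrow> \<bar>\<eta> z\<bar> \<le> B"
    using compact_imp_bounded[of "\<eta> ` cball c d"] unfolding bounded_pos by (metis imageI real_norm_def)
  have "\<bar>\<eta> z\<bar> \<le> B" for z
    using B continuous_kernelD(2)[OF assms, of z] by (cases "z \<in> cball c d") auto
  then show ?thesis unfolding sup_norm_def by (intro cSUP_upper bdd_aboveI2) auto
qed

lemma sup_norm_nonneg: "continuous_kernel c d \<eta> \<Longrightarrow> 0 \<le> sup_norm \<eta>"
  by (rule order_trans[OF abs_ge_zero abs_le_sup_norm])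

lemma continuous_compact_support_integrable:
  fixes f :: "'a::euclidean_space \<Rightarrow> real"
  assumes "continuous_on UNIV f" "compact K" "\<And>x. x \<notin> K \<Longrightarrow> f x = 0"
  shows "integrable lborel f"
proof -
  have "integrable lborel (\<lambda>x. indicator K x *\<^sub>R f x)"
    by (rule borel_integrable_compact[OF assms(2)]) (rule continuous_on_subset[OF assms(1)], simp)
  moreover have "(\<lambda>x. indicator K x *\<^sub>R f x) = f" using assms(3) by (auto simp: indicator_def fun_eq_iff)
  ultimately show ?thesis by simp
qed

lemma continuous_kernel_integrable: "continuous_kernel c d \<eta> \<Longrightarrow> integrable lborel \<eta>"
  by (rule continuous_compact_support_integrable[of \<eta> "cball c d"]) (auto dest: continuous_kernelD)

lemma integral_continuous_nonneg_pos:
  fixes f :: "'a::euclidean_space \<Rightarrow> real"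
  assumes cont: "continuous_on UNIV f" and int: "integrable lborel f"
    and nonneg: "\<And>x. 0 \<le> f x" and pos: "0 < f a"
  shows "0 < integral\<^sup>L lborel f"
proof -
  have "integral\<^sup>L lborel f \<noteq> 0"
  proof
    assume "integral\<^sup>L lborel f = 0"
    then have AE_zero: "AE x in lborel. f x = 0"
      using integral_nonneg_eq_0_iff_AE[OF int] nonneg by auto
    have open_pos: "open {x. f x > 0}" using cont by (simp add: open_Collect_less)
    have "{x. f x > 0} \<in> null_sets lborel"
      by (rule iffD2[OF AE_iff_null_sets]) (use open_pos AE_zero in \<open>auto elim: eventually_mono\<close>)
    then have "negligible {x. f x > 0}"
      by (simp add: negligible_iff_null_sets null_sets_completionI)
    then have "{x. f x > 0} = {}" using open_not_negligible[OF open_pos] by auto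
    with pos show False by auto
  qed
  moreover have "integral\<^sup>L lborel f \<ge> 0" using nonneg by simp
  ultimately show ?thesis by linarith
qed

lemma mollifier_exists:
  fixes c :: "real^'n"
  assumes d: "d > 0"
  obtains \<phi> where "mollifier c d \<phi>"
proof -
  define \<psi> where "\<psi> z = flat_fun 1 (d\<^sup>2 + (\<Sum>i\<in>UNIV. (-1) * ((z$i + - c$i) * (z$i + - c$i))))" for z
  have \<psi>: "\<psi> z = flat_fun 1 (d\<^sup>2 - (dist z c)\<^sup>2)" for z
    by (simp add: \<psi>_def dist_vec_def L2_set_def sum_nonneg sum_negf power2_eq_square dist_real_def)
  have Ck: "Ck k \<psi>" for k unfolding \<psi>_def
    by (intro smooth_flat_fun Ck_add Ck_sum Ck_mult Ck_const Ck_nth)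
  have nonneg: "\<psi> z \<ge> 0" for z unfolding \<psi> by (simp add: flat_fun_def)
  have zero: "\<psi> z = 0" if "z \<notin> cball c d" for z
  proof -
    have "d < dist z c" using that by (simp add: dist_commute)
    then have "d\<^sup>2 < (dist z c)\<^sup>2" using d by (intro power_strict_mono) auto
    then show ?thesis unfolding \<psi> by (simp add: flat_fun_def)
  qed
  have cont: "continuous_on UNIV \<psi>" using Ck Ck_continuous by blast
  have "integrable lborel \<psi>"
    by (rule continuous_compact_support_integrable[OF cont, of "cball c d"]) (use zero in auto)
  then have pos: "integral\<^sup>L lborel \<psi> > 0"
    by (rule integral_continuous_nonneg_pos[OF cont _ nonneg, where a=c]) (use d in \<open>simp add: \<psi> flat_fun_def\<close>)
  define \<phi> where "\<phi> z = (1 / integral\<^sup>L lborel \<psi>) * \<psi> z" for z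
  have "smooth \<phi>" unfolding smooth_def \<phi>_def by (intro allI Ck_mult Ck_const Ck)
  moreover have "continuous_kernel c d \<phi>"
    unfolding continuous_kernel_def \<phi>_def using cont zero pos by (auto intro!: continuous_intros)
  moreover have "0 \<le> \<phi> z" for z using nonneg pos by (simp add: \<phi>_def)
  moreover have "integral\<^sup>L lborel \<phi> = 1"
    unfolding \<phi>_def using pos by (subst integral_mult_right_zero) simp
  ultimately show ?thesis by (intro that[of \<phi>]) (simp add: mollifier_def)
qed

section \<open>Mollification in the space of integrable functions\<close>

lemma nn_integral_lborel_affine:
  fixes f :: "'a::euclidean_space \<Rightarrow> ennreal"
  assumes [measurable]: "f \<in> borel_measurable borel" and "c \<noteq> 0"
  shows "(\<integral>\<^sup>+x. f x \<partial>lborel) = ennreal (\<bar>c\<bar> ^ DIM('a)) * (\<integral>\<^sup>+x. f (t + c *\<^sub>R x) \<partial>lborel)"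
  by (subst lborel_affine[OF assms(2), of t])
    (simp add: nn_integral_density nn_integral_distr nn_integral_cmult)

lemma integral_lborel_affine:
  fixes f :: "'a::euclidean_space \<Rightarrow> real"
  assumes [measurable]: "f \<in> borel_measurable borel" and "c \<noteq> 0"
  shows "(\<integral>x. f x \<partial>lborel) = \<bar>c\<bar> ^ DIM('a) * (\<integral>x. f (t + c *\<^sub>R x) \<partial>lborel)"
  by (subst lborel_affine[OF assms(2), of t])
    (simp add: integral_density integral_distr)

lemma integrable_lborel_affine:
  fixes f :: "'a::euclidean_space \<Rightarrow> real"
  assumes f: "integrable lborel f" and "c \<noteq> 0"
  shows "integrable lborel (\<lambda>x. f (t + c *\<^sub>R x))"
proof -
  have [measurable]: "f \<in> borel_measurable borel" using f by auto
  show ?thesis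
  proof (rule integrableI_bounded)
    have "(\<integral>\<^sup>+ x. ennreal (norm (f x)) \<partial>lborel) < \<infinity>" using f by (simp add: integrable_iff_bounded)
    then show "(\<integral>\<^sup>+ x. ennreal (norm (f (t + c *\<^sub>R x))) \<partial>lborel) < \<infinity>"
      by (subst (asm) nn_integral_lborel_affine[OF _ assms(2), of _ t])
        (auto simp: ennreal_mult_less_top assms(2))
  qed simp
qed

lemma integrable_lborel_translate:
  fixes f :: "'a::euclidean_space \<Rightarrow> real"
  shows "integrable lborel f \<Longrightarrow> integrable lborel (\<lambda>x. f (x + h))"
  using integrable_lborel_affine[of f 1 h] by (simp add: add.commute)

lemma integral_lborel_translate:
  fixes f :: "'a::euclidean_space \<Rightarrow> real"
  shows "f \<in> borel_measurable borel \<Longrightarrow> (\<integral>x. f (x + h) \<partial>lborel) = (\<integral>x. f x \<partial>lborel)"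
  using integral_lborel_affine[of f 1 h] by (simp add: add.commute)

definition translation_modulus :: "('a::euclidean_space \<Rightarrow> real) \<Rightarrow> 'a \<Rightarrow> real" where
  "translation_modulus f h = (\<integral>x. \<bar>f (x + h) - f x\<bar> \<partial>lborel)"

lemma translation_modulus_nonneg: "0 \<le> translation_modulus f h"
  by (simp add: translation_modulus_def)

lemma borel_measurable_translation_modulus[measurable]:
  assumes [measurable]: "f \<in> borel_measurable borel"
  shows "translation_modulus f \<in> borel_measurable borel"
  unfolding translation_modulus_def[abs_def] by measurable

lemma translation_modulus_cmult: "translation_modulus (\<lambda>x. c * f x) h = \<bar>c\<bar> * translation_modulus f h"
  by (simp add: translation_modulus_def abs_mult right_diff_distrib[symmetric])

lemma translation_modulus_add_le:
  assumes "integrable lborel f" "integrable lborel g"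
  shows "translation_modulus (\<lambda>x. f x + g x) h \<le> translation_modulus f h + translation_modulus g h"
  unfolding translation_modulus_def
  using integrable_lborel_translate[OF assms(1), of h] integrable_lborel_translate[OF assms(2), of h] assms
  by (subst Bochner_Integration.integral_add[symmetric])
    (auto intro!: integral_mono simp del: Bochner_Integration.integral_add)

lemma translation_modulus_le:
  assumes f: "integrable lborel f"
  shows "translation_modulus f h \<le> 2 * (\<integral>x. \<bar>f x\<bar> \<partial>lborel)"
proof -
  have [measurable]: "f \<in> borel_measurable borel" using f by auto
  have f_translate: "integrable lborel (\<lambda>x. f (x + h))" by (rule integrable_lborel_translate[OF f])
  have "translation_modulus f h \<le> (\<integral>x. \<bar>f (x + h)\<bar> + \<bar>f x\<bar> \<partial>lborel)"
    unfolding translation_modulus_def using f f_translate by (intro integral_mono) auto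
  also have "\<dots> = 2 * (\<integral>x. \<bar>f x\<bar> \<partial>lborel)"
    using f f_translate integral_lborel_translate[of "\<lambda>x. \<bar>f x\<bar>" h] by simp
  finally show ?thesis .
qed

lemma translation_modulus_tendsto_0_closure:
  fixes f :: "'a::euclidean_space \<Rightarrow> real"
  assumes f: "integrable lborel f"
    and approx: "\<And>e. e > 0 \<Longrightarrow> \<exists>g. integrable lborel g \<and> (\<integral>x. \<bar>f x - g x\<bar> \<partial>lborel) < e \<and>
       (\<lambda>n. translation_modulus g (h n)) \<longlonglongrightarrow> 0"
  shows "(\<lambda>n. translation_modulus f (h n)) \<longlonglongrightarrow> 0"
proof (rule LIMSEQ_I)
  fix e :: real assume "e > 0"
  then obtain g where g: "integrable lborel g" "(\<integral>x. \<bar>f x - g x\<bar> \<partial>lborel) < e/4"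
    "(\<lambda>n. translation_modulus g (h n)) \<longlonglongrightarrow> 0" using approx[of "e/4"] by auto
  from LIMSEQ_D[OF g(3), of "e/2"] \<open>e > 0\<close> obtain N where
    N: "\<And>n. n \<ge> N \<Longrightarrow> translation_modulus g (h n) < e/2"
    by (auto simp: translation_modulus_nonneg)
  have modulus_le: "translation_modulus f (h n) \<le> 2 * (\<integral>x. \<bar>f x - g x\<bar> \<partial>lborel) + translation_modulus g (h n)" for n
    using translation_modulus_add_le[of "\<lambda>x. f x - g x" g "h n"] translation_modulus_le[of "\<lambda>x. f x - g x" "h n"]
      f g(1) by simp
  have "norm (translation_modulus f (h n) - 0) < e" if "n \<ge> N" for n
    using N[OF that] modulus_le[of n] g(2) translation_modulus_nonneg[of f "h n"] by simp
  then show "\<exists>N. \<forall>n\<ge>N. norm (translation_modulus f (h n) - 0) < e" by blast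
qed

lemma translation_modulus_indicator_eq:
  fixes U :: "'a::euclidean_space set"
  assumes [measurable]: "U \<in> sets borel" and fin: "emeasure lborel U < \<infinity>"
  shows "translation_modulus (indicator U) h = 2 * (\<integral>x. indicator U x * (1 - indicator U (x + h)) \<partial>lborel)"
proof -
  let ?I = "indicator U :: 'a \<Rightarrow> real"
  have I_integrable: "integrable lborel ?I" using fin by (simp add: integrable_indicator_iff)
  have product_integrable: "integrable lborel (\<lambda>x. ?I x * (1 - ?I (x + h)))"
    by (rule Bochner_Integration.integrable_bound[OF I_integrable]) (auto simp: indicator_def)
  have "translation_modulus ?I h = (\<integral>x. (?I (x + h) - ?I x) + 2 * (?I x * (1 - ?I (x + h))) \<partial>lborel)"
    unfolding translation_modulus_def by (rule Bochner_Integration.integral_cong) (auto simp: indicator_def)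
  also have "\<dots> = ((\<integral>x. ?I (x + h) \<partial>lborel) - (\<integral>x. ?I x \<partial>lborel)) + 2 * (\<integral>x. ?I x * (1 - ?I (x + h)) \<partial>lborel)"
    using I_integrable product_integrable integrable_lborel_translate[OF I_integrable, of h] by simp
  finally show ?thesis using integral_lborel_translate[of ?I h] by simp
qed

lemma translation_modulus_indicator_open:
  fixes U :: "'a::euclidean_space set"
  assumes U: "open U" "emeasure lborel U < \<infinity>" and h: "h \<longlonglongrightarrow> 0"
  shows "(\<lambda>n. translation_modulus (indicator U) (h n)) \<longlonglongrightarrow> 0"
proof -
  let ?I = "indicator U :: 'a \<Rightarrow> real"
  have [measurable]: "U \<in> sets borel" using U by auto
  have "(\<lambda>n. \<integral>x. ?I x * (1 - ?I (x + h n)) \<partial>lborel) \<longlonglongrightarrow> (\<integral>x. 0 \<partial>(lborel::'a measure))"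
  proof (rule integral_dominated_convergence[where w="?I"])
    have "(\<lambda>n. ?I x * (1 - ?I (x + h n))) \<longlonglongrightarrow> 0" for x
    proof (cases "x \<in> U")
      case True
      have "(\<lambda>n. x + h n) \<longlonglongrightarrow> x + 0" by (intro tendsto_intros h)
      then have "eventually (\<lambda>n. x + h n \<in> U) sequentially"
        using topological_tendstoD[OF _ U(1)] True by simp
      then have "eventually (\<lambda>n. ?I x * (1 - ?I (x + h n)) = 0) sequentially"
        by eventually_elim simp
      then show ?thesis by (rule tendsto_eventually)
    qed simp
    then show "AE x in lborel. (\<lambda>n. ?I x * (1 - ?I (x + h n))) \<longlonglongrightarrow> 0" by simp
    show "integrable lborel ?I" using U by (simp add: integrable_indicator_iff)
  qed (auto simp: indicator_def)
  then have "(\<lambda>n. 2 * (\<integral>x. ?I x * (1 - ?I (x + h n)) \<partial>lborel)) \<longlonglongrightarrow> 2 * 0"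
    by (intro tendsto_mult tendsto_const) simp
  then show ?thesis using U(2) by (simp add: translation_modulus_indicator_eq)
qed

lemma translation_modulus_indicator:
  fixes A :: "'a::euclidean_space set"
  assumes A: "A \<in> sets borel" "emeasure lborel A < \<infinity>" and h: "h \<longlonglongrightarrow> 0"
  shows "(\<lambda>n. translation_modulus (indicator A) (h n)) \<longlonglongrightarrow> 0"
proof (rule translation_modulus_tendsto_0_closure)
  show "integrable lborel (indicator A :: 'a \<Rightarrow> real)" using A by (simp add: integrable_indicator_iff)
  fix e :: real assume e: "e > 0"
  from outer_regular_lborel[OF A(1) e] obtain U where
    U: "open U" "A \<subseteq> U" "emeasure lborel (U - A) < e" by metis
  have [measurable]: "U \<in> sets borel" "A \<in> sets borel" using U A by auto
  have "emeasure lborel U = emeasure lborel A + emeasure lborel (U - A)"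
    using U by (subst plus_emeasure) (auto simp: Un_absorb1)
  moreover have fin: "emeasure lborel (U - A) < \<infinity>" using U(3) by (auto intro: order.strict_trans)
  ultimately have U_fin: "emeasure lborel U < \<infinity>" using A(2) by simp
  have "(\<integral>x. \<bar>indicator A x - indicator U x :: real\<bar> \<partial>lborel) = (\<integral>x. indicator (U - A) x \<partial>lborel)"
    by (rule Bochner_Integration.integral_cong) (use U(2) in \<open>auto simp: indicator_def split: if_splits\<close>)
  also have "\<dots> < e"
    using U(3) fin e by (simp add: emeasure_eq_ennreal_measure ennreal_less_iff)
  finally show "\<exists>g. integrable lborel g \<and> (\<integral>x. \<bar>indicator A x - g x\<bar> \<partial>lborel) < e \<and>
      (\<lambda>n. translation_modulus g (h n)) \<longlonglongrightarrow> 0"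
    using U_fin translation_modulus_indicator_open[OF U(1) U_fin h]
    by (intro exI[of _ "indicator U"]) (simp add: integrable_indicator_iff)
qed

lemma translation_modulus_tendsto_0:
  fixes f :: "'a::euclidean_space \<Rightarrow> real"
  assumes f: "integrable lborel f" and h: "h \<longlonglongrightarrow> 0"
  shows "(\<lambda>n. translation_modulus f (h n)) \<longlonglongrightarrow> 0"
  using f
proof (induction rule: integrable_induct)
  case (base A c)
  have "(\<lambda>n. \<bar>c\<bar> * translation_modulus (indicator A) (h n)) \<longlonglongrightarrow> \<bar>c\<bar> * 0"
    by (intro tendsto_mult tendsto_const translation_modulus_indicator h) (use base in auto)
  then show ?case by (simp add: translation_modulus_cmult mult.commute[of _ c])
next
  case (add f g)
  have "(\<lambda>n. translation_modulus f (h n) + translation_modulus g (h n)) \<longlonglongrightarrow> 0 + 0"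
    by (intro tendsto_add add)
  then have sum: "(\<lambda>n. translation_modulus f (h n) + translation_modulus g (h n)) \<longlonglongrightarrow> 0" by simp
  show ?case
    by (rule Lim_null_comparison[OF _ sum])
      (simp add: translation_modulus_nonneg translation_modulus_add_le add.hyps)
next
  case (lim f s)
  show ?case
  proof (rule translation_modulus_tendsto_0_closure)
    fix e :: real assume e: "e > 0"
    have "(\<lambda>i. \<integral>x. \<bar>f x - s i x\<bar> \<partial>lborel) \<longlonglongrightarrow> (\<integral>x. 0 \<partial>(lborel::'a measure))"
    proof (rule integral_dominated_convergence[where w="\<lambda>x. 3 * \<bar>f x\<bar>"])
      have "(\<lambda>i. \<bar>f x - s i x\<bar>) \<longlonglongrightarrow> 0" for x
        using tendsto_rabs[OF tendsto_diff[OF tendsto_const[of "f x"] lim.hyps(2)[of x]]] by simp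
      then show "AE x in lborel. (\<lambda>i. \<bar>f x - s i x\<bar>) \<longlonglongrightarrow> 0" by simp
      show "AE x in lborel. norm \<bar>f x - s i x\<bar> \<le> 3 * \<bar>f x\<bar>" for i
        using lim.hyps(3)[of _ i] by (intro AE_I2) (smt (verit) UNIV_I real_norm_def space_lborel)
    qed (use lim in auto)
    then have "(\<lambda>i. \<integral>x. \<bar>f x - s i x\<bar> \<partial>lborel) \<longlonglongrightarrow> 0" by simp
    from LIMSEQ_D[OF this e] obtain i where "(\<integral>x. \<bar>f x - s i x\<bar> \<partial>lborel) < e" by auto
    then show "\<exists>g. integrable lborel g \<and> (\<integral>x. \<bar>f x - g x\<bar> \<partial>lborel) < e \<and>
       (\<lambda>n. translation_modulus g (h n)) \<longlonglongrightarrow> 0"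
      using lim by (intro exI[of _ "s i"]) auto
  qed (use lim in auto)
qed

definition mollify :: "'n::finite fn \<Rightarrow> real \<Rightarrow> 'n fn \<Rightarrow> 'n fn" where
  "mollify \<eta> t f x = (\<integral>z. f (x + t *\<^sub>R z) * \<eta> z \<partial>lborel)"

lemma scaled_mem_cball_iff:
  fixes x c z :: "'a::real_normed_vector"
  assumes "t > 0"
  shows "x + t *\<^sub>R z \<in> cball (x + t *\<^sub>R c) (t * d) \<longleftrightarrow> z \<in> cball c d"
  using assms by (simp add: dist_norm scaleR_right_diff_distrib[symmetric])

lemma inverse_scaled_mem_cball_iff:
  fixes x c y :: "'a::real_normed_vector"
  assumes "t > 0"
  shows "(1/t) *\<^sub>R (y - x) \<in> cball c d \<longleftrightarrow> y \<in> cball (x + t *\<^sub>R c) (t * d)"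
  using scaled_mem_cball_iff[OF assms, of x "(1/t) *\<^sub>R (y - x)" c d] assms by simp

lemma borel_measurable_mollify[measurable]:
  assumes [measurable]: "f \<in> borel_measurable borel" "\<eta> \<in> borel_measurable borel"
  shows "mollify \<eta> t f \<in> borel_measurable borel"
  unfolding mollify_def[abs_def] by measurable

definition scaled_kernel :: "'n::finite fn \<Rightarrow> real \<Rightarrow> real^'n \<Rightarrow> 'n fn" where
  "scaled_kernel \<eta> t x y = 1 / t ^ CARD('n) * \<eta> ((1/t) *\<^sub>R (y - x))"

lemma borel_measurable_scaled_kernel[measurable]:
  assumes [measurable]: "\<eta> \<in> borel_measurable borel"
  shows "scaled_kernel \<eta> t x \<in> borel_measurable borel"
  unfolding scaled_kernel_def[abs_def] by measurable

lemma scaled_kernel_eq_0: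
  assumes "continuous_kernel c d \<eta>" "t > 0" "y \<notin> cball (x + t *\<^sub>R c) (t * d)"
  shows "scaled_kernel \<eta> t x y = 0"
  using continuous_kernelD(2)[OF assms(1)] assms(3)
  unfolding inverse_scaled_mem_cball_iff[OF assms(2), symmetric] by (simp add: scaled_kernel_def)

lemma abs_scaled_kernel_le:
  fixes \<eta> :: "'n::finite fn"
  assumes "continuous_kernel c d \<eta>" "t > 0"
  shows "\<bar>scaled_kernel \<eta> t x y\<bar> \<le> sup_norm \<eta> / t ^ CARD('n)"
  using abs_le_sup_norm[OF assms(1)] assms(2) by (simp add: scaled_kernel_def abs_mult divide_right_mono)

lemma mollify_eq_integral_scaled_kernel:
  assumes t: "t > 0" and [measurable]: "f \<in> borel_measurable borel" "\<eta> \<in> borel_measurable borel"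
  shows "mollify \<eta> t f x = (\<integral>y. f y * scaled_kernel \<eta> t x y \<partial>lborel)"
  using t unfolding mollify_def
  by (subst (2) integral_lborel_affine[of _ t x]) (auto simp: scaled_kernel_def)

lemma mollify_cong:
  assumes "continuous_kernel c d \<eta>" "t > 0"
    and "\<And>y. y \<in> cball (x + t *\<^sub>R c) (t * d) \<Longrightarrow> f y = g y"
  shows "mollify \<eta> t f x = mollify \<eta> t g x"
proof -
  have "f (x + t *\<^sub>R z) * \<eta> z = g (x + t *\<^sub>R z) * \<eta> z" for z
    using assms(3)[of "x + t *\<^sub>R z"] continuous_kernelD(2)[OF assms(1), of z]
    unfolding scaled_mem_cball_iff[OF assms(2)] by (cases "z \<in> cball c d") auto
  then show ?thesis by (simp only: mollify_def)
qed

lemma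
  fixes f :: "'n::finite fn"
  assumes f: "set_integrable lborel K f" "f \<in> borel_measurable borel" and \<eta>: "continuous_kernel c d \<eta>"
    and t: "t > 0" and K: "cball (x + t *\<^sub>R c) (t * d) \<subseteq> K"
  shows integrable_mult_scaled_kernel: "integrable lborel (\<lambda>y. f y * scaled_kernel \<eta> t x y)"
    and mollify_bound: "\<bar>mollify \<eta> t f x\<bar> \<le> sup_norm \<eta> / t ^ CARD('n) * (LINT y:K|lborel. \<bar>f y\<bar>)"
proof -
  note [measurable] = f(2) continuous_kernelD(3)[OF \<eta>]
  have dominated: "\<bar>f y * scaled_kernel \<eta> t x y\<bar> \<le> sup_norm \<eta> / t ^ CARD('n) * \<bar>indicator K y * f y\<bar>" for y
  proof (cases "y \<in> K")
    case True
    then show ?thesis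
      using abs_scaled_kernel_le[OF \<eta> t, of x y] mult_left_mono[of _ _ "\<bar>f y\<bar>"]
      by (fastforce simp: abs_mult mult.commute)
  next
    case False
    then have "scaled_kernel \<eta> t x y = 0" using scaled_kernel_eq_0[OF \<eta> t] K by blast
    then show ?thesis using False by simp
  qed
  have bound: "integrable lborel (\<lambda>y. sup_norm \<eta> / t ^ CARD('n) * \<bar>indicator K y * f y\<bar>)"
    using f(1) by (simp add: set_integrable_def)
  then show int: "integrable lborel (\<lambda>y. f y * scaled_kernel \<eta> t x y)"
    by (rule Bochner_Integration.integrable_bound)
      (simp_all only: AE_I2 real_norm_def order_trans[OF dominated abs_ge_self], simp)
  have "\<bar>mollify \<eta> t f x\<bar> = \<bar>\<integral>y. f y * scaled_kernel \<eta> t x y \<partial>lborel\<bar>"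
    using t by (simp add: mollify_eq_integral_scaled_kernel)
  also have "\<dots> \<le> (\<integral>y. sup_norm \<eta> / t ^ CARD('n) * \<bar>indicator K y * f y\<bar> \<partial>lborel)"
    by (rule order_trans[OF integral_abs_bound integral_mono[OF integrable_abs[OF int] bound dominated]])
  also have "\<dots> = sup_norm \<eta> / t ^ CARD('n) * (LINT y:K|lborel. \<bar>f y\<bar>)"
    by (simp add: set_lebesgue_integral_def abs_mult)
  finally show "\<bar>mollify \<eta> t f x\<bar> \<le> sup_norm \<eta> / t ^ CARD('n) * (LINT y:K|lborel. \<bar>f y\<bar>)" .
qed

lemma mollify_diff_abs_le:
  fixes f :: "'n::finite fn"
  assumes f: "integrable lborel f" and \<phi>: "mollifier c d \<phi>" and t: "t > 0"
  shows "ennreal \<bar>mollify \<phi> t f x - f x\<bar> \<le> (\<integral>\<^sup>+z. ennreal (\<phi> z * \<bar>f (x + t *\<^sub>R z) - f x\<bar>) \<partial>lborel)"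
proof -
  note \<phi>D = mollifierD[OF \<phi>]
  have "integrable lborel (\<lambda>y. f y * scaled_kernel \<phi> t x y)"
    using integrable_mult_scaled_kernel[of UNIV f c d \<phi> t x] f \<phi>D(2) t by (auto simp: set_integrable_def)
  from integrable_mult_right[OF integrable_lborel_affine[OF this, of t x], of "t ^ CARD('n)"]
  have int: "integrable lborel (\<lambda>z. f (x + t *\<^sub>R z) * \<phi> z)" "integrable lborel (\<lambda>z. f x * \<phi> z)"
    using t continuous_kernel_integrable[OF \<phi>D(2)] by (simp_all add: scaled_kernel_def)
  have "mollify \<phi> t f x - f x = (\<integral>z. f (x + t *\<^sub>R z) * \<phi> z \<partial>lborel) - (\<integral>z. f x * \<phi> z \<partial>lborel)"
    using \<phi>D(4) by (simp add: mollify_def)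
  also have "\<dots> = (\<integral>z. \<phi> z * (f (x + t *\<^sub>R z) - f x) \<partial>lborel)"
    by (subst Bochner_Integration.integral_diff[OF int, symmetric]) (simp add: algebra_simps)
  finally have "ennreal \<bar>mollify \<phi> t f x - f x\<bar> \<le> (\<integral>\<^sup>+z. ennreal \<bar>\<phi> z * (f (x + t *\<^sub>R z) - f x)\<bar> \<partial>lborel)"
    using integral_norm_bound_ennreal[of lborel "\<lambda>z. \<phi> z * (f (x + t *\<^sub>R z) - f x)"]
      Bochner_Integration.integrable_diff[OF int] by (simp add: algebra_simps)
  then show ?thesis using \<phi>D(3) by (simp add: abs_mult)
qed

lemma
  fixes f :: "'n::finite fn"
  assumes f: "integrable lborel f" and \<phi>: "mollifier c d \<phi>" and t: "t > 0"
  shows integrable_mollify: "integrable lborel (mollify \<phi> t f)"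
    and mollify_L1_distance_le:
      "(\<integral>x. \<bar>mollify \<phi> t f x - f x\<bar> \<partial>lborel) \<le> (\<integral>z. \<phi> z * translation_modulus f (t *\<^sub>R z) \<partial>lborel)"
    and integrable_mollifier_translation_modulus:
      "integrable lborel (\<lambda>z. \<phi> z * translation_modulus f (t *\<^sub>R z))"
proof -
  note \<phi>D = mollifierD[OF \<phi>]
  have [measurable]: "f \<in> borel_measurable borel" using f by auto
  note [measurable] = continuous_kernelD(3)[OF \<phi>D(2)]
  let ?R = "\<lambda>z. \<phi> z * translation_modulus f (t *\<^sub>R z)"
  show R: "integrable lborel ?R"
  proof (rule Bochner_Integration.integrable_bound)
    show "integrable lborel (\<lambda>z. \<phi> z * (2 * (\<integral>x. \<bar>f x\<bar> \<partial>lborel)))"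
      using continuous_kernel_integrable[OF \<phi>D(2)] by simp
    show "AE z in lborel. norm (?R z) \<le> norm (\<phi> z * (2 * (\<integral>x. \<bar>f x\<bar> \<partial>lborel)))"
      using \<phi>D(3) translation_modulus_nonneg[of f] translation_modulus_le[OF f]
      by (intro AE_I2) (simp add: abs_mult mult_left_mono)
  qed simp
  have "(\<integral>\<^sup>+x. ennreal \<bar>mollify \<phi> t f x - f x\<bar> \<partial>lborel)
     \<le> (\<integral>\<^sup>+x. (\<integral>\<^sup>+z. ennreal (\<phi> z * \<bar>f (x + t *\<^sub>R z) - f x\<bar>) \<partial>lborel) \<partial>lborel)"
    by (intro nn_integral_mono mollify_diff_abs_le[OF f \<phi> t])
  also have "\<dots> = (\<integral>\<^sup>+z. (\<integral>\<^sup>+x. ennreal (\<phi> z * \<bar>f (x + t *\<^sub>R z) - f x\<bar>) \<partial>lborel) \<partial>lborel)"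
    by (rule lborel_pair.Fubini') measurable
  also have "\<dots> = (\<integral>\<^sup>+z. ennreal (?R z) \<partial>lborel)"
  proof (rule nn_integral_cong)
    fix z
    have "integrable lborel (\<lambda>x. \<phi> z * \<bar>f (x + t *\<^sub>R z) - f x\<bar>)"
      using integrable_lborel_translate[OF f, of "t *\<^sub>R z"] f by auto
    then show "(\<integral>\<^sup>+x. ennreal (\<phi> z * \<bar>f (x + t *\<^sub>R z) - f x\<bar>) \<partial>lborel) = ennreal (?R z)"
      using \<phi>D(3) by (subst nn_integral_eq_integral) (auto simp: translation_modulus_def)
  qed
  also have "\<dots> = ennreal (\<integral>z. ?R z \<partial>lborel)"
    using \<phi>D(3) translation_modulus_nonneg[of f] by (intro nn_integral_eq_integral[OF R]) simp
  finally have L1_le: "(\<integral>\<^sup>+x. ennreal \<bar>mollify \<phi> t f x - f x\<bar> \<partial>lborel) \<le> ennreal (\<integral>z. ?R z \<partial>lborel)" .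
  have diff_integrable: "integrable lborel (\<lambda>x. mollify \<phi> t f x - f x)"
    by (rule integrableI_bounded) (use le_less_trans[OF L1_le ennreal_less_top] in auto)
  from Bochner_Integration.integrable_add[OF diff_integrable f] show "integrable lborel (mollify \<phi> t f)" by simp
  show "(\<integral>x. \<bar>mollify \<phi> t f x - f x\<bar> \<partial>lborel) \<le> (\<integral>z. ?R z \<partial>lborel)"
    using L1_le diff_integrable \<phi>D(3) translation_modulus_nonneg[of f]
    by (subst (asm) nn_integral_eq_integral) (auto simp: integral_nonneg_AE)
qed

lemma mollify_tendsto_L1:
  fixes f :: "'n::finite fn"
  assumes f: "integrable lborel f" and \<phi>: "mollifier c d \<phi>" and t: "\<And>n. t n > 0" "t \<longlonglongrightarrow> 0"
  shows "(\<lambda>n. \<integral>x. \<bar>mollify \<phi> (t n) f x - f x\<bar> \<partial>lborel) \<longlonglongrightarrow> 0"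
proof -
  note \<phi>D = mollifierD[OF \<phi>]
  let ?R = "\<lambda>n z. \<phi> z * translation_modulus f (t n *\<^sub>R z)"
  have "(\<lambda>n. \<integral>z. ?R n z \<partial>lborel) \<longlonglongrightarrow> (\<integral>z. 0 \<partial>(lborel::(real^'n) measure))"
  proof (rule integral_dominated_convergence)
    show "integrable lborel (\<lambda>z. \<phi> z * (2 * (\<integral>x. \<bar>f x\<bar> \<partial>lborel)))"
      using continuous_kernel_integrable[OF \<phi>D(2)] by simp
    have "(\<lambda>n. ?R n z) \<longlonglongrightarrow> 0" for z
    proof -
      have "(\<lambda>n. t n *\<^sub>R z) \<longlonglongrightarrow> 0 *\<^sub>R z" by (rule tendsto_scaleR[OF t(2) tendsto_const])
      then have "(\<lambda>n. ?R n z) \<longlonglongrightarrow> \<phi> z * 0"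
        by (intro tendsto_mult tendsto_const translation_modulus_tendsto_0 f) simp
      then show ?thesis by simp
    qed
    then show "AE z in lborel. (\<lambda>n. ?R n z) \<longlonglongrightarrow> 0" by simp
    show "AE z in lborel. norm (?R n z) \<le> \<phi> z * (2 * (\<integral>x. \<bar>f x\<bar> \<partial>lborel))" for n
      using \<phi>D(3) translation_modulus_nonneg[of f] translation_modulus_le[OF f]
      by (intro AE_I2) (simp add: abs_mult mult_left_mono)
    show "?R n \<in> borel_measurable lborel" for n
      using integrable_mollifier_translation_modulus[OF f \<phi> t(1)] by auto
  qed simp
  then have lim: "(\<lambda>n. \<integral>z. ?R n z \<partial>lborel) \<longlonglongrightarrow> 0" by simp
  show ?thesis
    by (rule Lim_null_comparison[OF always_eventually lim])
      (use mollify_L1_distance_le[OF f \<phi> t(1)] in auto)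
qed

lemma mollify_AE_subseq:
  fixes f :: "'n::finite fn"
  assumes f: "integrable lborel f" and \<phi>: "mollifier c d \<phi>" and t: "\<And>n. t n > 0" "t \<longlonglongrightarrow> 0"
  obtains r where "strict_mono r" "AE x in lborel. (\<lambda>n. mollify \<phi> (t (r n)) f x) \<longlonglongrightarrow> f x"
proof -
  have "integrable lborel (\<lambda>x. mollify \<phi> (t n) f x - f x)" for n
    using integrable_mollify[OF f \<phi> t(1)] f by simp
  from tendsto_L1_AE_subseq[of lborel "\<lambda>n x. mollify \<phi> (t n) f x - f x", OF this] mollify_tendsto_L1[OF f \<phi> t]
  obtain r where "strict_mono r" "AE x in lborel. (\<lambda>n. mollify \<phi> (t (r n)) f x - f x) \<longlonglongrightarrow> 0" by auto
  then show ?thesis by (intro that[of r]) (simp_all add: LIM_zero_iff)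
qed

section \<open>Weak gradients\<close>

lemma difference_quotient_le:
  fixes f :: "real \<Rightarrow> real"
  assumes "\<And>s. \<bar>s - a\<bar> < d \<Longrightarrow> (f has_real_derivative f' s) (at s)" "\<And>s. \<bar>s - a\<bar> < d \<Longrightarrow> \<bar>f' s\<bar> \<le> B"
    and s: "\<bar>s - a\<bar> < d" "s \<noteq> a"
  shows "\<bar>(f s - f a) / (s - a)\<bar> \<le> B"
proof -
  have "norm (f s - f a) \<le> B * norm (s - a)"
  proof (rule field_differentiable_bound[of "{a-d<..<a+d}" f f'])
    fix r assume "r \<in> {a-d<..<a+d}"
    then have "\<bar>r - a\<bar> < d" by auto
    with assms(1,2) show "(f has_field_derivative f' r) (at r within {a-d<..<a+d})" "norm (f' r) \<le> B"
      by (auto intro: has_field_derivative_at_within)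
  qed (use s in auto)
  then show ?thesis using s(2) by (simp add: abs_divide divide_le_eq)
qed

lemma has_real_derivative_under_integral:
  fixes \<Phi> :: "real \<Rightarrow> 'a \<Rightarrow> real"
  assumes d: "d > 0"
    and der: "\<And>s y. \<bar>s - a\<bar> < d \<Longrightarrow> ((\<lambda>s. \<Phi> s y) has_real_derivative \<Phi>' s y) (at s)"
    and int: "\<And>s. \<bar>s - a\<bar> < d \<Longrightarrow> integrable M (\<Phi> s)"
    and meas: "\<Phi>' a \<in> borel_measurable M"
    and bound: "\<And>s y. \<bar>s - a\<bar> < d \<Longrightarrow> \<bar>\<Phi>' s y\<bar> \<le> w y" and w: "integrable M w"
  shows "((\<lambda>s. \<integral>y. \<Phi> s y \<partial>M) has_real_derivative (\<integral>y. \<Phi>' a y \<partial>M)) (at a)"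
  unfolding has_field_derivative_iff tendsto_at_iff_sequentially comp_def
proof (intro allI impI)
  fix X :: "nat \<Rightarrow> real" assume X: "\<forall>i. X i \<in> UNIV - {a}" "X \<longlonglongrightarrow> a"
  from LIMSEQ_D[OF X(2) d] obtain N where N: "\<And>n. n \<ge> N \<Longrightarrow> \<bar>X n - a\<bar> < d" by auto
  define Y where "Y n = X (n + N)" for n
  have Y: "\<bar>Y n - a\<bar> < d" "Y n \<noteq> a" for n using N X(1) by (auto simp: Y_def)
  have Y_lim: "Y \<longlonglongrightarrow> a" unfolding Y_def using X(2) by (rule LIMSEQ_ignore_initial_segment)
  have "(\<lambda>n. \<integral>y. (\<Phi> (Y n) y - \<Phi> a y) / (Y n - a) \<partial>M) \<longlonglongrightarrow> (\<integral>y. \<Phi>' a y \<partial>M)"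
  proof (rule integral_dominated_convergence[OF meas _ w])
    have "integrable M (\<Phi> (Y n))" "integrable M (\<Phi> a)" for n using int Y d by auto
    then show "(\<lambda>y. (\<Phi> (Y n) y - \<Phi> a y) / (Y n - a)) \<in> borel_measurable M" for n
      by (auto dest!: borel_measurable_integrable)
    have "(\<lambda>n. (\<Phi> (Y n) y - \<Phi> a y) / (Y n - a)) \<longlonglongrightarrow> \<Phi>' a y" for y
      using der[of a y] d Y Y_lim
      unfolding has_field_derivative_iff tendsto_at_iff_sequentially comp_def by auto
    then show "AE y in M. (\<lambda>n. (\<Phi> (Y n) y - \<Phi> a y) / (Y n - a)) \<longlonglongrightarrow> \<Phi>' a y" by simp
    show "AE y in M. norm ((\<Phi> (Y n) y - \<Phi> a y) / (Y n - a)) \<le> w y" for n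
      unfolding real_norm_def by (intro AE_I2 difference_quotient_le[OF der bound Y])
  qed
  moreover have "(\<integral>y. (\<Phi> (Y n) y - \<Phi> a y) / (Y n - a) \<partial>M)
      = ((\<integral>y. \<Phi> (Y n) y \<partial>M) - (\<integral>y. \<Phi> a y \<partial>M)) / (Y n - a)" for n
    using int[of "Y n"] int[of a] Y d by simp
  ultimately have "(\<lambda>n. ((\<integral>y. \<Phi> (Y n) y \<partial>M) - (\<integral>y. \<Phi> a y \<partial>M)) / (Y n - a)) \<longlonglongrightarrow> (\<integral>y. \<Phi>' a y \<partial>M)"
    by (simp only:)
  then show "(\<lambda>n. ((\<integral>y. \<Phi> (X n) y \<partial>M) - (\<integral>y. \<Phi> a y \<partial>M)) / (X n - a)) \<longlonglongrightarrow> (\<integral>y. \<Phi>' a y \<partial>M)"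
    unfolding Y_def by (rule LIMSEQ_offset)
qed

lemma has_real_derivative_integral_mult:
  fixes u :: "'a::euclidean_space \<Rightarrow> real"
  assumes d: "d > 0" and u: "set_integrable lborel K u" and u_measurable: "u \<in> borel_measurable borel"
    and der: "\<And>s y. \<bar>s - a\<bar> < d \<Longrightarrow> ((\<lambda>s. \<psi> s y) has_real_derivative \<psi>' s y) (at s)"
    and int: "\<And>s. \<bar>s - a\<bar> < d \<Longrightarrow> integrable lborel (\<lambda>y. u y * \<psi> s y)"
    and bound: "\<And>s y. \<bar>s - a\<bar> < d \<Longrightarrow> \<bar>\<psi>' s y\<bar> \<le> B"
    and supp: "\<And>s y. \<bar>s - a\<bar> < d \<Longrightarrow> y \<notin> K \<Longrightarrow> \<psi>' s y = 0"
    and meas: "\<psi>' a \<in> borel_measurable borel"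
  shows "((\<lambda>s. \<integral>y. u y * \<psi> s y \<partial>lborel) has_real_derivative (\<integral>y. u y * \<psi>' a y \<partial>lborel)) (at a)"
proof (rule has_real_derivative_under_integral[OF d _ int, where w="\<lambda>y. B * \<bar>indicator K y * u y\<bar>"])
  show "((\<lambda>s. u y * \<psi> s y) has_real_derivative u y * \<psi>' s y) (at s)" if "\<bar>s - a\<bar> < d" for s y
    by (rule DERIV_cmult[OF der[OF that]])
  show "\<bar>u y * \<psi>' s y\<bar> \<le> B * \<bar>indicator K y * u y\<bar>" if "\<bar>s - a\<bar> < d" for s y
    using mult_left_mono[OF bound[OF that, of y], of "\<bar>u y\<bar>"] supp[OF that, of y]
    by (cases "y \<in> K") (simp_all add: abs_mult mult.commute)
qed (use u meas u_measurable in \<open>simp_all add: set_integrable_def\<close>)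

lemma integrable_bounded_compact_support:
  fixes f :: "'a::euclidean_space \<Rightarrow> real"
  assumes "compact S" "f \<in> borel_measurable borel" "\<And>x. \<bar>f x\<bar> \<le> B" "\<And>x. x \<notin> S \<Longrightarrow> f x = 0"
  shows "integrable lborel f"
proof (rule Bochner_Integration.integrable_bound)
  show "integrable lborel (\<lambda>x. B * indicator S x)"
    using emeasure_compact_finite[OF assms(1)] assms(1) by (simp add: borel_compact)
  have "\<bar>f x\<bar> \<le> \<bar>B * indicator S x\<bar>" for x
    using assms(3)[of x] assms(4)[of x] by (cases "x \<in> S") auto
  then show "AE x in lborel. norm (f x) \<le> norm (B * indicator S x)" by simp
qed (use assms(2) in simp)

lemma integral_directional_derivative_eq_0:
  fixes G :: "'a::euclidean_space \<Rightarrow> real"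
  assumes S: "compact S" and G: "G \<in> borel_measurable borel" "G' \<in> borel_measurable borel"
    and supp: "\<And>x. x \<notin> S \<Longrightarrow> G x = 0" "\<And>x. x \<notin> S \<Longrightarrow> G' x = 0"
    and der: "\<And>x. ((\<lambda>s. G (x + s *\<^sub>R e)) has_real_derivative G' x) (at 0)"
    and bound: "\<And>x. \<bar>G x\<bar> \<le> B" "\<And>x. \<bar>G' x\<bar> \<le> B'"
  shows "(\<integral>x. G' x \<partial>lborel) = 0"
proof -
  let ?K = "\<Union>x\<in>S. cball x (norm e)"
  have K: "compact ?K" by (rule compact_minkowski_sum_cball[OF S])
  have off_K: "x + s *\<^sub>R e \<notin> S" if "x \<notin> ?K" "\<bar>s\<bar> < 1" for x s
    using that by (auto simp: dist_norm mult_left_le_one_le)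
  have "((\<lambda>s. \<integral>x. G (x + s *\<^sub>R e) \<partial>lborel) has_real_derivative (\<integral>x. G' (x + 0 *\<^sub>R e) \<partial>lborel)) (at 0)"
  proof (rule has_real_derivative_under_integral[where d=1 and w="\<lambda>x. B' * indicator ?K x"])
    show "((\<lambda>s. G (y + s *\<^sub>R e)) has_real_derivative G' (y + s *\<^sub>R e)) (at s)" for s y
      using der[of "y + s *\<^sub>R e"] DERIV_shift[of "\<lambda>s. G (y + s *\<^sub>R e)" "G' (y + s *\<^sub>R e)" 0 s]
      by (simp add: algebra_simps)
    show "integrable lborel (\<lambda>x. G (x + s *\<^sub>R e))" for s
      using integrable_lborel_translate[OF integrable_bounded_compact_support[OF S G(1) bound(1) supp(1)]] .
    show "\<bar>G' (y + s *\<^sub>R e)\<bar> \<le> B' * indicator ?K y" if "\<bar>s - 0\<bar> < 1" for s y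
      using bound(2)[of "y + s *\<^sub>R e"] supp(2)[of "y + s *\<^sub>R e"] off_K[of y s] that
      by (cases "y \<in> ?K") auto
    show "integrable lborel (\<lambda>x. B' * indicator ?K x)"
      using emeasure_compact_finite[OF K] K by (simp add: borel_compact)
  qed (use G in auto)
  moreover have "(\<integral>x. G (x + s *\<^sub>R e) \<partial>lborel) = (\<integral>x. G x \<partial>lborel)" for s
    by (rule integral_lborel_translate[OF G(1)])
  ultimately have "((\<lambda>s::real. \<integral>x. G x \<partial>lborel) has_real_derivative (\<integral>x. G' x \<partial>lborel)) (at 0)" by simp
  from DERIV_unique[OF this DERIV_const] show ?thesis .
qed

text \<open>Weak gradients of Borel functions with respect to \<open>lborel\<close> rather than \<open>lebesgue\<close>:
  only there are Tonelli's theorem and the measurability of \<open>\<lambda>(x, z). f (x + t *\<^sub>R z)\<close> available.\<close>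

definition borel_weak_gradient :: "(real^'n::finite) set \<Rightarrow> 'n fn \<Rightarrow> ('n \<Rightarrow> 'n fn) \<Rightarrow> bool" where
  "borel_weak_gradient \<Omega> u g \<longleftrightarrow> u \<in> borel_measurable borel \<and> (\<forall>i. g i \<in> borel_measurable borel) \<and>
     (\<forall>K. compact K \<and> K \<subseteq> \<Omega> \<longrightarrow> set_integrable lborel K u \<and> (\<forall>i. set_integrable lborel K (g i))) \<and>
     (\<forall>i \<phi>. test_fun \<Omega> \<phi> \<longrightarrow>
        (\<integral>x. u x * partial i \<phi> x \<partial>lborel) = - (\<integral>x. g i x * \<phi> x \<partial>lborel))"

lemma borel_weak_gradientD:
  assumes "borel_weak_gradient \<Omega> u g"
  shows "u \<in> borel_measurable borel" "g i \<in> borel_measurable borel"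
    "compact K \<Longrightarrow> K \<subseteq> \<Omega> \<Longrightarrow> set_integrable lborel K u"
    "compact K \<Longrightarrow> K \<subseteq> \<Omega> \<Longrightarrow> set_integrable lborel K (g i)"
    "test_fun \<Omega> \<phi> \<Longrightarrow> (\<integral>x. u x * partial i \<phi> x \<partial>lborel) = - (\<integral>x. g i x * \<phi> x \<partial>lborel)"
  using assms unfolding borel_weak_gradient_def by auto

lemma borel_weak_gradient_subset:
  assumes "borel_weak_gradient \<Omega> u g" "U \<subseteq> \<Omega>"
  shows "borel_weak_gradient U u g"
  using assms unfolding borel_weak_gradient_def test_fun_def by (meson order_trans)

definition support :: "('a::topological_space \<Rightarrow> real) \<Rightarrow> 'a set" where
  "support f = closure {x. f x \<noteq> 0}"

lemma closed_support: "closed (support f)"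
  by (simp add: support_def)

lemma test_fun_iff: "test_fun \<Omega> \<zeta> \<longleftrightarrow> smooth \<zeta> \<and> compact (support \<zeta>) \<and> support \<zeta> \<subseteq> \<Omega>"
  by (simp add: test_fun_def support_def)

lemma test_funD:
  assumes "test_fun \<Omega> \<zeta>"
  shows "smooth \<zeta>" "compact (support \<zeta>)" "support \<zeta> \<subseteq> \<Omega>"
  using assms by (auto simp: test_fun_iff)

lemma eq_0_off_support: "x \<notin> support f \<Longrightarrow> f x = 0"
  using closure_subset[of "{x. f x \<noteq> 0}"] unfolding support_def by blast

lemma partial_eq_0_off_support: "x \<notin> support f \<Longrightarrow> partial i f x = 0"
  by (rule partial_eq_0[of "- support f"]) (auto intro: eq_0_off_support closed_support)

lemma test_fun_continuous_kernel:
  assumes "test_fun \<Omega> \<zeta>"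
  obtains R where "continuous_kernel 0 R \<zeta>" "\<And>i. continuous_kernel 0 R (partial i \<zeta>)"
proof -
  obtain R where R: "support \<zeta> \<subseteq> cball 0 R"
    using compact_imp_bounded[OF test_funD(2)[OF assms]] unfolding bounded_iff subset_iff mem_cball_0 by metis
  have "continuous_kernel 0 R \<zeta>"
    unfolding continuous_kernel_def using smooth_continuous[OF test_funD(1)[OF assms]] R eq_0_off_support by blast
  then show ?thesis using continuous_kernel_partial[OF test_funD(1)[OF assms]] that by blast
qed

lemma smooth_scaled_kernel: "smooth \<eta> \<Longrightarrow> smooth (scaled_kernel \<eta> t x)"
  unfolding scaled_kernel_def[abs_def] by (intro smooth_cmult smooth_compose_affine)

lemma partial_scaled_kernel:
  assumes "smooth \<eta>"
  shows "partial i (scaled_kernel \<eta> t x) y = (1/t) * scaled_kernel (partial i \<eta>) t x y"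
  unfolding scaled_kernel_def[abs_def]
  by (simp only: partial_cmult[OF smooth_compose_affine[OF assms]] partial_compose_affine[OF assms] mult.left_commute)

lemma test_fun_scaled_kernel:
  assumes "smooth \<eta>" and \<eta>: "continuous_kernel c d \<eta>" and t: "t > 0" and sub: "cball (x + t *\<^sub>R c) (t * d) \<subseteq> \<Omega>"
  shows "test_fun \<Omega> (scaled_kernel \<eta> t x)"
proof -
  have "{y. scaled_kernel \<eta> t x y \<noteq> 0} \<subseteq> cball (x + t *\<^sub>R c) (t * d)"
    using scaled_kernel_eq_0[OF \<eta> t] by blast
  then have supp: "support (scaled_kernel \<eta> t x) \<subseteq> cball (x + t *\<^sub>R c) (t * d)"
    unfolding support_def by (rule closure_minimal) simp
  then have "compact (support (scaled_kernel \<eta> t x))"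
    using closed_support bounded_subset[OF bounded_cball] compact_eq_bounded_closed by blast
  with supp show ?thesis
    using smooth_scaled_kernel[OF assms(1)] sub unfolding test_fun_iff by blast
qed

lemma mollify_weak_gradient:
  assumes w: "borel_weak_gradient \<Omega> u g" and \<eta>: "smooth \<eta>" "continuous_kernel c d \<eta>" and t: "t > 0"
    and sub: "cball (x + t *\<^sub>R c) (t * d) \<subseteq> \<Omega>"
  shows "mollify (partial i \<eta>) t u x = - t * mollify \<eta> t (g i) x"
proof -
  note [measurable] = borel_weak_gradientD(1,2)[OF w] continuous_kernelD(3)[OF \<eta>(2)]
    continuous_kernelD(3)[OF continuous_kernel_partial[OF \<eta>]]
  have "(1/t) * (\<integral>y. u y * scaled_kernel (partial i \<eta>) t x y \<partial>lborel)
      = (\<integral>y. u y * partial i (scaled_kernel \<eta> t x) y \<partial>lborel)"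
    unfolding partial_scaled_kernel[OF \<eta>(1)] by (subst integral_mult_right_zero[symmetric]) (simp add: ac_simps)
  also have "\<dots> = - (\<integral>y. g i y * scaled_kernel \<eta> t x y \<partial>lborel)"
    by (rule borel_weak_gradientD(5)[OF w test_fun_scaled_kernel[OF \<eta> t sub]])
  finally show ?thesis using t by (simp add: mollify_eq_integral_scaled_kernel field_simps)
qed

text \<open>When \<open>x\<close> moves with velocity \<open>v\<close> and \<open>t\<close> with velocity \<open>b\<close>, the derivative of the scaled kernel is
  minus the divergence in \<open>y\<close> of the scaled kernel times \<open>v + b z\<close>, where \<open>z = (y - x) / t\<close>. This is an
  admissible test field even when \<open>x\<close> is close to the boundary.\<close>

definition drift_divergence :: "'n::finite fn \<Rightarrow> real^'n \<Rightarrow> real \<Rightarrow> 'n fn" where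
  "drift_divergence \<phi> v b z = (\<Sum>i\<in>UNIV. partial i (\<lambda>z. (v $ i + b * z $ i) * \<phi> z) z)"

lemma continuous_kernel_drift_divergence:
  assumes "smooth \<phi>" "continuous_kernel c d \<phi>"
  shows "continuous_kernel c d (drift_divergence \<phi> v b)"
  unfolding drift_divergence_def[abs_def]
  by (intro continuous_kernel_sum continuous_kernel_partial smooth_affine_coordinate_mult
      continuous_kernel_affine_coordinate_mult assms)

lemma inverse_power_has_real_derivative:
  assumes "s > (0::real)"
  shows "((\<lambda>s. 1 / s ^ n) has_real_derivative - (1/s) * (real n * (1 / s ^ n))) (at s)"
proof (cases n)
  case (Suc m)
  have "((\<lambda>s. 1 / s ^ n) has_real_derivative - (real n * s ^ (n - 1)) / (s ^ n)\<^sup>2) (at s)"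
    using assms by (auto intro!: derivative_eq_intros simp: power2_eq_square)
  then show ?thesis using assms by (elim DERIV_cong) (simp add: Suc power2_eq_square field_simps)
qed simp

lemma scaled_kernel_has_real_derivative:
  fixes \<phi> :: "'n::finite fn"
  assumes \<phi>: "smooth \<phi>" and pos: "t + s * b > 0"
  shows "((\<lambda>s. scaled_kernel \<phi> (t + s * b) (x + s *\<^sub>R v) y) has_real_derivative
    - (1 / (t + s * b)) * scaled_kernel (drift_divergence \<phi> v b) (t + s * b) (x + s *\<^sub>R v) y) (at s)"
proof -
  let ?n = "CARD('n)" and ?\<sigma> = "\<lambda>s. t + s * b" and ?l = "\<lambda>s. (1 / (t + s * b)) *\<^sub>R (y - (x + s *\<^sub>R v))"
  have \<sigma>: "(?\<sigma> has_real_derivative b) (at s)" by (auto intro!: derivative_eq_intros)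
  have power: "((\<lambda>s. 1 / ?\<sigma> s ^ ?n) has_real_derivative - (1 / ?\<sigma> s) * (real ?n * (1 / ?\<sigma> s ^ ?n)) * b) (at s)"
    by (rule DERIV_chain2[OF inverse_power_has_real_derivative[OF pos] \<sigma>])
  have "((\<lambda>s. 1 / ?\<sigma> s) has_real_derivative - (b / (?\<sigma> s)\<^sup>2)) (at s)"
    using pos by (auto intro!: derivative_eq_intros simp: power2_eq_square)
  moreover have "((\<lambda>s. y - (x + s *\<^sub>R v)) has_vector_derivative - v) (at s)"
    by (auto intro!: derivative_eq_intros)
  ultimately have "(?l has_vector_derivative (1 / ?\<sigma> s) *\<^sub>R (- v) + (- (b / (?\<sigma> s)\<^sup>2)) *\<^sub>R (y - (x + s *\<^sub>R v))) (at s)"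
    by (rule has_vector_derivative_scaleR)
  also have "(1 / ?\<sigma> s) *\<^sub>R (- v) + (- (b / (?\<sigma> s)\<^sup>2)) *\<^sub>R (y - (x + s *\<^sub>R v)) = (- (1 / ?\<sigma> s)) *\<^sub>R (v + b *\<^sub>R ?l s)"
    using pos by (simp add: scaleR_right_distrib power2_eq_square)
  finally have curve: "((\<lambda>s. \<phi> (?l s)) has_real_derivative
      (\<Sum>i\<in>UNIV. ((- (1 / ?\<sigma> s)) *\<^sub>R (v + b *\<^sub>R ?l s)) $ i * partial i \<phi> (?l s))) (at s)"
    by (rule smooth_compose_curve_derivative[OF \<phi>])
  have "(\<Sum>i\<in>UNIV. ((- (1 / ?\<sigma> s)) *\<^sub>R (v + b *\<^sub>R ?l s)) $ i * partial i \<phi> (?l s))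
      = - (1 / ?\<sigma> s) * (\<Sum>i\<in>UNIV. (v $ i + b * ?l s $ i) * partial i \<phi> (?l s))"
    by (simp add: sum_distrib_left sum_negf mult_ac)
  moreover have "drift_divergence \<phi> v b z = real ?n * b * \<phi> z + (\<Sum>i\<in>UNIV. (v $ i + b * z $ i) * partial i \<phi> z)" for z
    unfolding drift_divergence_def partial_affine_coordinate_mult[OF \<phi>] by (simp add: sum.distrib)
  ultimately show ?thesis
    using DERIV_mult[OF power curve] unfolding scaled_kernel_def
    by (elim DERIV_cong) (simp add: algebra_simps)
qed

lemma moving_cball_subset:
  fixes x c v :: "'a::real_normed_vector"
  assumes t: "t > 0" and r: "r > 0"
  obtains \<delta> where "\<delta> > 0" "\<And>s. \<bar>s\<bar> < \<delta> \<Longrightarrow> t/2 \<le> t + s * b"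
    "\<And>s. \<bar>s\<bar> < \<delta> \<Longrightarrow> cball ((x + s *\<^sub>R v) + (t + s * b) *\<^sub>R c) ((t + s * b) * d)
      \<subseteq> (\<Union>y\<in>cball (x + t *\<^sub>R c) (t * d). cball y r)"
proof -
  define R where "R = norm v + \<bar>b\<bar> * (norm c + \<bar>d\<bar>) + 1"
  have R: "R > 0" by (simp add: R_def add_nonneg_pos)
  define \<delta> where "\<delta> = min (t / (2 * (\<bar>b\<bar> + 1))) (r / R)"
  have \<delta>: "\<delta> > 0" using t r R by (simp add: \<delta>_def)
  have half: "t/2 \<le> t + s * b" if "\<bar>s\<bar> < \<delta>" for s
  proof -
    have "\<bar>s * b\<bar> \<le> (t / (2 * (\<bar>b\<bar> + 1))) * (\<bar>b\<bar> + 1)"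
      unfolding abs_mult using that by (intro mult_mono) (auto simp: \<delta>_def)
    also have "\<dots> = t/2" by (simp add: field_simps)
    finally show ?thesis by linarith
  qed
  have "y \<in> (\<Union>y\<in>cball (x + t *\<^sub>R c) (t * d). cball y r)"
    if s: "\<bar>s\<bar> < \<delta>" and y: "y \<in> cball ((x + s *\<^sub>R v) + (t + s * b) *\<^sub>R c) ((t + s * b) * d)" for s y
  proof -
    have pos: "t + s * b > 0" using half[OF s] t by linarith
    define z where "z = (1 / (t + s * b)) *\<^sub>R (y - (x + s *\<^sub>R v))"
    have z: "z \<in> cball c d" unfolding z_def inverse_scaled_mem_cball_iff[OF pos] by (rule y)
    have "norm z \<le> norm c + norm (z - c)" by (metis add.commute diff_add_cancel norm_triangle_ineq)
    with z have "norm z \<le> norm c + \<bar>d\<bar>" by (auto simp: dist_norm norm_minus_commute)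
    then have "\<bar>b\<bar> * norm z \<le> \<bar>b\<bar> * (norm c + \<bar>d\<bar>)" by (intro mult_left_mono) auto
    then have "norm (v + b *\<^sub>R z) \<le> R" using norm_triangle_ineq[of v "b *\<^sub>R z"] by (simp add: R_def)
    then have "\<bar>s\<bar> * norm (v + b *\<^sub>R z) \<le> (r / R) * R"
      using s r R by (intro mult_mono) (auto simp: \<delta>_def)
    then have small: "norm (s *\<^sub>R (v + b *\<^sub>R z)) \<le> r" using R by simp
    have "(t + s * b) *\<^sub>R z = y - (x + s *\<^sub>R v)" using pos by (simp add: z_def)
    then have "y = (x + t *\<^sub>R z) + s *\<^sub>R (v + b *\<^sub>R z)" by (simp add: algebra_simps)
    then have "y \<in> cball (x + t *\<^sub>R z) r" using small by (simp add: dist_norm)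
    moreover have "x + t *\<^sub>R z \<in> cball (x + t *\<^sub>R c) (t * d)" using z by (simp only: scaled_mem_cball_iff[OF t])
    ultimately show ?thesis by blast
  qed
  with \<delta> half show ?thesis by (intro that[of \<delta>]) blast+
qed

lemma mollify_drift_divergence:
  fixes u :: "'n::finite fn"
  assumes w: "borel_weak_gradient \<Omega> u g" and \<phi>: "smooth \<phi>" "continuous_kernel c d \<phi>" and t: "t > 0"
    and sub: "cball (x + t *\<^sub>R c) (t * d) \<subseteq> \<Omega>"
  shows "mollify (drift_divergence \<phi> v b) t u x = - t * (\<Sum>i\<in>UNIV. mollify (\<lambda>z. (v $ i + b * z $ i) * \<phi> z) t (g i) x)"
proof -
  let ?\<eta> = "\<lambda>i z. (v $ i + b * z $ i) * \<phi> z"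
  have \<eta>: "smooth (?\<eta> i)" "continuous_kernel c d (?\<eta> i)" for i
    by (intro smooth_affine_coordinate_mult continuous_kernel_affine_coordinate_mult \<phi>)+
  note \<eta>' = continuous_kernel_partial[OF \<eta>]
  note [measurable] = borel_weak_gradientD(1)[OF w] continuous_kernelD(3)[OF \<eta>']
    continuous_kernelD(3)[OF continuous_kernel_drift_divergence[OF \<phi>]]
  have "mollify (drift_divergence \<phi> v b) t u x = (\<integral>y. (\<Sum>i\<in>UNIV. u y * scaled_kernel (partial i (?\<eta> i)) t x y) \<partial>lborel)"
    using t by (simp add: mollify_eq_integral_scaled_kernel scaled_kernel_def drift_divergence_def sum_distrib_left)
  also have "\<dots> = (\<Sum>i\<in>UNIV. mollify (partial i (?\<eta> i)) t u x)"
    using t integrable_mult_scaled_kernel[OF borel_weak_gradientD(3)[OF w compact_cball sub]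
        borel_weak_gradientD(1)[OF w] \<eta>' t order_refl]
    by (simp add: mollify_eq_integral_scaled_kernel)
  also have "\<dots> = (\<Sum>i\<in>UNIV. - t * mollify (?\<eta> i) t (g i) x)"
    by (simp only: mollify_weak_gradient[OF w \<eta> t sub])
  finally show ?thesis by (simp only: sum_distrib_left)
qed

lemma abs_scaled_kernel_divide_le:
  fixes \<psi> :: "'n::finite fn"
  assumes \<psi>: "continuous_kernel c d \<psi>" and t: "0 < t0" "t0 \<le> t"
  shows "\<bar>1 / t * scaled_kernel \<psi> t x y\<bar> \<le> 1 / t0 * (sup_norm \<psi> / t0 ^ CARD('n))"
proof -
  have "\<bar>1 / t * scaled_kernel \<psi> t x y\<bar> \<le> 1 / t * (sup_norm \<psi> / t ^ CARD('n))"
    unfolding abs_mult using t by (intro mult_mono abs_scaled_kernel_le[OF \<psi>]) auto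
  also have "\<dots> \<le> 1 / t0 * (sup_norm \<psi> / t0 ^ CARD('n))"
    using t sup_norm_nonneg[OF \<psi>] by (intro mult_mono divide_left_mono power_mono) auto
  finally show ?thesis .
qed

lemma mollify_moving_has_real_derivative:
  fixes u :: "'n::finite fn"
  assumes u: "set_integrable lborel (\<Union>y\<in>cball (x + t *\<^sub>R c) (t * d). cball y r) u" "u \<in> borel_measurable borel"
    and \<phi>: "smooth \<phi>" "continuous_kernel c d \<phi>" and t: "t > 0" and r: "r > 0"
  shows "((\<lambda>s. mollify \<phi> (t + s * b) u (x + s *\<^sub>R v)) has_real_derivative
    - (1/t) * mollify (drift_divergence \<phi> v b) t u x) (at 0)"
proof -
  let ?Q = "drift_divergence \<phi> v b" and ?K = "\<Union>y\<in>cball (x + t *\<^sub>R c) (t * d). cball y r"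
  note Q = continuous_kernel_drift_divergence[OF \<phi>, of v b]
  note [measurable] = u(2) continuous_kernelD(3)[OF \<phi>(2)] continuous_kernelD(3)[OF Q]
  obtain \<delta> where \<delta>: "\<delta> > 0" "\<And>s. \<bar>s\<bar> < \<delta> \<Longrightarrow> t/2 \<le> t + s * b"
    and K: "\<And>s. \<bar>s\<bar> < \<delta> \<Longrightarrow> cball ((x + s *\<^sub>R v) + (t + s * b) *\<^sub>R c) ((t + s * b) * d) \<subseteq> ?K"
    using moving_cball_subset[OF t r, of b x v c d] by metis
  have pos: "t + s * b > 0" if "\<bar>s\<bar> < \<delta>" for s using \<delta>(2)[OF that] t by linarith
  let ?\<psi>' = "\<lambda>s y. - (1 / (t + s * b)) * scaled_kernel ?Q (t + s * b) (x + s *\<^sub>R v) y"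
  have "((\<lambda>s. \<integral>y. u y * scaled_kernel \<phi> (t + s * b) (x + s *\<^sub>R v) y \<partial>lborel) has_real_derivative
      (\<integral>y. u y * ?\<psi>' 0 y \<partial>lborel)) (at 0)"
  proof (rule has_real_derivative_integral_mult[OF \<delta>(1) u])
    fix s :: real and y assume "\<bar>s - 0\<bar> < \<delta>"
    then have s: "\<bar>s\<bar> < \<delta>" by simp
    show "((\<lambda>s. scaled_kernel \<phi> (t + s * b) (x + s *\<^sub>R v) y) has_real_derivative ?\<psi>' s y) (at s)"
      by (rule scaled_kernel_has_real_derivative[OF \<phi>(1) pos[OF s]])
    show "integrable lborel (\<lambda>y. u y * scaled_kernel \<phi> (t + s * b) (x + s *\<^sub>R v) y)"
      by (rule integrable_mult_scaled_kernel[OF u \<phi>(2) pos[OF s] K[OF s]])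
    show "\<bar>?\<psi>' s y\<bar> \<le> 1 / (t/2) * (sup_norm ?Q / (t/2) ^ CARD('n))"
      using abs_scaled_kernel_divide_le[OF Q _ \<delta>(2)[OF s]] t by simp
    assume "y \<notin> ?K"
    then have "scaled_kernel ?Q (t + s * b) (x + s *\<^sub>R v) y = 0"
      using scaled_kernel_eq_0[OF Q pos[OF s]] K[OF s] by blast
    then show "?\<psi>' s y = 0" by simp
  qed measurable
  then have "((\<lambda>s. mollify \<phi> (t + s * b) u (x + s *\<^sub>R v)) has_real_derivative (\<integral>y. u y * ?\<psi>' 0 y \<partial>lborel)) (at 0)"
    by (rule has_field_derivative_transform_within_open[of _ _ _ "{-\<delta><..<\<delta>}"])
      (use \<delta>(1) pos in \<open>auto simp: mollify_eq_integral_scaled_kernel\<close>)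
  moreover have "(\<integral>y. u y * ?\<psi>' 0 y \<partial>lborel) = - (1/t) * mollify ?Q t u x"
    using t by (simp add: mollify_eq_integral_scaled_kernel)
  ultimately show ?thesis by (simp only:)
qed

lemma mollify_has_real_derivative:
  fixes u :: "'n::finite fn"
  assumes w: "borel_weak_gradient \<Omega> u g" and \<Omega>: "open \<Omega>" and \<phi>: "smooth \<phi>" "continuous_kernel c d \<phi>" and t: "t > 0"
    and sub: "cball (x + t *\<^sub>R c) (t * d) \<subseteq> \<Omega>"
  shows "((\<lambda>s. mollify \<phi> (t + s * b) u (x + s *\<^sub>R v)) has_real_derivative
    (\<Sum>i\<in>UNIV. mollify (\<lambda>z. (v $ i + b * z $ i) * \<phi> z) t (g i) x)) (at 0)"
proof -
  obtain r where r: "r > 0" "(\<Union>y\<in>cball (x + t *\<^sub>R c) (t * d). cball y r) \<subseteq> \<Omega>"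
    using compact_subset_open_imp_cball_epsilon_subset[OF compact_cball \<Omega> sub] by blast
  have "set_integrable lborel (\<Union>y\<in>cball (x + t *\<^sub>R c) (t * d). cball y r) u"
    by (rule borel_weak_gradientD(3)[OF w compact_minkowski_sum_cball[OF compact_cball] r(2)])
  from mollify_moving_has_real_derivative[OF this borel_weak_gradientD(1)[OF w] \<phi> t r(1), of b v]
  show ?thesis using t by (simp add: mollify_drift_divergence[OF w \<phi> t sub])
qed

lemma mollify_partial_derivative:
  fixes u :: "'n::finite fn"
  assumes "borel_weak_gradient \<Omega> u g" "open \<Omega>" "smooth \<phi>" "continuous_kernel c d \<phi>" "t > 0"
    "cball (x + t *\<^sub>R c) (t * d) \<subseteq> \<Omega>"
  shows "((\<lambda>s. mollify \<phi> t u (x + s *\<^sub>R axis i 1)) has_real_derivative mollify \<phi> t (g i) x) (at 0)"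
proof -
  have "mollify (\<lambda>z. (axis i 1 $ j + 0 * z $ j) * \<phi> z) t (g j) x = (if j = i then mollify \<phi> t (g i) x else 0)" for j
    by (simp add: axis_def mollify_def)
  then show ?thesis using mollify_has_real_derivative[OF assms, of 0 "axis i 1"] by simp
qed

lemma mollify_scale_derivative:
  fixes u :: "'n::finite fn"
  assumes "borel_weak_gradient \<Omega> u g" "open \<Omega>" "smooth \<phi>" "continuous_kernel c d \<phi>" "t > 0"
    "cball (x + t *\<^sub>R c) (t * d) \<subseteq> \<Omega>"
  shows "((\<lambda>t. mollify \<phi> t u x) has_real_derivative (\<Sum>i\<in>UNIV. mollify (\<lambda>z. z $ i * \<phi> z) t (g i) x)) (at t)"
  using mollify_has_real_derivative[OF assms, of 1 0]
    DERIV_shift[of "\<lambda>t. mollify \<phi> t u x" "\<Sum>i\<in>UNIV. mollify (\<lambda>z. z $ i * \<phi> z) t (g i) x" 0 t]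
  by (simp add: add.commute)

section \<open>The chain rule for weak gradients\<close>

lemma integrable_bounded_mult:
  fixes f g :: "'a \<Rightarrow> real"
  assumes g: "integrable M g" and f: "f \<in> borel_measurable M" "\<And>x. \<bar>f x\<bar> \<le> B"
  shows "integrable M (\<lambda>x. f x * g x)"
proof (rule Bochner_Integration.integrable_bound)
  have "B \<ge> 0" using f(2) abs_ge_zero order_trans by blast
  then show "AE x in M. norm (f x * g x) \<le> norm (B * g x)" using f(2) by (simp add: abs_mult mult_right_mono)
  show "integrable M (\<lambda>x. B * g x)" using g by simp
qed (use f g in measurable)

lemma abs_integral_mult_diff_le:
  fixes a \<alpha> b \<beta> :: "'a \<Rightarrow> real"
  assumes a: "a \<in> borel_measurable M" "\<And>x. \<bar>a x\<bar> \<le> B" and \<alpha>: "\<alpha> \<in> borel_measurable M" "\<And>x. \<bar>\<alpha> x\<bar> \<le> B"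
    and b: "integrable M b" "integrable M \<beta>"
  shows "\<bar>(\<integral>x. a x * b x \<partial>M) - (\<integral>x. \<alpha> x * \<beta> x \<partial>M)\<bar> \<le> B * (\<integral>x. \<bar>b x - \<beta> x\<bar> \<partial>M) + (\<integral>x. \<bar>a x - \<alpha> x\<bar> * \<bar>\<beta> x\<bar> \<partial>M)"
proof -
  note int = integrable_bounded_mult[OF b(1) a] integrable_bounded_mult[OF b(2) \<alpha>]
  have "\<bar>a x - \<alpha> x\<bar> \<le> 2 * B" for x using a(2)[of x] \<alpha>(2)[of x] by linarith
  then have int_diff: "integrable M (\<lambda>x. \<bar>a x - \<alpha> x\<bar> * \<bar>\<beta> x\<bar>)"
    using a(1) \<alpha>(1) b(2) by (intro integrable_bounded_mult[where B="2 * B"]) auto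
  have "\<bar>(\<integral>x. a x * b x \<partial>M) - (\<integral>x. \<alpha> x * \<beta> x \<partial>M)\<bar> \<le> (\<integral>x. \<bar>a x * b x - \<alpha> x * \<beta> x\<bar> \<partial>M)"
    using integral_abs_bound[of M "\<lambda>x. a x * b x - \<alpha> x * \<beta> x"] int by simp
  also have "\<dots> \<le> (\<integral>x. B * \<bar>b x - \<beta> x\<bar> + \<bar>a x - \<alpha> x\<bar> * \<bar>\<beta> x\<bar> \<partial>M)"
  proof (rule integral_mono)
    fix x
    have "a x * b x - \<alpha> x * \<beta> x = a x * (b x - \<beta> x) + (a x - \<alpha> x) * \<beta> x" by (simp add: algebra_simps)
    also have "\<bar>\<dots>\<bar> \<le> \<bar>a x\<bar> * \<bar>b x - \<beta> x\<bar> + \<bar>a x - \<alpha> x\<bar> * \<bar>\<beta> x\<bar>"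
      by (rule order_trans[OF abs_triangle_ineq]) (simp add: abs_mult)
    also have "\<dots> \<le> B * \<bar>b x - \<beta> x\<bar> + \<bar>a x - \<alpha> x\<bar> * \<bar>\<beta> x\<bar>"
      using a(2) by (intro add_right_mono mult_right_mono) auto
    finally show "\<bar>a x * b x - \<alpha> x * \<beta> x\<bar> \<le> B * \<bar>b x - \<beta> x\<bar> + \<bar>a x - \<alpha> x\<bar> * \<bar>\<beta> x\<bar>" .
  qed (use int int_diff b in auto)
  also have "\<dots> = B * (\<integral>x. \<bar>b x - \<beta> x\<bar> \<partial>M) + (\<integral>x. \<bar>a x - \<alpha> x\<bar> * \<bar>\<beta> x\<bar> \<partial>M)"
    using int_diff b by simp
  finally show ?thesis .
qed

lemma L1_tendsto_mult_bounded:
  fixes a b :: "nat \<Rightarrow> 'a \<Rightarrow> real"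
  assumes meas[measurable]: "\<And>n. a n \<in> borel_measurable M" "\<alpha> \<in> borel_measurable M"
    and bound: "\<And>n x. \<bar>a n x\<bar> \<le> B" "\<And>x. \<bar>\<alpha> x\<bar> \<le> B"
    and lim_a: "AE x in M. (\<lambda>n. a n x) \<longlonglongrightarrow> \<alpha> x"
    and b: "\<And>n. integrable M (b n)" "integrable M \<beta>" and lim_b: "(\<lambda>n. \<integral>x. \<bar>b n x - \<beta> x\<bar> \<partial>M) \<longlonglongrightarrow> 0"
  shows "(\<lambda>n. \<integral>x. a n x * b n x \<partial>M) \<longlonglongrightarrow> (\<integral>x. \<alpha> x * \<beta> x \<partial>M)"
proof -
  note [measurable] = borel_measurable_integrable[OF b(2)]
  have bound_diff: "\<bar>a n x - \<alpha> x\<bar> * \<bar>\<beta> x\<bar> \<le> 2 * B * \<bar>\<beta> x\<bar>" for n x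
    using bound(1)[of n x] bound(2)[of x] by (intro mult_right_mono) auto
  have "(\<lambda>n. \<integral>x. \<bar>a n x - \<alpha> x\<bar> * \<bar>\<beta> x\<bar> \<partial>M) \<longlonglongrightarrow> (\<integral>x. 0 \<partial>M)"
  proof (rule integral_dominated_convergence[where w="\<lambda>x. 2 * B * \<bar>\<beta> x\<bar>"])
    show "AE x in M. (\<lambda>n. \<bar>a n x - \<alpha> x\<bar> * \<bar>\<beta> x\<bar>) \<longlonglongrightarrow> 0"
      using lim_a by eventually_elim (auto intro!: tendsto_mult_left_zero tendsto_rabs_zero LIM_zero)
  qed (use b bound_diff in auto)
  with tendsto_mult[OF tendsto_const[of B] lim_b]
  have lim: "(\<lambda>n. B * (\<integral>x. \<bar>b n x - \<beta> x\<bar> \<partial>M) + (\<integral>x. \<bar>a n x - \<alpha> x\<bar> * \<bar>\<beta> x\<bar> \<partial>M)) \<longlonglongrightarrow> 0"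
    using tendsto_add by fastforce
  have "(\<lambda>n. (\<integral>x. a n x * b n x \<partial>M) - (\<integral>x. \<alpha> x * \<beta> x \<partial>M)) \<longlonglongrightarrow> 0"
    using abs_integral_mult_diff_le[OF meas(1) bound(1) meas(2) bound(2) b]
    by (intro Lim_null_comparison[OF always_eventually lim]) simp
  then show ?thesis by (rule LIM_zero_cancel)
qed

lemma Lipschitz_of_bounded_derivative:
  fixes F :: "real \<Rightarrow> real"
  assumes "\<And>x. (F has_real_derivative F' x) (at x)" "\<And>x. \<bar>F' x\<bar> \<le> M"
  shows "\<bar>F a - F b\<bar> \<le> M * \<bar>a - b\<bar>"
  using field_differentiable_bound[of UNIV F F' M a b] assms by (auto intro: has_field_derivative_at_within)

lemma integrable_Lipschitz_comp:
  fixes F :: "real \<Rightarrow> real"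
  assumes F: "F \<in> borel_measurable borel" "\<And>a b. \<bar>F a - F b\<bar> \<le> L * \<bar>a - b\<bar>"
    and v: "integrable M v" and \<psi>: "integrable M \<psi>" "\<And>x. \<bar>\<psi> x\<bar> \<le> B"
  shows "integrable M (\<lambda>x. F (v x) * \<psi> x)"
proof (rule Bochner_Integration.integrable_bound)
  note [measurable] = F(1) borel_measurable_integrable[OF v] borel_measurable_integrable[OF \<psi>(1)]
  show "integrable M (\<lambda>x. \<bar>F 0\<bar> * \<bar>\<psi> x\<bar> + B * (L * \<bar>v x\<bar>))" using v \<psi> by simp
  have "\<bar>F (v x) * \<psi> x\<bar> \<le> \<bar>F 0\<bar> * \<bar>\<psi> x\<bar> + B * (L * \<bar>v x\<bar>)" for x
  proof -
    have "\<bar>F (v x)\<bar> \<le> \<bar>F 0\<bar> + L * \<bar>v x\<bar>" using F(2)[of "v x" 0] by simp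
    then have "\<bar>F (v x) * \<psi> x\<bar> \<le> (\<bar>F 0\<bar> + L * \<bar>v x\<bar>) * \<bar>\<psi> x\<bar>"
      unfolding abs_mult by (rule mult_right_mono) simp
    moreover have "(L * \<bar>v x\<bar>) * \<bar>\<psi> x\<bar> \<le> (L * \<bar>v x\<bar>) * B"
      using F(2)[of "v x" 0] by (intro mult_left_mono \<psi>(2)) (simp add: order_trans[OF abs_ge_zero])
    ultimately show ?thesis by (simp add: algebra_simps)
  qed
  then show "AE x in M. norm (F (v x) * \<psi> x) \<le> norm (\<bar>F 0\<bar> * \<bar>\<psi> x\<bar> + B * (L * \<bar>v x\<bar>))"
    by (intro AE_I2) (simp add: order_trans[OF _ abs_ge_self])
  show "(\<lambda>x. F (v x) * \<psi> x) \<in> borel_measurable M" by measurable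
qed

lemma integral_Lipschitz_comp_tendsto:
  fixes F :: "real \<Rightarrow> real"
  assumes F: "F \<in> borel_measurable borel" "\<And>a b. \<bar>F a - F b\<bar> \<le> L * \<bar>a - b\<bar>"
    and v: "\<And>n. integrable M (v n)" "integrable M u" "(\<lambda>n. \<integral>x. \<bar>v n x - u x\<bar> \<partial>M) \<longlonglongrightarrow> 0"
    and \<psi>: "integrable M \<psi>" "\<And>x. \<bar>\<psi> x\<bar> \<le> B"
  shows "(\<lambda>n. \<integral>x. F (v n x) * \<psi> x \<partial>M) \<longlonglongrightarrow> (\<integral>x. F (u x) * \<psi> x \<partial>M)"
proof -
  note int = integrable_Lipschitz_comp[OF F v(1) \<psi>] integrable_Lipschitz_comp[OF F v(2) \<psi>]
  have lim: "(\<lambda>n. L * B * (\<integral>x. \<bar>v n x - u x\<bar> \<partial>M)) \<longlonglongrightarrow> 0"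
    using tendsto_mult[OF tendsto_const[of "L * B"] v(3)] by simp
  have "\<bar>(\<integral>x. F (v n x) * \<psi> x \<partial>M) - (\<integral>x. F (u x) * \<psi> x \<partial>M)\<bar> \<le> L * B * (\<integral>x. \<bar>v n x - u x\<bar> \<partial>M)" for n
  proof -
    have "\<bar>(\<integral>x. F (v n x) * \<psi> x \<partial>M) - (\<integral>x. F (u x) * \<psi> x \<partial>M)\<bar> \<le> (\<integral>x. \<bar>F (v n x) * \<psi> x - F (u x) * \<psi> x\<bar> \<partial>M)"
      using integral_abs_bound[of M "\<lambda>x. F (v n x) * \<psi> x - F (u x) * \<psi> x"] int by simp
    also have "\<dots> \<le> (\<integral>x. L * B * \<bar>v n x - u x\<bar> \<partial>M)"
    proof (rule integral_mono)
      fix x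
      have "\<bar>F (v n x) * \<psi> x - F (u x) * \<psi> x\<bar> = \<bar>F (v n x) - F (u x)\<bar> * \<bar>\<psi> x\<bar>"
        by (simp add: abs_mult[symmetric] left_diff_distrib)
      also have "\<dots> \<le> (L * \<bar>v n x - u x\<bar>) * B"
        by (rule mult_mono[OF F(2) \<psi>(2) order_trans[OF abs_ge_zero F(2)] abs_ge_zero])
      finally show "\<bar>F (v n x) * \<psi> x - F (u x) * \<psi> x\<bar> \<le> L * B * \<bar>v n x - u x\<bar>" by (simp add: mult_ac)
    qed (use int v in auto)
    finally show ?thesis by simp
  qed
  then have "(\<lambda>n. (\<integral>x. F (v n x) * \<psi> x \<partial>M) - (\<integral>x. F (u x) * \<psi> x \<partial>M)) \<longlonglongrightarrow> 0"
    by (intro Lim_null_comparison[OF always_eventually lim]) simp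
  then show ?thesis by (rule LIM_zero_cancel)
qed

lemma mollify_chain_derivative:
  fixes u :: "'n::finite fn"
  assumes w: "borel_weak_gradient \<Omega> u g" and \<Omega>: "open \<Omega>" and \<phi>: "smooth \<phi>" "continuous_kernel c d \<phi>" and t: "t > 0"
    and \<zeta>: "smooth \<zeta>" and sub: "\<And>x. x \<in> support \<zeta> \<Longrightarrow> cball (x + t *\<^sub>R c) (t * d) \<subseteq> \<Omega>"
    and F: "\<And>a. (F has_real_derivative F' a) (at a)"
  shows "((\<lambda>s. F (mollify \<phi> t u (x + s *\<^sub>R axis i 1)) * \<zeta> (x + s *\<^sub>R axis i 1)) has_real_derivative
    F (mollify \<phi> t u x) * partial i \<zeta> x + F' (mollify \<phi> t u x) * mollify \<phi> t (g i) x * \<zeta> x) (at 0)"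
proof (cases "x \<in> support \<zeta>")
  case True
  from F[of "mollify \<phi> t u x"] mollify_partial_derivative[OF w \<Omega> \<phi> t sub[OF True], of i]
  have "((\<lambda>s. F (mollify \<phi> t u (x + s *\<^sub>R axis i 1))) has_real_derivative
      F' (mollify \<phi> t u x) * mollify \<phi> t (g i) x) (at 0)"
    by (intro DERIV_chain2[of F]) simp_all
  from DERIV_mult[OF this smooth_axis_derivative[OF \<zeta> DERIV_ident, of x i]] show ?thesis
    by (elim DERIV_cong) (simp add: algebra_simps)
next
  case False
  have "((\<lambda>s. x + s *\<^sub>R axis i 1) \<longlongrightarrow> x + 0 *\<^sub>R axis i 1) (nhds (0::real))"
    by (intro tendsto_intros filterlim_ident)
  then have "eventually (\<lambda>s. x + s *\<^sub>R axis i 1 \<in> - support \<zeta>) (nhds (0::real))"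
    by (rule topological_tendstoD) (use False closed_support[of \<zeta>] in auto)
  then have zero: "eventually (\<lambda>s. F (mollify \<phi> t u (x + s *\<^sub>R axis i 1)) * \<zeta> (x + s *\<^sub>R axis i 1) = 0) (nhds 0)"
    by eventually_elim (simp add: eq_0_off_support[of _ \<zeta>])
  have "((\<lambda>s. F (mollify \<phi> t u (x + s *\<^sub>R axis i 1)) * \<zeta> (x + s *\<^sub>R axis i 1)) has_real_derivative 0) (at 0)"
    using DERIV_cong_ev[OF refl zero refl] by simp
  then show ?thesis by (simp add: eq_0_off_support[OF False] partial_eq_0_off_support[OF False])
qed

lemma mollify_chain_integral:
  fixes u :: "'n::finite fn"
  assumes w: "borel_weak_gradient \<Omega> u g" and u: "integrable lborel u" "integrable lborel (g i)" and \<Omega>: "open \<Omega>"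
    and \<phi>: "smooth \<phi>" "continuous_kernel c d \<phi>" and t: "t > 0" and \<zeta>: "test_fun \<Omega> \<zeta>"
    and sub: "\<And>x. x \<in> support \<zeta> \<Longrightarrow> cball (x + t *\<^sub>R c) (t * d) \<subseteq> \<Omega>"
    and F: "\<And>a. (F has_real_derivative F' a) (at a)" and F': "continuous_on UNIV F'" "\<And>a. \<bar>F' a\<bar> \<le> M"
  shows "(\<integral>x. F (mollify \<phi> t u x) * partial i \<zeta> x \<partial>lborel)
    = - (\<integral>x. (F' (mollify \<phi> t u x) * \<zeta> x) * mollify \<phi> t (g i) x \<partial>lborel)"
proof -
  let ?v = "mollify \<phi> t u" and ?w = "mollify \<phi> t (g i)"
  note \<zeta>D = test_funD[OF \<zeta>] and zero = eq_0_off_support[of _ \<zeta>] partial_eq_0_off_support[of _ \<zeta> i]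
  obtain R where k: "continuous_kernel 0 R \<zeta>" "continuous_kernel 0 R (partial i \<zeta>)"
    using test_fun_continuous_kernel[OF \<zeta>] by blast
  have F_cont: "continuous_on UNIV F" by (rule DERIV_continuous_on) (rule has_field_derivative_at_within[OF F])
  note [measurable] = borel_weak_gradientD(1,2)[OF w] continuous_kernelD(3)[OF \<phi>(2)] continuous_kernelD(3)[OF k(1)]
    continuous_kernelD(3)[OF k(2)] borel_measurable_continuous_onI[OF F_cont] borel_measurable_continuous_onI[OF F'(1)]
  define A where "A = sup_norm \<phi> / t ^ CARD('n) * (\<integral>y. \<bar>u y\<bar> \<partial>lborel)"
  define A' where "A' = sup_norm \<phi> / t ^ CARD('n) * (\<integral>y. \<bar>g i y\<bar> \<partial>lborel)"
  have v_le: "\<bar>?v x\<bar> \<le> A" and w_le: "\<bar>?w x\<bar> \<le> A'" for x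
    using mollify_bound[of UNIV u c d \<phi> t x] mollify_bound[of UNIV "g i" c d \<phi> t x] u \<phi>(2) t
    by (auto simp: A_def A'_def set_integrable_def set_lebesgue_integral_def)
  have M_nonneg: "M \<ge> 0" and A: "A \<ge> 0" "A' \<ge> 0"
    using F'(2)[of 0] v_le[of 0] w_le[of 0] by (linarith)+
  define B where "B = \<bar>F 0\<bar> + M * A"
  have B: "\<bar>F (?v x)\<bar> \<le> B" for x
    using Lipschitz_of_bounded_derivative[OF F F'(2), of "?v x" 0] mult_left_mono[OF v_le[of x] M_nonneg]
    unfolding B_def by simp
  have B_nonneg: "B \<ge> 0" using B[of 0] by linarith
  have bound: "\<bar>F (?v x) * \<zeta> x\<bar> \<le> B * sup_norm \<zeta>" "\<bar>F (?v x) * partial i \<zeta> x\<bar> \<le> B * sup_norm (partial i \<zeta>)"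
      "\<bar>F' (?v x) * ?w x * \<zeta> x\<bar> \<le> M * A' * sup_norm \<zeta>" for x
    unfolding abs_mult using M_nonneg A B_nonneg
    by (intro mult_mono B F'(2) w_le abs_le_sup_norm[OF k(1)] abs_le_sup_norm[OF k(2)]; simp)+
  have int: "integrable lborel (\<lambda>x. F (?v x) * partial i \<zeta> x)" "integrable lborel (\<lambda>x. F' (?v x) * ?w x * \<zeta> x)"
    by (rule integrable_bounded_compact_support[OF \<zeta>D(2) _ bound(2)], simp, simp add: zero)
      (rule integrable_bounded_compact_support[OF \<zeta>D(2) _ bound(3)], simp, simp add: zero)
  have "(\<integral>x. F (?v x) * partial i \<zeta> x + F' (?v x) * ?w x * \<zeta> x \<partial>lborel) = 0"
  proof (rule integral_directional_derivative_eq_0[OF \<zeta>D(2), where G="\<lambda>x. F (?v x) * \<zeta> x" and e="axis i 1"])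
    show "((\<lambda>s. F (?v (x + s *\<^sub>R axis i 1)) * \<zeta> (x + s *\<^sub>R axis i 1)) has_real_derivative
        F (?v x) * partial i \<zeta> x + F' (?v x) * ?w x * \<zeta> x) (at 0)" for x
      by (rule mollify_chain_derivative[OF w \<Omega> \<phi> t \<zeta>D(1) sub F])
    show "\<bar>F (?v x) * partial i \<zeta> x + F' (?v x) * ?w x * \<zeta> x\<bar> \<le> B * sup_norm (partial i \<zeta>) + M * A' * sup_norm \<zeta>" for x
      by (rule order_trans[OF abs_triangle_ineq add_mono[OF bound(2,3)]])
    show "\<bar>F (?v x) * \<zeta> x\<bar> \<le> B * sup_norm \<zeta>" for x by (rule bound(1))
  qed (simp_all add: zero)
  then show ?thesis using int by (simp add: mult.assoc mult.commute[of "\<zeta> _"])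
qed

lemma mollify_approximation:
  fixes u :: "'n::finite fn"
  assumes \<phi>: "mollifier c d \<phi>" and u: "integrable lborel u" and r: "r > 0"
  obtains t :: "nat \<Rightarrow> real" where "\<And>n. 0 < t n" "\<And>n. t n \<le> r"
    "AE x in lborel. (\<lambda>n. mollify \<phi> (t n) u x) \<longlonglongrightarrow> u x"
    "\<And>f. integrable lborel f \<Longrightarrow> (\<lambda>n. \<integral>x. \<bar>mollify \<phi> (t n) f x - f x\<bar> \<partial>lborel) \<longlonglongrightarrow> 0"
proof -
  define \<tau> where "\<tau> n = r / real (n + 1)" for n
  have \<tau>: "\<tau> n > 0" "\<tau> n \<le> r" for n using r by (auto simp: \<tau>_def field_simps)
  have \<tau>_lim: "\<tau> \<longlonglongrightarrow> 0" unfolding \<tau>_def by (rule LIMSEQ_Suc[OF lim_const_over_n, unfolded Suc_eq_plus1])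
  obtain q where q: "strict_mono q" "AE x in lborel. (\<lambda>n. mollify \<phi> (\<tau> (q n)) u x) \<longlonglongrightarrow> u x"
    using mollify_AE_subseq[OF u \<phi> \<tau>(1) \<tau>_lim] by blast
  show ?thesis
  proof (rule that[of "\<tau> \<circ> q"])
    fix f :: "'n fn" assume "integrable lborel f"
    from LIMSEQ_subseq_LIMSEQ[OF mollify_tendsto_L1[OF this \<phi> \<tau>(1) \<tau>_lim] q(1)]
    show "(\<lambda>n. \<integral>x. \<bar>mollify \<phi> ((\<tau> \<circ> q) n) f x - f x\<bar> \<partial>lborel) \<longlonglongrightarrow> 0" by (simp add: o_def)
  qed (use \<tau> q(2) in simp_all)
qed

lemma integrable_weak_gradient_chain:
  fixes u :: "'n::finite fn"
  assumes w: "borel_weak_gradient \<Omega> u g" and u: "integrable lborel u" "integrable lborel (g i)" and \<Omega>: "open \<Omega>"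
    and F: "\<And>a. (F has_real_derivative F' a) (at a)" and F': "continuous_on UNIV F'" "\<And>a. \<bar>F' a\<bar> \<le> M"
    and \<zeta>: "test_fun \<Omega> \<zeta>"
  shows "(\<integral>x. F (u x) * partial i \<zeta> x \<partial>lborel) = - (\<integral>x. F' (u x) * g i x * \<zeta> x \<partial>lborel)"
proof -
  obtain R where k: "continuous_kernel 0 R \<zeta>" "continuous_kernel 0 R (partial i \<zeta>)"
    using test_fun_continuous_kernel[OF \<zeta>] by blast
  have F_cont: "continuous_on UNIV F" by (rule DERIV_continuous_on) (rule has_field_derivative_at_within[OF F])
  obtain r where r: "r > 0" "(\<Union>x\<in>support \<zeta>. cball x r) \<subseteq> \<Omega>"
    using compact_subset_open_imp_cball_epsilon_subset[OF test_funD(2)[OF \<zeta>] \<Omega> test_funD(3)[OF \<zeta>]] by blast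
  obtain \<phi> :: "'n fn" where \<phi>: "mollifier 0 1 \<phi>" using mollifier_exists[of 1 0] by auto
  note \<phi>D = mollifierD(1,2)[OF \<phi>]
  note [measurable] = borel_weak_gradientD(1,2)[OF w] continuous_kernelD(3)[OF k(1)] continuous_kernelD(3)[OF \<phi>D(2)]
    borel_measurable_continuous_onI[OF F_cont] borel_measurable_continuous_onI[OF F'(1)]
  obtain t where t: "\<And>n. 0 < t n" "\<And>n. t n \<le> r" and AE_lim: "AE x in lborel. (\<lambda>n. mollify \<phi> (t n) u x) \<longlonglongrightarrow> u x"
    and L1_lim: "\<And>f. integrable lborel f \<Longrightarrow> (\<lambda>n. \<integral>x. \<bar>mollify \<phi> (t n) f x - f x\<bar> \<partial>lborel) \<longlonglongrightarrow> 0"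
    by (rule mollify_approximation[OF \<phi> u(1) r(1)]) (rule that)
  let ?v = "\<lambda>n. mollify \<phi> (t n) u" and ?w = "\<lambda>n. mollify \<phi> (t n) (g i)"
  have "(\<lambda>n. \<integral>x. F (?v n x) * partial i \<zeta> x \<partial>lborel) \<longlonglongrightarrow> (\<integral>x. F (u x) * partial i \<zeta> x \<partial>lborel)"
    by (rule integral_Lipschitz_comp_tendsto[OF _ Lipschitz_of_bounded_derivative[OF F F'(2)]
          integrable_mollify[OF u(1) \<phi> t(1)] u(1) L1_lim[OF u(1)] continuous_kernel_integrable[OF k(2)]
          abs_le_sup_norm[OF k(2)]]) simp
  moreover have "(\<lambda>n. \<integral>x. (F' (?v n x) * \<zeta> x) * ?w n x \<partial>lborel) \<longlonglongrightarrow> (\<integral>x. (F' (u x) * \<zeta> x) * g i x \<partial>lborel)"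
  proof (rule L1_tendsto_mult_bounded[where B="M * sup_norm \<zeta>",
        OF _ _ _ _ _ integrable_mollify[OF u(2) \<phi> t(1)] u(2) L1_lim[OF u(2)]])
    show "AE x in lborel. (\<lambda>n. F' (?v n x) * \<zeta> x) \<longlonglongrightarrow> F' (u x) * \<zeta> x"
      using AE_lim by eventually_elim (auto intro!: tendsto_intros continuous_on_tendsto_compose[OF F'(1)])
    have "M \<ge> 0" using F'(2)[of 0] by linarith
    then show "\<bar>F' (?v n x) * \<zeta> x\<bar> \<le> M * sup_norm \<zeta>" "\<bar>F' (u x) * \<zeta> x\<bar> \<le> M * sup_norm \<zeta>" for n x
      unfolding abs_mult by (intro mult_mono F'(2) abs_le_sup_norm[OF k(1)]; simp)+
  qed measurable
  moreover have "(\<integral>x. F (?v n x) * partial i \<zeta> x \<partial>lborel) = - (\<integral>x. (F' (?v n x) * \<zeta> x) * ?w n x \<partial>lborel)" for n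
  proof (rule mollify_chain_integral[OF w u \<Omega> \<phi>D t(1) \<zeta> _ F F'])
    fix x assume "x \<in> support \<zeta>"
    then have "cball x r \<subseteq> \<Omega>" using r(2) by blast
    then show "cball (x + t n *\<^sub>R 0) (t n * 1) \<subseteq> \<Omega>" using t(2)[of n] subset_cball by fastforce
  qed
  ultimately have "(\<integral>x. F (u x) * partial i \<zeta> x \<partial>lborel) = - (\<integral>x. (F' (u x) * \<zeta> x) * g i x \<partial>lborel)"
    using LIMSEQ_unique[OF _ tendsto_minus] by (simp only:)
  then show ?thesis by (simp add: mult_ac)
qed

lemma set_integrable_compact_const:
  fixes K :: "'a::euclidean_space set"
  shows "compact K \<Longrightarrow> set_integrable lborel K (\<lambda>x. C :: real)"
  using emeasure_compact_finite[of K] by (simp add: set_integrable_def borel_compact)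

lemma borel_weak_gradient_restrict:
  assumes w: "borel_weak_gradient \<Omega> u g" and K: "K \<subseteq> \<Omega>" "K \<in> sets borel"
  shows "borel_weak_gradient K (\<lambda>x. indicator K x * u x) (\<lambda>i x. indicator K x * g i x)"
  unfolding borel_weak_gradient_def
proof (intro conjI allI impI)
  note w' = borel_weak_gradient_subset[OF w K(1)]
  note [measurable] = K(2) borel_weak_gradientD(1,2)[OF w]
  show "(\<lambda>x. indicator K x * u x) \<in> borel_measurable borel" "(\<lambda>x. indicator K x * g i x) \<in> borel_measurable borel" for i
    by measurable
  fix i
  have restrict_eq: "indicator C x *\<^sub>R (indicator K x * f x) = indicator C x *\<^sub>R f x" if "C \<subseteq> K" for C x and f :: "'a fn"
    using that by (auto simp: indicator_def)
  show "set_integrable lborel C (\<lambda>x. indicator K x * u x)" "set_integrable lborel C (\<lambda>x. indicator K x * g i x)"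
    if "compact C \<and> C \<subseteq> K" for C
    using borel_weak_gradientD(3,4)[OF w', of C] that
    unfolding set_integrable_def restrict_eq[OF conjunct2[OF that]] by blast+
  fix \<phi> assume \<phi>: "test_fun K \<phi>"
  have "(indicator K x * u x) * partial i \<phi> x = u x * partial i \<phi> x" "(indicator K x * g i x) * \<phi> x = g i x * \<phi> x" for x
    using test_funD(3)[OF \<phi>] eq_0_off_support[of x \<phi>] partial_eq_0_off_support[of x \<phi> i]
    by (cases "x \<in> support \<phi>"; auto)+
  then have "(\<integral>x. (indicator K x * u x) * partial i \<phi> x \<partial>lborel) = (\<integral>x. u x * partial i \<phi> x \<partial>lborel)"
      "(\<integral>x. (indicator K x * g i x) * \<phi> x \<partial>lborel) = (\<integral>x. g i x * \<phi> x \<partial>lborel)" by (simp_all only:)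
  then show "(\<integral>x. (indicator K x * u x) * partial i \<phi> x \<partial>lborel) = - (\<integral>x. (indicator K x * g i x) * \<phi> x \<partial>lborel)"
    using borel_weak_gradientD(5)[OF w' \<phi>] by simp
qed

lemma weak_gradient_chain_integral:
  fixes u :: "'n::finite fn"
  assumes w: "borel_weak_gradient \<Omega> u g" and \<Omega>: "open \<Omega>" and \<zeta>: "test_fun \<Omega> \<zeta>"
    and F: "\<And>a. (F has_real_derivative F' a) (at a)" and F': "continuous_on UNIV F'" "\<And>a. \<bar>F' a\<bar> \<le> M"
  shows "(\<integral>x. F (u x) * partial i \<zeta> x \<partial>lborel) = - (\<integral>x. F' (u x) * g i x * \<zeta> x \<partial>lborel)"
proof -
  note S = test_funD(2,3)[OF \<zeta>]
  obtain r where r: "r > 0" "(\<Union>x\<in>support \<zeta>. cball x r) \<subseteq> \<Omega>"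
    using compact_subset_open_imp_cball_epsilon_subset[OF S(1) \<Omega> S(2)] by blast
  let ?K = "\<Union>x\<in>support \<zeta>. cball x r"
  define U where "U = (\<Union>x\<in>support \<zeta>. ball x r)"
  have U: "open U" "support \<zeta> \<subseteq> U" "U \<subseteq> ?K" using r(1) by (auto simp: U_def)
  have U_borel: "U \<in> sets borel" using U(1) by simp
  have \<zeta>U: "test_fun U \<zeta>" using \<zeta> U(2) by (simp add: test_fun_iff)
  have wU: "borel_weak_gradient U (\<lambda>x. indicator U x * u x) (\<lambda>i x. indicator U x * g i x)"
    using U(3) r(2) by (intro borel_weak_gradient_restrict[OF w _ U_borel]) blast
  have "set_integrable lborel U f" if "set_integrable lborel ?K f" for f :: "'n fn"
    by (rule set_integrable_subset[OF that]) (use U_borel U(3) in simp_all)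
  from this[OF borel_weak_gradientD(3)[OF w compact_minkowski_sum_cball[OF S(1)] r(2)]]
    this[OF borel_weak_gradientD(4)[OF w compact_minkowski_sum_cball[OF S(1)] r(2), of i]]
  have int: "integrable lborel (\<lambda>x. indicator U x * u x)" "integrable lborel (\<lambda>x. indicator U x * g i x)"
    by (simp_all add: set_integrable_def)
  have localise: "F (indicator U x * u x) * partial i \<zeta> x = F (u x) * partial i \<zeta> x"
      "F' (indicator U x * u x) * (indicator U x * g i x) * \<zeta> x = F' (u x) * g i x * \<zeta> x" for x
    using eq_0_off_support[of x \<zeta>] partial_eq_0_off_support[of x \<zeta> i] U(2)
    by (cases "x \<in> support \<zeta>"; auto)+
  show ?thesis using integrable_weak_gradient_chain[OF wU int U(1) F F' \<zeta>U] unfolding localise .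
qed

lemma borel_weak_gradient_chain:
  fixes u :: "'n::finite fn"
  assumes w: "borel_weak_gradient \<Omega> u g" and \<Omega>: "open \<Omega>"
    and F: "\<And>a. (F has_real_derivative F' a) (at a)" and F': "continuous_on UNIV F'" "\<And>a. \<bar>F' a\<bar> \<le> M"
  shows "borel_weak_gradient \<Omega> (\<lambda>x. F (u x)) (\<lambda>i x. F' (u x) * g i x)"
  unfolding borel_weak_gradient_def
proof (intro conjI allI impI)
  have F_cont: "continuous_on UNIV F" by (rule DERIV_continuous_on) (rule has_field_derivative_at_within[OF F])
  note [measurable] = borel_weak_gradientD(1,2)[OF w]
    borel_measurable_continuous_onI[OF F_cont] borel_measurable_continuous_onI[OF F'(1)]
  show "(\<lambda>x. F (u x)) \<in> borel_measurable borel" "(\<lambda>x. F' (u x) * g i x) \<in> borel_measurable borel" for i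
    by measurable
  have M: "M \<ge> 0" using F'(2)[of 0] by linarith
  fix i
  show "set_integrable lborel K (\<lambda>x. F (u x))" if K: "compact K \<and> K \<subseteq> \<Omega>" for K
  proof (rule set_integrable_bound)
    show "set_integrable lborel K (\<lambda>x. \<bar>F 0\<bar> + M * \<bar>u x\<bar>)"
      using K borel_weak_gradientD(3)[OF w]
      by (intro set_integral_add set_integrable_mult_right set_integrable_abs set_integrable_compact_const) auto
    have "\<bar>F (u x)\<bar> \<le> \<bar>F 0\<bar> + M * \<bar>u x\<bar>" for x
      using Lipschitz_of_bounded_derivative[OF F F'(2), of "u x" 0] by simp
    then show "AE x in lborel. x \<in> K \<longrightarrow> norm (F (u x)) \<le> norm (\<bar>F 0\<bar> + M * \<bar>u x\<bar>)"
      using M by simp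
  qed (use K in \<open>auto simp: set_borel_measurable_def intro!: borel_measurable_times borel_measurable_indicator borel_compact\<close>)
  show "set_integrable lborel K (\<lambda>x. F' (u x) * g i x)" if K: "compact K \<and> K \<subseteq> \<Omega>" for K
  proof (rule set_integrable_bound)
    show "set_integrable lborel K (\<lambda>x. M * g i x)"
      using K borel_weak_gradientD(4)[OF w] by (intro set_integrable_mult_right) auto
    show "AE x in lborel. x \<in> K \<longrightarrow> norm (F' (u x) * g i x) \<le> norm (M * g i x)"
      using F'(2) M by (simp add: abs_mult mult_right_mono)
  qed (use K in \<open>auto simp: set_borel_measurable_def intro!: borel_measurable_times borel_measurable_indicator borel_compact\<close>)
  show "(\<integral>x. F (u x) * partial i \<zeta> x \<partial>lborel) = - (\<integral>x. F' (u x) * g i x * \<zeta> x \<partial>lborel)" if "test_fun \<Omega> \<zeta>" for \<zeta>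
    by (rule weak_gradient_chain_integral[OF w \<Omega> that F F'])
qed

section \<open>Powers and dyadic sums\<close>

lemma powr_add_le:
  fixes a b q :: real
  assumes "a \<ge> 0" "b \<ge> 0" "q \<ge> 0"
  shows "(a + b) powr q \<le> 2 powr q * (a powr q + b powr q)"
proof -
  have "(a + b) powr q \<le> (2 * max a b) powr q" using assms by (intro powr_mono2) auto
  also have "\<dots> = 2 powr q * max a b powr q" by (rule powr_mult)
  also have "\<dots> \<le> 2 powr q * (a powr q + b powr q)"
    by (intro mult_left_mono) (auto simp: max_def)
  finally show ?thesis .
qed

lemma powr_sum_le:
  fixes a :: "'i \<Rightarrow> real"
  assumes "finite I" "\<And>i. i \<in> I \<Longrightarrow> a i \<ge> 0" "q \<ge> 0"
  shows "(\<Sum>i\<in>I. a i) powr q \<le> real (card I) powr q * (\<Sum>i\<in>I. a i powr q)"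
proof (cases "I = {}")
  case False
  define m where "m = Max (a ` I)"
  have "m \<in> a ` I" unfolding m_def using assms(1) False by (intro Max_in) auto
  then obtain k where k: "k \<in> I" "m = a k" by auto
  have "(\<Sum>i\<in>I. a i) \<le> real (card I) * m"
    using sum_bounded_above[of I a m] assms(1) by (simp add: m_def)
  then have "(\<Sum>i\<in>I. a i) powr q \<le> (real (card I) * m) powr q"
    using assms by (intro powr_mono2) (auto intro: sum_nonneg)
  also have "\<dots> = real (card I) powr q * a k powr q" unfolding k(2) by (rule powr_mult)
  also have "\<dots> \<le> real (card I) powr q * (\<Sum>i\<in>I. a i powr q)"
    using assms k by (intro mult_left_mono member_le_sum[of k I "\<lambda>i. a i powr q"]) auto
  finally show ?thesis .
qed simp

lemma powr_le_powr_mult: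
  fixes x y a :: real
  assumes "0 \<le> x" "x \<le> y" "1 \<le> a"
  shows "x powr a \<le> y powr (a - 1) * x"
proof (cases "x = 0")
  case False
  then have "x powr a = x powr (a - 1) * x" using assms(1) by (simp add: powr_diff)
  also have "\<dots> \<le> y powr (a - 1) * x" using assms by (intro mult_right_mono powr_mono2) auto
  finally show ?thesis .
qed simp

lemma powr_le_one_plus_powr:
  fixes x a b :: real
  assumes "0 \<le> x" "0 < a" "a \<le> b"
  shows "x powr a \<le> 1 + x powr b"
proof (cases "x \<le> 1")
  case True
  then have "x powr a \<le> 1 powr a" using assms by (intro powr_mono2) auto
  then show ?thesis by (simp add: add_increasing2)
next
  case False
  then have "x powr a \<le> x powr b" using assms by (intro powr_mono) auto
  then show ?thesis by simp
qed

lemma ennreal_le_suminf_imp_le_term: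
  fixes a :: "nat \<Rightarrow> real"
  assumes h: "h \<ge> 0" and a: "\<And>j. a j \<ge> 0" and h_le: "ennreal h \<le> (\<Sum>j. ennreal (a j))"
    and \<rho>: "0 < \<rho>" "\<rho> < 1"
  obtains j where "h \<le> a j / (\<rho> ^ j * (1 - \<rho>))"
proof (rule ccontr)
  assume "\<not> thesis"
  with that have a_less: "a j < h * (1 - \<rho>) * \<rho> ^ j" for j
    using \<rho> by (force simp: not_le divide_less_eq mult_ac)
  have geometric_summable: "summable (\<lambda>j. h * (1 - \<rho>) * \<rho> ^ j)"
    using \<rho> by (intro summable_mult summable_geometric) auto
  have a_summable: "summable a"
    by (rule summable_comparison_test'[OF geometric_summable, of 0]) (use a_less a in \<open>auto simp: less_imp_le\<close>)
  have "0 < (\<Sum>j. h * (1 - \<rho>) * \<rho> ^ j - a j)"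
    using a_less by (intro suminf_pos summable_diff geometric_summable a_summable) auto
  also have "\<dots> = (\<Sum>j. h * (1 - \<rho>) * \<rho> ^ j) - (\<Sum>j. a j)"
    by (rule suminf_diff[OF geometric_summable a_summable, symmetric])
  also have "(\<Sum>j. h * (1 - \<rho>) * \<rho> ^ j) = h" using \<rho> by (simp add: suminf_mult suminf_geometric summable_geometric)
  finally have "(\<Sum>j. a j) < h" by simp
  moreover have "(\<Sum>j. ennreal (a j)) = ennreal (\<Sum>j. a j)" by (rule suminf_ennreal2[OF a a_summable])
  ultimately show False using h_le h a a_summable by (simp add: suminf_nonneg)
qed

lemma nn_integral_powr_le_suminf_rescaled:
  fixes a :: "nat \<Rightarrow> 'a \<Rightarrow> real"
  assumes meas: "\<And>j. a j \<in> borel_measurable M" and nonneg: "\<And>j x. a j x \<ge> 0"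
    and q: "q > 0" and \<rho>: "0 < \<rho>" "\<rho> < 1" and h: "\<And>x. h x \<ge> 0"
    and sum: "AE x in M. ennreal (h x) \<le> (\<Sum>j. ennreal (a j x))"
  shows "(\<integral>\<^sup>+x. ennreal (h x powr q) \<partial>M) \<le> (\<Sum>j. \<integral>\<^sup>+x. ennreal ((a j x / (\<rho> ^ j * (1 - \<rho>))) powr q) \<partial>M)"
proof -
  note [measurable] = meas
  have "AE x in M. ennreal (h x powr q) \<le> (\<Sum>j. ennreal ((a j x / (\<rho> ^ j * (1 - \<rho>))) powr q))"
    using sum
  proof eventually_elim
    case (elim x)
    obtain j where j: "h x \<le> a j x / (\<rho> ^ j * (1 - \<rho>))"
      using ennreal_le_suminf_imp_le_term[OF h nonneg elim \<rho>] .
    have "ennreal (h x powr q) \<le> ennreal ((a j x / (\<rho> ^ j * (1 - \<rho>))) powr q)"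
      using j h q by (intro ennreal_leI powr_mono2) auto
    also have "\<dots> = (\<Sum>i\<in>{j}. ennreal ((a i x / (\<rho> ^ i * (1 - \<rho>))) powr q))" by simp
    also have "\<dots> \<le> (\<Sum>j. ennreal ((a j x / (\<rho> ^ j * (1 - \<rho>))) powr q))" by (rule sum_le_suminf) auto
    finally show ?case .
  qed
  then have "(\<integral>\<^sup>+x. ennreal (h x powr q) \<partial>M) \<le> (\<integral>\<^sup>+x. (\<Sum>j. ennreal ((a j x / (\<rho> ^ j * (1 - \<rho>))) powr q)) \<partial>M)"
    by (rule nn_integral_mono_AE)
  then show ?thesis by (subst (asm) nn_integral_suminf) simp_all
qed

text \<open>This replaces Minkowski's inequality for dyadic sums; the ratio of the rescaling is chosen such that
  \<open>\<rho> ^ (2 * q) = \<theta>\<close>.\<close>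

lemma nn_integral_powr_suminf_geometric:
  fixes a :: "nat \<Rightarrow> 'a \<Rightarrow> real"
  assumes meas: "\<And>j. a j \<in> borel_measurable M" and nonneg: "\<And>j x. a j x \<ge> 0"
    and q: "q > 0" and \<theta>: "0 < \<theta>" "\<theta> < 1" and D: "D \<ge> 0" and h: "\<And>x. h x \<ge> 0"
    and sum: "AE x in M. ennreal (h x) \<le> (\<Sum>j. ennreal (a j x))"
    and geometric: "\<And>j. (\<integral>\<^sup>+x. ennreal (a j x powr q) \<partial>M) \<le> ennreal (D * \<theta> ^ j)"
  shows "(\<integral>\<^sup>+x. ennreal (h x powr q) \<partial>M) \<le> ennreal (D / ((1 - \<theta> powr (1 / (2 * q))) powr q * (1 - sqrt \<theta>)))"
proof -
  note [measurable] = meas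
  define \<rho> where "\<rho> = \<theta> powr (1 / (2 * q))"
  have \<rho>: "0 < \<rho>" "\<rho> < 1" using \<theta> q powr_less_mono2[of "1 / (2 * q)" \<theta> 1] by (auto simp: \<rho>_def)
  define \<sigma> where "\<sigma> = sqrt \<theta>"
  have \<sigma>: "0 < \<sigma>" "\<sigma> < 1" "\<theta> ^ j = \<sigma> ^ j * \<sigma> ^ j" for j using \<theta> by (auto simp: \<sigma>_def power_mult_distrib[symmetric])
  define L where "L = 1 / (1 - \<rho>) powr q"
  have L: "L \<ge> 0" by (simp add: L_def)
  have \<rho>\<sigma>: "(\<rho> ^ j) powr q = \<sigma> ^ j" for j
    using \<theta> q by (simp add: \<rho>_def \<sigma>_def powr_realpow[symmetric] powr_powr powr_half_sqrt[symmetric])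
  have rescaled: "(a j x / (\<rho> ^ j * (1 - \<rho>))) powr q = L / \<sigma> ^ j * a j x powr q" for j x
    by (simp add: powr_divide powr_mult \<rho>\<sigma> L_def)
  have "(\<integral>\<^sup>+x. ennreal (h x powr q) \<partial>M) \<le> (\<Sum>j. \<integral>\<^sup>+x. ennreal ((a j x / (\<rho> ^ j * (1 - \<rho>))) powr q) \<partial>M)"
    by (rule nn_integral_powr_le_suminf_rescaled[OF meas nonneg q \<rho> h sum])
  also have "\<dots> \<le> (\<Sum>j. ennreal (L * D * \<sigma> ^ j))"
  proof (rule suminf_le)
    fix j
    have "(\<integral>\<^sup>+x. ennreal ((a j x / (\<rho> ^ j * (1 - \<rho>))) powr q) \<partial>M)
        = ennreal (L / \<sigma> ^ j) * (\<integral>\<^sup>+x. ennreal (a j x powr q) \<partial>M)"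
      unfolding rescaled using L \<sigma> by (subst nn_integral_cmult[symmetric]) (auto simp: ennreal_mult'[symmetric])
    also have "\<dots> \<le> ennreal (L / \<sigma> ^ j) * ennreal (D * \<theta> ^ j)" by (rule mult_left_mono[OF geometric]) simp
    also have "\<dots> = ennreal (L * D * \<sigma> ^ j)"
      using L \<sigma> by (simp add: ennreal_mult'[symmetric] mult.assoc)
    finally show "(\<integral>\<^sup>+x. ennreal ((a j x / (\<rho> ^ j * (1 - \<rho>))) powr q) \<partial>M) \<le> ennreal (L * D * \<sigma> ^ j)" .
  qed auto
  also have "\<dots> = ennreal (\<Sum>j. L * D * \<sigma> ^ j)"
    using \<sigma> L D by (intro suminf_ennreal2) (auto intro!: summable_mult summable_geometric)
  also have "(\<Sum>j. L * D * \<sigma> ^ j) = L * D / (1 - \<sigma>)"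
    using \<sigma> by (simp add: suminf_mult suminf_geometric summable_geometric)
  finally show ?thesis by (simp add: L_def \<rho>_def \<sigma>_def)
qed

lemma ennreal_abs_diff_le_suminf:
  fixes a b :: "nat \<Rightarrow> real"
  assumes step: "\<And>j. \<bar>a (Suc j) - a j\<bar> \<le> b j" and lim: "(\<lambda>n. a (r n)) \<longlonglongrightarrow> l"
  shows "ennreal \<bar>l - a 0\<bar> \<le> (\<Sum>j. ennreal (b j))"
proof (rule Lim_bounded)
  show "(\<lambda>n. ennreal \<bar>a (r n) - a 0\<bar>) \<longlonglongrightarrow> ennreal \<bar>l - a 0\<bar>" by (intro tendsto_intros lim)
  have b: "b j \<ge> 0" for j using step[of j] abs_ge_zero order_trans by blast
  have telescope: "\<bar>a n - a 0\<bar> \<le> (\<Sum>j<n. b j)" for n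
  proof (induction n)
    case (Suc n)
    then show ?case using step[of n] by simp
  qed simp
  have "ennreal \<bar>a n - a 0\<bar> \<le> (\<Sum>j. ennreal (b j))" for n
  proof -
    have "ennreal \<bar>a n - a 0\<bar> \<le> (\<Sum>j<n. ennreal (b j))"
      using telescope[of n] b by (simp add: sum_ennreal ennreal_leI)
    also have "\<dots> \<le> (\<Sum>j. ennreal (b j))" by (rule sum_le_suminf) auto
    finally show ?thesis .
  qed
  then show "\<forall>n\<ge>0. ennreal \<bar>a (r n) - a 0\<bar> \<le> (\<Sum>j. ennreal (b j))" by blast
qed

section \<open>Integrals over balls\<close>

definition ball_integral :: "'n::finite fn \<Rightarrow> real \<Rightarrow> 'n fn" where
  "ball_integral G r x = (LINT y:ball x r|lborel. G y)"

lemma borel_measurable_indicator_ball[measurable]: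
  "(\<lambda>p. indicator (ball (fst p) r) (snd p) :: real) \<in> borel_measurable (borel \<Otimes>\<^sub>M (borel :: (real^'n::finite) measure))"
proof -
  have "{p :: (real^'n) \<times> (real^'n). dist (fst p) (snd p) < r} \<in> sets (borel \<Otimes>\<^sub>M borel)"
    unfolding borel_prod by (intro borel_open open_Collect_less continuous_intros)
  moreover have "(\<lambda>p. indicator (ball (fst p) r) (snd p) :: real)
      = indicator {p :: (real^'n) \<times> (real^'n). dist (fst p) (snd p) < r}"
    by (auto simp: fun_eq_iff indicator_def)
  ultimately show ?thesis by simp
qed

lemma borel_measurable_ball_integral[measurable]:
  assumes [measurable]: "G \<in> borel_measurable borel"
  shows "ball_integral G r \<in> borel_measurable borel"
proof -
  have "(\<lambda>(x,y). indicator (ball x r) y *\<^sub>R G y) \<in> borel_measurable (borel \<Otimes>\<^sub>M lborel)"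
    unfolding case_prod_beta by measurable
  from lborel.borel_measurable_lebesgue_integral[OF this] show ?thesis
    unfolding ball_integral_def[abs_def] set_lebesgue_integral_def .
qed

lemma set_integrable_ball:
  fixes G :: "'n::finite fn"
  shows "integrable lborel G \<Longrightarrow> set_integrable lborel (ball x r) G"
  unfolding set_integrable_def by (rule integrable_mult_indicator) simp_all

lemma ball_integral_nonneg: "(\<And>y. G y \<ge> 0) \<Longrightarrow> ball_integral G r x \<ge> 0"
  unfolding ball_integral_def set_lebesgue_integral_def by (rule integral_nonneg_AE) simp

lemma ball_integral_mono:
  assumes "integrable lborel G" "\<And>y. G y \<ge> 0" "r \<le> s"
  shows "ball_integral G r x \<le> ball_integral G s x"
  unfolding ball_integral_def set_lebesgue_integral_def
  by (intro integral_mono set_integrable_ball[OF assms(1), unfolded set_integrable_def])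
    (use assms(2,3) in \<open>auto simp: indicator_def\<close>)

lemma ball_integral_le_integral:
  assumes "integrable lborel G" "\<And>y. G y \<ge> 0"
  shows "ball_integral G r x \<le> (\<integral>y. G y \<partial>lborel)"
  unfolding ball_integral_def set_lebesgue_integral_def
  by (intro integral_mono set_integrable_ball[OF assms(1), unfolded set_integrable_def] assms(1))
    (use assms(2) in \<open>auto simp: indicator_def\<close>)

lemma measure_lborel_ball:
  "r \<ge> 0 \<Longrightarrow> measure lborel (ball (x::real^'n::finite) r) = r ^ CARD('n) * measure lborel (ball (0::real^'n) 1)"
  using content_ball_conv_unit_ball[of r x] by simp

lemma nn_integral_ball_integral:
  fixes G :: "'n::finite fn"
  assumes G: "integrable lborel G" "\<And>y. G y \<ge> 0" and r: "r \<ge> 0"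
  shows "(\<integral>\<^sup>+x. ennreal (ball_integral G r x) \<partial>lborel)
    = ennreal (measure lborel (ball (0::real^'n) r) * (\<integral>y. G y \<partial>lborel))"
proof -
  let ?V = "measure lborel (ball (0::real^'n) r)"
  have [measurable]: "G \<in> borel_measurable borel" using G by auto
  have "(\<integral>\<^sup>+x. ennreal (ball_integral G r x) \<partial>lborel)
      = (\<integral>\<^sup>+x. (\<integral>\<^sup>+y. ennreal (indicator (ball x r) y * G y) \<partial>lborel) \<partial>lborel)"
    using set_integrable_ball[OF G(1), of _ r] G(2)
    by (intro nn_integral_cong)
      (simp add: ball_integral_def set_lebesgue_integral_def set_integrable_def nn_integral_eq_integral)
  also have "\<dots> = (\<integral>\<^sup>+y. (\<integral>\<^sup>+x. ennreal (indicator (ball x r) y * G y) \<partial>lborel) \<partial>lborel)"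
    by (rule lborel_pair.Fubini'[where f="\<lambda>x y. ennreal (indicator (ball x r) y * G y)", symmetric])
      (unfold case_prod_beta, measurable)
  also have "\<dots> = (\<integral>\<^sup>+y. ennreal (G y) * ennreal ?V \<partial>lborel)"
  proof (rule nn_integral_cong)
    fix y
    have "(\<integral>\<^sup>+x. ennreal (indicator (ball x r) y * G y) \<partial>lborel) = (\<integral>\<^sup>+x. ennreal (G y) * indicator (ball y r) x \<partial>lborel)"
      by (rule nn_integral_cong) (auto simp: indicator_def dist_commute)
    also have "\<dots> = ennreal (G y) * emeasure lborel (ball y r)" by (simp add: nn_integral_cmult_indicator)
    also have "emeasure lborel (ball y r) = ennreal ?V"
      using emeasure_lborel_ball_finite[of y r] measure_lborel_ball[OF r, of y]
        measure_lborel_ball[OF r, of "0::real^'n"]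
      by (subst emeasure_eq_ennreal_measure) auto
    finally show "(\<integral>\<^sup>+x. ennreal (indicator (ball x r) y * G y) \<partial>lborel) = ennreal (G y) * ennreal ?V" .
  qed
  also have "\<dots> = ennreal (\<integral>y. G y \<partial>lborel) * ennreal ?V"
    using G by (simp add: nn_integral_multc nn_integral_eq_integral)
  finally show ?thesis using G by (simp add: ennreal_mult'[symmetric] mult.commute)
qed

lemma ball_integral_le_threshold:
  fixes G :: "'n::finite fn"
  assumes G: "integrable lborel G" and G_powr: "integrable lborel (\<lambda>y. G y powr b)"
    and b: "b \<ge> 1" and r: "r > 0" and l: "l > 0"
  shows "ball_integral G r x
    \<le> l * measure lborel (ball (0::real^'n) r) + l powr (1 - b) * ball_integral (\<lambda>y. G y powr b) r x"
proof -
  have ball: "measure lborel (ball x r) = measure lborel (ball (0::real^'n) r)"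
      "set_integrable lborel (ball x r) (\<lambda>_. l)"
    using r measure_lborel_ball[of r x] measure_lborel_ball[of r "0::real^'n"] emeasure_lborel_ball_finite[of x r]
    by (simp_all add: set_integrable_def)
  have "G y \<le> l + l powr (1 - b) * G y powr b" for y
  proof (cases "G y \<le> l")
    case False
    have "G y = G y powr (1 - b) * G y powr b" using False l by (simp add: powr_add[symmetric])
    also have "\<dots> \<le> l powr (1 - b) * G y powr b"
      using False l b by (intro mult_right_mono powr_mono2') auto
    finally show ?thesis using l by simp
  qed (use l in \<open>auto intro: order_trans\<close>)
  moreover have "set_integrable lborel (ball x r) (\<lambda>y. l + l powr (1 - b) * G y powr b)"
    using set_integrable_ball[OF G_powr] by (intro set_integral_add set_integrable_mult_right ball(2))
  ultimately have "ball_integral G r x \<le> (LINT y:ball x r|lborel. l + l powr (1 - b) * G y powr b)"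
    unfolding ball_integral_def by (intro set_integral_mono set_integrable_ball[OF G]) auto
  also have "\<dots> = l * measure lborel (ball (0::real^'n) r) + l powr (1 - b) * ball_integral (\<lambda>y. G y powr b) r x"
    using ball(2) set_integrable_ball[OF G_powr, of x r] unfolding ball_integral_def
    by (subst set_integral_add) (auto simp: set_lebesgue_integral_def ball(1))
  finally show ?thesis .
qed

lemma ball_integral_powr_le:
  fixes G :: "'n::finite fn"
  assumes G: "integrable lborel G" "\<And>y. G y \<ge> 0" and G_powr: "integrable lborel (\<lambda>y. G y powr b)"
    and b: "b \<ge> 1" and r: "r > 0"
  shows "ball_integral G r x powr b
    \<le> 2 powr b * measure lborel (ball (0::real^'n) r) powr (b - 1) * ball_integral (\<lambda>y. G y powr b) r x"
proof -
  define V where "V = measure lborel (ball (0::real^'n) r)"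
  define I where "I = ball_integral G r x"
  define J where "J = ball_integral (\<lambda>y. G y powr b) r x"
  have V_pos: "V > 0" using r unfolding V_def by simp
  have I_nonneg: "I \<ge> 0" unfolding I_def by (rule ball_integral_nonneg[OF G(2)])
  have J_nonneg: "J \<ge> 0" unfolding J_def by (rule ball_integral_nonneg) simp
  have "I powr b \<le> 2 powr b * V powr (b - 1) * J"
  proof (cases "I = 0")
    case False
    define l where "l = I / (2 * V)"
    have l: "l > 0" using False I_nonneg V_pos by (simp add: l_def)
    have "I \<le> l * V + l powr (1 - b) * J"
      unfolding I_def J_def V_def by (rule ball_integral_le_threshold[OF G(1) G_powr b r l])
    then have "l * V \<le> l powr (1 - b) * J" using V_pos by (simp add: l_def)
    then have "l powr (b - 1) * (l * V) \<le> l powr (b - 1) * (l powr (1 - b) * J)" by (rule mult_left_mono) simp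
    also have "\<dots> = J" using l by (simp add: mult.assoc[symmetric] powr_add[symmetric])
    finally have "l powr b * V \<le> J" using l by (simp add: powr_diff)
    moreover have "l powr b * V = I powr b / (2 powr b * V powr (b - 1))"
      using V_pos by (simp add: l_def powr_divide powr_mult powr_diff)
    ultimately show ?thesis using V_pos by (simp add: divide_le_eq mult_ac)
  qed (use J_nonneg in simp)
  then show ?thesis by (simp add: I_def J_def V_def)
qed

lemma nn_integral_ball_integral_powr_le:
  fixes G :: "'n::finite fn"
  assumes G: "integrable lborel G" "\<And>y. G y \<ge> 0" and G_powr: "integrable lborel (\<lambda>y. G y powr b)"
    and b: "b \<ge> 1" and r: "r > 0" and q: "q \<ge> b"
  shows "(\<integral>\<^sup>+x. ennreal (ball_integral G r x powr q) \<partial>lborel)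
     \<le> ennreal (2 powr q * measure lborel (ball (0::real^'n) r) powr ((b - 1) * q / b + 1) *
        (\<integral>y. G y powr b \<partial>lborel) powr (q / b))"
proof -
  define V where "V = measure lborel (ball (0::real^'n) r)"
  define N where "N = (\<integral>y. G y powr b \<partial>lborel)"
  define c where "c = 2 powr q * V powr ((b - 1) * q / b) * N powr (q/b - 1)"
  let ?J = "ball_integral (\<lambda>y. G y powr b) r"
  have V_pos: "V > 0" using r unfolding V_def by simp
  have [measurable]: "G \<in> borel_measurable borel" using G by auto
  have J_bounds: "?J x \<ge> 0" "?J x \<le> N" for x
    using ball_integral_le_integral[OF G_powr, of r x] by (auto intro: ball_integral_nonneg simp: N_def)
  have N: "N \<ge> 0" using J_bounds[of 0] by linarith
  have pointwise: "ball_integral G r x powr q \<le> c * ?J x" for x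
  proof -
    have "ball_integral G r x powr q = (ball_integral G r x powr b) powr (q / b)"
      using b by (simp add: powr_powr)
    also have "\<dots> \<le> (2 powr b * V powr (b - 1) * ?J x) powr (q / b)"
      using ball_integral_powr_le[OF G G_powr b r] q b by (intro powr_mono2) (auto simp: V_def)
    also have "\<dots> = 2 powr q * V powr ((b - 1) * q / b) * ?J x powr (q / b)"
      using V_pos b J_bounds by (simp add: powr_mult powr_powr)
    also have "?J x powr (q / b) \<le> N powr (q/b - 1) * ?J x"
      using J_bounds q b by (intro powr_le_powr_mult) auto
    finally show ?thesis by (simp add: c_def mult_left_mono mult.assoc)
  qed
  have "(\<integral>\<^sup>+x. ennreal (ball_integral G r x powr q) \<partial>lborel) \<le> (\<integral>\<^sup>+x. ennreal c * ennreal (?J x) \<partial>lborel)"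
    using pointwise by (intro nn_integral_mono) (simp add: c_def ennreal_mult'[symmetric] ennreal_leI)
  also have "\<dots> = ennreal c * ennreal (V * N)"
    using nn_integral_ball_integral[OF G_powr _ less_imp_le[OF r]] by (simp add: nn_integral_cmult V_def N_def)
  also have "\<dots> = ennreal (c * (V * N))" by (intro ennreal_mult'[symmetric]) (simp add: c_def)
  also have "c * (V * N) = 2 powr q * V powr ((b - 1) * q / b + 1) * N powr (q / b)"
    using V_pos N by (cases "N = 0") (simp_all add: c_def powr_add powr_diff)
  finally show ?thesis by (simp add: V_def N_def)
qed

section \<open>The subcritical Sobolev inequality on cone domains\<close>

definition integrable_weak_gradient :: "(real^'n::finite) set \<Rightarrow> 'n fn \<Rightarrow> ('n \<Rightarrow> 'n fn) \<Rightarrow> bool" where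
  "integrable_weak_gradient \<Omega> f g \<longleftrightarrow> borel_weak_gradient \<Omega> f g \<and>
     set_integrable lborel \<Omega> f \<and> (\<forall>i. set_integrable lborel \<Omega> (g i))"

lemma integrable_weak_gradientD:
  assumes "integrable_weak_gradient \<Omega> f g"
  shows "borel_weak_gradient \<Omega> f g" "set_integrable lborel \<Omega> f" "set_integrable lborel \<Omega> (g i)"
    "f \<in> borel_measurable borel" "g i \<in> borel_measurable borel"
  using assms borel_weak_gradientD(1,2) unfolding integrable_weak_gradient_def by blast+

lemma
  fixes f :: "'a \<Rightarrow> real"
  assumes meas[measurable]: "f \<in> borel_measurable M" "A \<in> sets M"
    and bound: "(\<integral>\<^sup>+x\<in>A. ennreal \<bar>f x\<bar> \<partial>M) \<le> ennreal N" and N: "N \<ge> 0"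
  shows set_integrable_if_nn_integral_le: "set_integrable M A f"
    and set_integral_abs_le_if_nn_integral_le: "(LINT x:A|M. \<bar>f x\<bar>) \<le> N"
proof -
  have norm_le: "(\<integral>\<^sup>+x. ennreal \<bar>indicator A x * f x\<bar> \<partial>M) \<le> ennreal N"
    using bound by (simp add: indicator_mult_ennreal abs_mult mult.commute)
  then have "(\<integral>\<^sup>+x. ennreal (norm (indicator A x * f x)) \<partial>M) < \<infinity>"
    using le_less_trans[OF norm_le ennreal_less_top] by simp
  then show int: "set_integrable M A f"
    unfolding set_integrable_def by (intro integrableI_bounded) simp_all
  have "(\<integral>\<^sup>+x. ennreal \<bar>indicator A x * f x\<bar> \<partial>M) = ennreal (\<integral>x. \<bar>indicator A x * f x\<bar> \<partial>M)"
    using int by (intro nn_integral_eq_integral) (simp_all add: set_integrable_def)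
  with norm_le N show "(LINT x:A|M. \<bar>f x\<bar>) \<le> N"
    by (simp add: set_lebesgue_integral_def abs_mult)
qed

definition sobolev_bounded :: "(real^'n::finite) set \<Rightarrow> real \<Rightarrow> real \<Rightarrow> 'n fn \<Rightarrow> ('n \<Rightarrow> 'n fn) \<Rightarrow> bool" where
  "sobolev_bounded \<Omega> b N f g \<longleftrightarrow> borel_weak_gradient \<Omega> f g \<and>
     (\<integral>\<^sup>+x\<in>\<Omega>. ennreal \<bar>f x\<bar> \<partial>lborel) \<le> ennreal N \<and>
     (\<forall>i. (\<integral>\<^sup>+x\<in>\<Omega>. ennreal (\<bar>g i x\<bar> powr b) \<partial>lborel) \<le> ennreal N)"

lemma sobolev_boundedD:
  assumes "sobolev_bounded \<Omega> b N f g"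
  shows "borel_weak_gradient \<Omega> f g" "f \<in> borel_measurable borel" "g i \<in> borel_measurable borel"
    "(\<integral>\<^sup>+x\<in>\<Omega>. ennreal \<bar>f x\<bar> \<partial>lborel) \<le> ennreal N"
    "(\<integral>\<^sup>+x\<in>\<Omega>. ennreal (\<bar>g i x\<bar> powr b) \<partial>lborel) \<le> ennreal N"
  using assms borel_weak_gradientD(1,2) unfolding sobolev_bounded_def by blast+

lemma nn_integral_powr_le_if_near_bounded:
  fixes f h :: "'a \<Rightarrow> real"
  assumes [measurable]: "f \<in> borel_measurable M" "h \<in> borel_measurable M" "A \<in> sets M"
    and h: "\<And>x. x \<in> A \<Longrightarrow> \<bar>h x\<bar> \<le> B" and B: "B \<ge> 0" and q: "q \<ge> 0"
  shows "(\<integral>\<^sup>+x\<in>A. ennreal (\<bar>f x\<bar> powr q) \<partial>M)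
    \<le> ennreal (2 powr q) * ((\<integral>\<^sup>+x\<in>A. ennreal (\<bar>f x - h x\<bar> powr q) \<partial>M) + ennreal (B powr q) * emeasure M A)"
proof -
  have pointwise: "\<bar>f x\<bar> powr q \<le> 2 powr q * (\<bar>f x - h x\<bar> powr q + B powr q)" if "x \<in> A" for x
  proof -
    have "\<bar>f x\<bar> powr q \<le> (\<bar>f x - h x\<bar> + B) powr q" using h[OF that] q by (intro powr_mono2) auto
    also have "\<dots> \<le> 2 powr q * (\<bar>f x - h x\<bar> powr q + B powr q)" using B q by (intro powr_add_le) auto
    finally show ?thesis .
  qed
  have "(\<integral>\<^sup>+x\<in>A. ennreal (\<bar>f x\<bar> powr q) \<partial>M)
      \<le> (\<integral>\<^sup>+x. ennreal (2 powr q) * (ennreal (\<bar>f x - h x\<bar> powr q) * indicator A x + ennreal (B powr q) * indicator A x) \<partial>M)"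
    using pointwise
    by (intro nn_integral_mono)
      (simp add: ennreal_mult'[symmetric] ennreal_plus[symmetric] ennreal_leI indicator_def del: ennreal_plus)
  also have "\<dots> = ennreal (2 powr q) * ((\<integral>\<^sup>+x\<in>A. ennreal (\<bar>f x - h x\<bar> powr q) \<partial>M) + ennreal (B powr q) * emeasure M A)"
    by (subst nn_integral_cmult, measurable) (subst nn_integral_add, simp_all add: nn_integral_cmult_indicator)
  finally show ?thesis .
qed

locale cone_domain =
  fixes \<Omega> A :: "(real^'n::finite) set" and c :: "real^'n" and d :: real and \<phi> :: "'n fn" and T :: real
  assumes open_domain: "open \<Omega>" and mollifier: "mollifier c d \<phi>"
    and inner_subset: "A \<subseteq> \<Omega>" and inner_borel[measurable]: "A \<in> sets borel" and height_pos: "T > 0"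
    and cone: "\<And>x t. x \<in> A \<Longrightarrow> 0 < t \<Longrightarrow> t \<le> T \<Longrightarrow> cball (x + t *\<^sub>R c) (t * d) \<subseteq> \<Omega>"
begin

lemmas mollifier_smooth = mollifierD(1)[OF mollifier]
  and mollifier_kernel = mollifierD(2)[OF mollifier]

lemma domain_borel[measurable]: "\<Omega> \<in> sets borel"
  using open_domain by simp

lemma mollifier_measurable[measurable]: "\<phi> \<in> borel_measurable borel"
  by (rule continuous_kernelD(3)[OF mollifier_kernel])

definition radius :: real where
  "radius = norm c + \<bar>d\<bar> + 1"

lemma radius_pos: "radius > 0"
  unfolding radius_def by (simp add: add_nonneg_pos)

lemma cball_subset_ball:
  assumes "t > 0"
  shows "cball (x + t *\<^sub>R c) (t * d) \<subseteq> ball x (radius * t)"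
proof
  fix y assume "y \<in> cball (x + t *\<^sub>R c) (t * d)"
  then have "dist x y \<le> norm (t *\<^sub>R c) + t * d"
    using dist_triangle[of x y "x + t *\<^sub>R c"] by (simp add: dist_norm)
  also have "\<dots> \<le> t * (norm c + \<bar>d\<bar>)" using assms by (simp add: distrib_left)
  also have "\<dots> < radius * t" using assms by (simp add: radius_def mult.commute)
  finally show "y \<in> ball x (radius * t)" by simp
qed

definition grad_norm :: "('n \<Rightarrow> 'n fn) \<Rightarrow> 'n fn" where
  "grad_norm g y = (\<Sum>i\<in>UNIV. indicator \<Omega> y * \<bar>g i y\<bar>)"

lemma grad_norm_nonneg: "grad_norm g y \<ge> 0"
  unfolding grad_norm_def by (simp add: sum_nonneg)

lemma grad_norm_integrable:
  assumes "integrable_weak_gradient \<Omega> f g"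
  shows "integrable lborel (grad_norm g)"
  using integrable_weak_gradientD(3)[OF assms] set_integrable_abs[of lborel \<Omega> "g _"]
  unfolding grad_norm_def[abs_def] set_integrable_def by (intro Bochner_Integration.integrable_sum) simp

lemma coordinate_kernel: "continuous_kernel c d (\<lambda>z. z $ i * \<phi> z)"
  using continuous_kernel_affine_coordinate_mult[OF mollifier_kernel, of 0 1 i] by simp

definition increment_const :: real where
  "increment_const = 2 ^ CARD('n) * (\<Sum>i\<in>UNIV. sup_norm (\<lambda>z. z $ i * \<phi> z))"

lemma increment_const_nonneg: "increment_const \<ge> 0"
  unfolding increment_const_def by (simp add: sum_nonneg sup_norm_nonneg[OF coordinate_kernel])

lemma mollify_gradient_bound:
  assumes g: "integrable_weak_gradient \<Omega> f g" and x: "x \<in> A" and s: "0 < s" "s \<le> T"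
  shows "\<bar>mollify (\<lambda>z. z $ i * \<phi> z) s (g i) x\<bar>
    \<le> sup_norm (\<lambda>z. z $ i * \<phi> z) / s ^ CARD('n) * ball_integral (grad_norm g) (radius * s) x"
proof -
  let ?K = "\<Omega> \<inter> ball x (radius * s)"
  note gD = integrable_weak_gradientD[OF g]
  have "set_integrable lborel ?K (g i)" by (rule set_integrable_subset[OF gD(3)]) auto
  then have "\<bar>mollify (\<lambda>z. z $ i * \<phi> z) s (g i) x\<bar>
      \<le> sup_norm (\<lambda>z. z $ i * \<phi> z) / s ^ CARD('n) * (LINT y:?K|lborel. \<bar>g i y\<bar>)"
    using cone[OF x s] cball_subset_ball[OF s(1), of x]
    by (intro mollify_bound[OF _ gD(5) coordinate_kernel s(1)]) auto
  moreover have "(LINT y:?K|lborel. \<bar>g i y\<bar>) \<le> ball_integral (grad_norm g) (radius * s) x"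
    unfolding ball_integral_def set_lebesgue_integral_def
  proof (rule integral_mono)
    show "integrable lborel (\<lambda>y. indicator ?K y *\<^sub>R \<bar>g i y\<bar>)"
      using set_integrable_abs[OF \<open>set_integrable lborel ?K (g i)\<close>] by (simp add: set_integrable_def)
    show "integrable lborel (\<lambda>y. indicator (ball x (radius * s)) y *\<^sub>R grad_norm g y)"
      using set_integrable_ball[OF grad_norm_integrable[OF g]] by (simp add: set_integrable_def)
    show "indicator ?K y *\<^sub>R \<bar>g i y\<bar> \<le> indicator (ball x (radius * s)) y *\<^sub>R grad_norm g y" for y
      using member_le_sum[of i UNIV "\<lambda>i. \<bar>g i y\<bar>"] by (auto simp: grad_norm_def indicator_def)
  qed
  ultimately show ?thesis
    using s sup_norm_nonneg[OF coordinate_kernel, of i]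
    by (meson divide_nonneg_nonneg less_imp_le mult_left_mono order_trans zero_le_power)
qed

lemma mollify_dyadic_increment:
  assumes g: "integrable_weak_gradient \<Omega> f g" and x: "x \<in> A" and t: "0 < t" "t \<le> T"
  shows "\<bar>mollify \<phi> (t/2) f x - mollify \<phi> t f x\<bar>
    \<le> increment_const * (t / t ^ CARD('n) * ball_integral (grad_norm g) (radius * t) x)"
proof -
  let ?n = "CARD('n)" and ?D = "\<lambda>s. \<Sum>i\<in>UNIV. mollify (\<lambda>z. z $ i * \<phi> z) s (g i) x"
  let ?S = "\<lambda>i. sup_norm (\<lambda>z. z $ i * \<phi> z)" and ?I = "\<lambda>s. ball_integral (grad_norm g) (radius * s) x"
  note S = sup_norm_nonneg[OF coordinate_kernel]
  have I_nonneg: "?I s \<ge> 0" for s by (rule ball_integral_nonneg[OF grad_norm_nonneg])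
  define Z where "Z = increment_const / t ^ ?n * ?I t"
  have Z: "Z \<ge> 0" using increment_const_nonneg I_nonneg t by (simp add: Z_def)
  have "norm (mollify \<phi> (t/2) f x - mollify \<phi> t f x) \<le> Z * norm (t/2 - t)"
  proof (rule field_differentiable_bound[of "{t/2..t}" _ ?D])
    fix s assume "s \<in> {t/2..t}"
    then have s: "0 < s" "s \<le> T" "t/2 \<le> s" "s \<le> t" using t by auto
    show "((\<lambda>s. mollify \<phi> s f x) has_field_derivative ?D s) (at s within {t/2..t})"
      by (rule has_field_derivative_at_within[OF mollify_scale_derivative[OF integrable_weak_gradientD(1)[OF g]
              open_domain mollifier_smooth mollifier_kernel s(1) cone[OF x s(1,2)]]])
    have "\<bar>mollify (\<lambda>z. z $ i * \<phi> z) s (g i) x\<bar> \<le> ?S i / (t/2) ^ ?n * ?I t" for i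
    proof (rule order_trans[OF mollify_gradient_bound[OF g x s(1,2)] mult_mono])
      show "?S i / s ^ ?n \<le> ?S i / (t/2) ^ ?n"
        using s t by (intro divide_left_mono power_mono S) auto
      show "?I s \<le> ?I t"
        using s radius_pos by (intro ball_integral_mono grad_norm_integrable[OF g] grad_norm_nonneg) auto
    qed (use t I_nonneg S in auto)
    then have "\<bar>?D s\<bar> \<le> (\<Sum>i\<in>UNIV. ?S i / (t/2) ^ ?n * ?I t)"
      by (intro order_trans[OF sum_abs sum_mono])
    also have "\<dots> = Z"
      by (simp add: Z_def increment_const_def sum_distrib_right sum_divide_distrib sum_distrib_left power_divide mult_ac)
    finally show "norm (?D s) \<le> Z" by simp
  qed (use t in auto)
  also have "\<dots> \<le> Z * t" using Z t by (intro mult_left_mono) auto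
  finally show ?thesis by (simp add: Z_def mult_ac)
qed

lemma mollify_error_AE:
  assumes g: "integrable_weak_gradient \<Omega> f g" and \<tau>: "0 < \<tau>" "\<tau> \<le> T"
  shows "AE x in lborel. x \<in> A \<longrightarrow> ennreal \<bar>f x - mollify \<phi> \<tau> f x\<bar> \<le>
     (\<Sum>j. ennreal (increment_const * (\<tau>/2^j / (\<tau>/2^j) ^ CARD('n) * ball_integral (grad_norm g) (radius * (\<tau>/2^j)) x)))"
proof -
  let ?f = "\<lambda>y. indicator \<Omega> y * f y" and ?t = "\<lambda>j::nat. \<tau> / 2 ^ j"
  have t: "0 < ?t j" "?t j \<le> T" for j
    using \<tau> power_increasing[of 0 j "2::real"] by (auto simp: divide_le_eq intro: order_trans)
  have "(\<lambda>j. \<tau> * (1/2)^j) \<longlonglongrightarrow> \<tau> * 0" by (intro tendsto_mult tendsto_const LIMSEQ_power_zero) simp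
  then have t_lim: "?t \<longlonglongrightarrow> 0" by (simp add: power_divide)
  have "integrable lborel ?f"
    using integrable_weak_gradientD(2)[OF g] by (simp add: set_integrable_def)
  then obtain r where "AE x in lborel. (\<lambda>n. mollify \<phi> (?t (r n)) ?f x) \<longlonglongrightarrow> ?f x"
    using mollify_AE_subseq[OF _ mollifier t(1) t_lim] by blast
  then show ?thesis
  proof eventually_elim
    case (elim x)
    show ?case
    proof
      assume x: "x \<in> A"
      have "mollify \<phi> (?t j) ?f x = mollify \<phi> (?t j) f x" for j
        using subsetD[OF cone[OF x t]] by (intro mollify_cong[OF mollifier_kernel t(1)]) (simp add: indicator_def)
      moreover have "?f x = f x" using x inner_subset by auto
      ultimately have lim: "(\<lambda>n. mollify \<phi> (?t (r n)) f x) \<longlonglongrightarrow> f x" using elim by (simp only:)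
      have "\<bar>mollify \<phi> (?t (Suc j)) f x - mollify \<phi> (?t j) f x\<bar>
          \<le> increment_const * (?t j / ?t j ^ CARD('n) * ball_integral (grad_norm g) (radius * ?t j) x)" for j
        using mollify_dyadic_increment[OF g x t[of j]] by (simp add: mult.commute[of 2])
      from ennreal_abs_diff_le_suminf[of "\<lambda>j. mollify \<phi> (?t j) f x", OF this lim]
      show "ennreal \<bar>f x - mollify \<phi> \<tau> f x\<bar> \<le> (\<Sum>j. ennreal (increment_const *
          (?t j / ?t j ^ CARD('n) * ball_integral (grad_norm g) (radius * ?t j) x)))" by simp
    qed
  qed
qed

definition sobolev_gain :: "real \<Rightarrow> real \<Rightarrow> real" where
  "sobolev_gain b q = q - real CARD('n) * q / b + real CARD('n)"

lemma sobolev_gain_pos: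
  assumes "q > 0" "real CARD('n) / b - real CARD('n) / q < 1"
  shows "sobolev_gain b q > 0"
proof -
  have "sobolev_gain b q = q * (1 - (real CARD('n) / b - real CARD('n) / q))"
    using assms by (simp add: sobolev_gain_def field_simps)
  then show ?thesis using assms by simp
qed

definition increment_Lq_const :: "real \<Rightarrow> real \<Rightarrow> real" where
  "increment_Lq_const b q = increment_const powr q *
     (2 powr q * (radius ^ CARD('n) * measure lborel (ball (0::real^'n) 1)) powr ((b - 1) * q / b + 1))"

lemma nn_integral_increment_powr_le:
  assumes g: "integrable_weak_gradient \<Omega> f g" and G_powr: "integrable lborel (\<lambda>y. grad_norm g y powr b)"
    and b: "b \<ge> 1" and q: "q \<ge> b" and t: "t > 0"
  shows "(\<integral>\<^sup>+x. ennreal ((increment_const * (t / t ^ CARD('n) * ball_integral (grad_norm g) (radius * t) x)) powr q) \<partial>lborel)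
    \<le> ennreal (increment_Lq_const b q * t powr sobolev_gain b q * (\<integral>y. grad_norm g y powr b \<partial>lborel) powr (q / b))"
proof -
  let ?n = "real CARD('n)" and ?I = "ball_integral (grad_norm g) (radius * t)"
  define e where "e = (b - 1) * q / b + 1"
  define V where "V = radius ^ CARD('n) * measure lborel (ball (0::real^'n) 1)"
  define N where "N = (\<integral>y. grad_norm g y powr b \<partial>lborel)"
  define D where "D = increment_const powr q * t powr ((1 - ?n) * q)"
  note G = grad_norm_integrable[OF g]
  note [measurable] = borel_measurable_integrable[OF G, unfolded measurable_lborel1]
  have V_pos: "V > 0" using radius_pos by (simp add: V_def)
  have t_power: "t ^ CARD('n) = t powr ?n" using t by (simp add: powr_realpow)
  have "(increment_const * (t / t ^ CARD('n) * ?I x)) powr q = D * ?I x powr q" for x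
    using t by (simp add: D_def t_power powr_mult powr_divide powr_powr powr_diff left_diff_distrib)
  then have "(\<integral>\<^sup>+x. ennreal ((increment_const * (t / t ^ CARD('n) * ?I x)) powr q) \<partial>lborel)
      = ennreal D * (\<integral>\<^sup>+x. ennreal (?I x powr q) \<partial>lborel)"
    by (subst nn_integral_cmult[symmetric]) (simp_all add: ennreal_mult' D_def)
  also have "\<dots> \<le> ennreal D * ennreal (2 powr q * measure lborel (ball (0::real^'n) (radius * t)) powr e * N powr (q / b))"
    unfolding e_def N_def using radius_pos t
    by (intro mult_left_mono nn_integral_ball_integral_powr_le[OF G grad_norm_nonneg G_powr b _ q]) auto
  also have "measure lborel (ball (0::real^'n) (radius * t)) powr e = V powr e * t powr (?n * e)"
  proof -
    have "measure lborel (ball (0::real^'n) (radius * t)) = V * t powr ?n"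
      using radius_pos t measure_lborel_ball[of "radius * t" "0::real^'n"] by (simp add: V_def power_mult_distrib t_power)
    then show ?thesis by (simp only: powr_mult powr_powr)
  qed
  also have "ennreal D * ennreal (2 powr q * (V powr e * t powr (?n * e)) * N powr (q / b))
      = ennreal (increment_const powr q * (2 powr q * V powr e) * (t powr ((1 - ?n) * q) * t powr (?n * e)) * N powr (q / b))"
    by (simp add: ennreal_mult'[symmetric] D_def mult_ac)
  also have "t powr ((1 - ?n) * q) * t powr (?n * e) = t powr sobolev_gain b q"
  proof -
    have "(1 - ?n) * q + ?n * e = sobolev_gain b q" using b by (simp add: e_def sobolev_gain_def field_simps)
    then show ?thesis by (simp only: powr_add[symmetric])
  qed
  finally show ?thesis by (simp add: increment_Lq_const_def V_def e_def N_def)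
qed

definition sobolev_const :: "real \<Rightarrow> real \<Rightarrow> real" where
  "sobolev_const b q = (let \<theta> = 2 powr (- sobolev_gain b q)
     in increment_Lq_const b q / ((1 - \<theta> powr (1 / (2 * q))) powr q * (1 - sqrt \<theta>)))"

lemma sobolev_const_nonneg:
  assumes "q > 0" "real CARD('n) / b - real CARD('n) / q < 1"
  shows "sobolev_const b q \<ge> 0"
proof -
  have "2 powr (- sobolev_gain b q) \<le> 1"
    using sobolev_gain_pos[OF assms] powr_mono[of "- sobolev_gain b q" 0 2] by simp
  then show ?thesis by (simp add: sobolev_const_def increment_Lq_const_def Let_def)
qed

lemma mollify_error_Lq:
  assumes g: "integrable_weak_gradient \<Omega> f g" and G_powr: "integrable lborel (\<lambda>y. grad_norm g y powr b)"
    and b: "b \<ge> 1" and q: "q \<ge> b" and subcritical: "real CARD('n) / b - real CARD('n) / q < 1"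
    and \<tau>: "0 < \<tau>" "\<tau> \<le> T"
  shows "(\<integral>\<^sup>+x\<in>A. ennreal (\<bar>f x - mollify \<phi> \<tau> f x\<bar> powr q) \<partial>lborel)
    \<le> ennreal (sobolev_const b q * \<tau> powr sobolev_gain b q * (\<integral>y. grad_norm g y powr b \<partial>lborel) powr (q / b))"
proof -
  let ?\<kappa> = "sobolev_gain b q" and ?t = "\<lambda>j::nat. \<tau> / 2 ^ j"
  let ?a = "\<lambda>j x. increment_const * (?t j / ?t j ^ CARD('n) * ball_integral (grad_norm g) (radius * ?t j) x)"
  define \<theta> where "\<theta> = 2 powr (- ?\<kappa>)"
  define D where "D = increment_Lq_const b q * \<tau> powr ?\<kappa> * (\<integral>y. grad_norm g y powr b \<partial>lborel) powr (q / b)"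
  have q_pos: "q > 0" using b q by simp
  have \<theta>: "0 < \<theta>" "\<theta> < 1" using sobolev_gain_pos[OF q_pos subcritical] by (auto simp: \<theta>_def powr_less_one)
  note [measurable] = borel_measurable_integrable[OF grad_norm_integrable[OF g], unfolded measurable_lborel1]
  have t: "?t j powr ?\<kappa> = \<tau> powr ?\<kappa> * \<theta> ^ j" for j
  proof -
    have "(2 ^ j) powr ?\<kappa> = (2 powr ?\<kappa>) ^ j" by (simp add: powr_realpow[symmetric] powr_powr mult.commute)
    then show ?thesis by (simp add: powr_divide \<theta>_def powr_minus power_inverse field_simps)
  qed
  have "(\<integral>\<^sup>+x. ennreal ((indicator A x * \<bar>f x - mollify \<phi> \<tau> f x\<bar>) powr q) \<partial>lborel)
      \<le> ennreal (D / ((1 - \<theta> powr (1 / (2 * q))) powr q * (1 - sqrt \<theta>)))"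
  proof (rule nn_integral_powr_suminf_geometric[where a="?a"])
    show "?a j x \<ge> 0" for j x
      using increment_const_nonneg \<tau> ball_integral_nonneg[of "grad_norm g", OF grad_norm_nonneg] by simp
    show "AE x in lborel. ennreal (indicator A x * \<bar>f x - mollify \<phi> \<tau> f x\<bar>) \<le> (\<Sum>j. ennreal (?a j x))"
      using mollify_error_AE[OF g \<tau>] by eventually_elim (auto simp: indicator_def)
    show "(\<integral>\<^sup>+x. ennreal (?a j x powr q) \<partial>lborel) \<le> ennreal (D * \<theta> ^ j)" for j
      using nn_integral_increment_powr_le[OF g G_powr b q, of "?t j"] \<tau>(1) by (simp add: t D_def mult_ac)
    show "D \<ge> 0" by (simp add: D_def increment_Lq_const_def)
  qed (use q_pos \<theta> in auto)
  also have "(\<integral>\<^sup>+x. ennreal ((indicator A x * \<bar>f x - mollify \<phi> \<tau> f x\<bar>) powr q) \<partial>lborel)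
      = (\<integral>\<^sup>+x\<in>A. ennreal (\<bar>f x - mollify \<phi> \<tau> f x\<bar> powr q) \<partial>lborel)"
    using q_pos by (intro nn_integral_cong) (auto simp: indicator_def)
  finally show ?thesis by (simp add: sobolev_const_def \<theta>_def D_def Let_def mult_ac)
qed

lemma
  assumes f: "sobolev_bounded \<Omega> b N f g" and fin: "emeasure lborel \<Omega> < \<infinity>" and b: "b \<ge> 1" and N: "N \<ge> 0"
  shows integrable_weak_gradient_if_sobolev_bounded: "integrable_weak_gradient \<Omega> f g"
    and grad_norm_powr_integrable: "integrable lborel (\<lambda>y. grad_norm g y powr b)"
    and integral_grad_norm_powr_le: "(\<integral>y. grad_norm g y powr b \<partial>lborel) \<le> real CARD('n) powr b * (real CARD('n) * N)"
proof -
  let ?n = "real CARD('n)"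
  note fD = sobolev_boundedD[OF f]
  note [measurable] = fD(2,3)
  have g_powr: "set_integrable lborel \<Omega> (\<lambda>x. \<bar>g i x\<bar> powr b)" "(LINT x:\<Omega>|lborel. \<bar>g i x\<bar> powr b) \<le> N" for i
    using set_integrable_if_nn_integral_le[of "\<lambda>x. \<bar>g i x\<bar> powr b" lborel \<Omega> N]
      set_integral_abs_le_if_nn_integral_le[of "\<lambda>x. \<bar>g i x\<bar> powr b" lborel \<Omega> N] fD(5)[of i] N by simp_all
  have "set_integrable lborel \<Omega> (g i)" for i
  proof (rule set_integrable_bound)
    show "set_integrable lborel \<Omega> (\<lambda>x. 1 + \<bar>g i x\<bar> powr b)"
      using g_powr(1) fin by (intro set_integral_add) (simp_all add: set_integrable_def)
    show "AE x in lborel. x \<in> \<Omega> \<longrightarrow> norm (g i x) \<le> norm (1 + \<bar>g i x\<bar> powr b)"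
      using powr_le_one_plus_powr[of "\<bar>g i _\<bar>" 1 b] b by simp
  qed (simp add: set_borel_measurable_def)
  then show "integrable_weak_gradient \<Omega> f g"
    using fD(1) set_integrable_if_nn_integral_le[OF _ _ fD(4) N] by (simp add: integrable_weak_gradient_def)
  define H where "H x = ?n powr b * (\<Sum>i\<in>UNIV. indicator \<Omega> x * \<bar>g i x\<bar> powr b)" for x
  have H_int: "integrable lborel H" using g_powr(1) unfolding H_def[abs_def] set_integrable_def
    by (intro integrable_mult_right Bochner_Integration.integrable_sum) simp
  have grad_norm_powr_le: "grad_norm g x powr b \<le> H x" for x
    using powr_sum_le[of "UNIV::'n set" "\<lambda>i. indicator \<Omega> x * \<bar>g i x\<bar>" b] b
    by (cases "x \<in> \<Omega>") (simp_all add: H_def grad_norm_def)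
  have [measurable]: "grad_norm g \<in> borel_measurable borel" unfolding grad_norm_def[abs_def] by measurable
  show int: "integrable lborel (\<lambda>y. grad_norm g y powr b)"
    by (rule Bochner_Integration.integrable_bound[OF H_int])
      (use grad_norm_powr_le in \<open>auto intro: order_trans[OF _ abs_ge_self]\<close>)
  have "(\<integral>y. grad_norm g y powr b \<partial>lborel) \<le> (\<integral>x. H x \<partial>lborel)" by (rule integral_mono[OF int H_int grad_norm_powr_le])
  also have "\<dots> = ?n powr b * (\<Sum>i\<in>UNIV. LINT x:\<Omega>|lborel. \<bar>g i x\<bar> powr b)"
    unfolding H_def set_lebesgue_integral_def integral_mult_right_zero
    using g_powr(1) by (subst Bochner_Integration.integral_sum) (simp_all add: set_integrable_def)
  also have "\<dots> \<le> ?n powr b * (?n * N)"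
    using sum_bounded_above[of "UNIV::'n set" "\<lambda>i. LINT x:\<Omega>|lborel. \<bar>g i x\<bar> powr b" N] g_powr(2)
    by (intro mult_left_mono) auto
  finally show "(\<integral>y. grad_norm g y powr b \<partial>lborel) \<le> ?n powr b * (?n * N)" .
qed

lemma abs_mollify_le_if_sobolev_bounded:
  assumes f: "sobolev_bounded \<Omega> b N f g" and fin: "emeasure lborel \<Omega> < \<infinity>" and b: "b \<ge> 1" and N: "N \<ge> 0" and x: "x \<in> A"
  shows "\<bar>mollify \<phi> T f x\<bar> \<le> sup_norm \<phi> / T ^ CARD('n) * N"
proof -
  note fg = integrable_weak_gradient_if_sobolev_bounded[OF f fin b N]
  have "\<bar>mollify \<phi> T f x\<bar> \<le> sup_norm \<phi> / T ^ CARD('n) * (LINT y:\<Omega>|lborel. \<bar>f y\<bar>)"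
    by (rule mollify_bound[OF integrable_weak_gradientD(2,4)[OF fg] mollifier_kernel height_pos
          cone[OF x height_pos order_refl]])
  also have "\<dots> \<le> sup_norm \<phi> / T ^ CARD('n) * N"
    using set_integral_abs_le_if_nn_integral_le[OF _ _ sobolev_boundedD(4)[OF f] N] sobolev_boundedD(2)[OF f]
      sup_norm_nonneg[OF mollifier_kernel] height_pos
    by (intro mult_left_mono) auto
  finally show ?thesis .
qed

lemma subcritical_sobolev:
  assumes fin: "emeasure lborel \<Omega> < \<infinity>" and b: "b \<ge> 1" and q: "q \<ge> b"
    and subcritical: "real CARD('n) / b - real CARD('n) / q < 1" and N: "N \<ge> 0"
  obtains K where "K \<ge> 0"
    "\<And>f g. sobolev_bounded \<Omega> b N f g \<Longrightarrow> (\<integral>\<^sup>+x\<in>A. ennreal (\<bar>f x\<bar> powr q) \<partial>lborel) \<le> ennreal K"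
proof -
  have q_pos: "q > 0" using b q by simp
  define N' where "N' = real CARD('n) powr b * (real CARD('n) * N)"
  define K1 where "K1 = sobolev_const b q * T powr sobolev_gain b q * N' powr (q / b)"
  define K2 where "K2 = sup_norm \<phi> / T ^ CARD('n) * N"
  define mA where "mA = measure lborel A"
  have K1_nonneg: "K1 \<ge> 0" using sobolev_const_nonneg[OF q_pos subcritical] by (simp add: K1_def)
  have K2_nonneg: "K2 \<ge> 0" using sup_norm_nonneg[OF mollifier_kernel] height_pos N by (simp add: K2_def)
  have "emeasure lborel A < \<infinity>" using fin emeasure_mono[OF inner_subset, of lborel] by (auto intro: le_less_trans)
  then have mA: "emeasure lborel A = ennreal mA" "mA \<ge> 0" by (auto simp: mA_def intro: emeasure_eq_ennreal_measure)
  show ?thesis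
  proof (rule that[of "2 powr q * (K1 + K2 powr q * mA)"])
    fix f g
    assume f: "sobolev_bounded \<Omega> b N f g"
    note [measurable] = sobolev_boundedD(2)[OF f]
    note fg = integrable_weak_gradient_if_sobolev_bounded[OF f fin b N]
      and G_powr = grad_norm_powr_integrable[OF f fin b N]
    let ?e = "\<lambda>x. \<bar>f x - mollify \<phi> T f x\<bar> powr q"
    have "(\<integral>\<^sup>+x\<in>A. ennreal (?e x) \<partial>lborel)
        \<le> ennreal (sobolev_const b q * T powr sobolev_gain b q * (\<integral>y. grad_norm g y powr b \<partial>lborel) powr (q / b))"
      by (rule mollify_error_Lq[OF fg G_powr b q subcritical height_pos order_refl])
    also have "\<dots> \<le> ennreal K1"
      unfolding K1_def N'_def using b q integral_grad_norm_powr_le[OF f fin b N]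
        sobolev_const_nonneg[OF q_pos subcritical]
      by (intro ennreal_leI mult_left_mono powr_mono2) (auto simp: integral_nonneg_AE)
    finally have error: "(\<integral>\<^sup>+x\<in>A. ennreal (?e x) \<partial>lborel) \<le> ennreal K1" .
    have average: "\<bar>mollify \<phi> T f x\<bar> \<le> K2" if "x \<in> A" for x
      unfolding K2_def by (rule abs_mollify_le_if_sobolev_bounded[OF f fin b N that])
    have "(\<integral>\<^sup>+x\<in>A. ennreal (\<bar>f x\<bar> powr q) \<partial>lborel)
        \<le> ennreal (2 powr q) * ((\<integral>\<^sup>+x\<in>A. ennreal (?e x) \<partial>lborel) + ennreal (K2 powr q) * ennreal mA)"
      unfolding mA(1)[symmetric] using average K2_nonneg q_pos by (intro nn_integral_powr_le_if_near_bounded) auto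
    also have "\<dots> \<le> ennreal (2 powr q) * (ennreal K1 + ennreal (K2 powr q) * ennreal mA)"
      by (intro mult_left_mono add_right_mono error) simp
    also have "\<dots> = ennreal (2 powr q * (K1 + K2 powr q * mA))"
      using K1_nonneg mA(2) by (simp add: ennreal_mult' ennreal_plus)
    finally show "(\<integral>\<^sup>+x\<in>A. ennreal (\<bar>f x\<bar> powr q) \<partial>lborel) \<le> ennreal (2 powr q * (K1 + K2 powr q * mA))" .
  qed (use K1_nonneg mA(2) in simp)
qed

end

section \<open>Truncated powers\<close>

lemma continuous_antiderivative:
  fixes f :: "real \<Rightarrow> real"
  assumes "continuous_on UNIV f"
  obtains F where "F 0 = 0" "\<And>x. (F has_real_derivative f x) (at x)"
proof -
  have "isCont f x" for x using assms by (simp add: continuous_on_eq_continuous_at)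
  then obtain F where F: "\<And>x. (F has_vector_derivative f x) (at x)"
    using einterval_antiderivative[of "-\<infinity>" \<infinity> f] by auto
  have "((\<lambda>x. F x - F 0) has_real_derivative f x) (at x)" for x
    using F[of x] unfolding has_real_derivative_iff_has_vector_derivative[symmetric]
    by (auto intro!: derivative_eq_intros)
  then show ?thesis using that[of "\<lambda>x. F x - F 0"] by simp
qed

lemma antiderivative_nonneg_mono:
  fixes F :: "real \<Rightarrow> real"
  assumes "\<And>x. (F has_real_derivative f x) (at x)" "\<And>x. f x \<ge> 0" "x \<le> y"
  shows "F x \<le> F y"
  by (rule DERIV_nonneg_imp_nondecreasing[OF assms(3)]) (use assms in blast)

lemma antiderivative_even_odd:
  fixes F :: "real \<Rightarrow> real"
  assumes F: "F 0 = 0" "\<And>x. (F has_real_derivative f x) (at x)" and even: "\<And>x. f (- x) = f x"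
  shows "F (- x) = - F x"
proof -
  have "((\<lambda>x. F (- x)) has_real_derivative f (- x) * (-1)) (at x)" for x
    by (rule DERIV_chain2[OF F(2)]) (auto intro!: derivative_eq_intros)
  from DERIV_add[OF F(2) this] have "((\<lambda>x. F x + F (- x)) has_real_derivative 0) (at x)" for x
    by (simp add: even)
  then have "F x + F (- x) = F 0 + F (- 0)" by (intro DERIV_isconst_all) blast
  then show ?thesis using F(1) by simp
qed

lemma abs_antiderivative_even_nonneg:
  fixes F :: "real \<Rightarrow> real"
  assumes F: "F 0 = 0" "\<And>x. (F has_real_derivative f x) (at x)" and f: "\<And>x. f (- x) = f x" "\<And>x. f x \<ge> 0"
  shows "\<bar>F x\<bar> = F \<bar>x\<bar>"
  using antiderivative_even_odd[OF F f(1), of x] antiderivative_nonneg_mono[OF F(2) f(2), of 0 "\<bar>x\<bar>"] F(1)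
  by (cases "x \<ge> 0") auto

text \<open>Vanishing on \<open>\<bar>x\<bar> < 1\<close> makes \<open>trunc_powr s M u \<le> \<bar>u\<bar> powr (\<gamma> / \<beta>)\<close> hold for every \<open>s \<le> \<gamma> / \<beta>\<close>,
  so that the variable exponent can be frozen on small balls; the cap \<open>M\<close> keeps the chain rule applicable.\<close>

definition trunc_powr :: "real \<Rightarrow> real \<Rightarrow> real \<Rightarrow> real" where
  "trunc_powr s M x = min M (max 0 (\<bar>x\<bar> powr s - 1))"

lemma continuous_trunc_powr: "s > 0 \<Longrightarrow> continuous_on UNIV (trunc_powr s M)"
  unfolding trunc_powr_def[abs_def]
  by (intro continuous_on_min continuous_on_max continuous_on_const continuous_on_diff continuous_on_powr'
      continuous_on_rabs continuous_on_id) auto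

lemma trunc_powr_bounds:
  assumes "M \<ge> 0"
  shows "0 \<le> trunc_powr s M x" "trunc_powr s M x \<le> M" "trunc_powr s M x \<le> \<bar>x\<bar> powr s"
  using assms by (auto simp: trunc_powr_def min_le_iff_disj)

lemma trunc_powr_eq_0:
  assumes "M \<ge> 0" "s > 0" "\<bar>x\<bar> < 1"
  shows "trunc_powr s M x = 0"
  using powr_mono2[of s "\<bar>x\<bar>" 1] assms by (simp add: trunc_powr_def)

lemma trunc_powr_antiderivative_le:
  assumes s: "s > 0" and M: "M \<ge> 0" and F: "F 0 = 0" "\<And>x. (F has_real_derivative trunc_powr s M x) (at x)"
  shows "\<bar>F t\<bar> \<le> \<bar>t\<bar> powr (s + 1)"
proof -
  have "norm (F t - F 0) \<le> \<bar>t\<bar> powr s * norm (t - 0)"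
  proof (rule field_differentiable_bound[of "closed_segment 0 t" F "trunc_powr s M"])
    show "(F has_field_derivative trunc_powr s M z) (at z within closed_segment 0 t)" for z
      by (rule has_field_derivative_at_within[OF F(2)])
    fix z assume "z \<in> closed_segment 0 t"
    then have "\<bar>z\<bar> \<le> \<bar>t\<bar>" by (auto simp: closed_segment_eq_real_ivl split: if_splits)
    then have "\<bar>z\<bar> powr s \<le> \<bar>t\<bar> powr s" using s by (intro powr_mono2) auto
    then show "norm (trunc_powr s M z) \<le> \<bar>t\<bar> powr s" using trunc_powr_bounds[OF M, of s z] by simp
  qed auto
  then show ?thesis using F(1) by (cases "t = 0") (simp_all add: powr_add)
qed

lemma trunc_powr_antiderivative_ge:
  assumes s: "s > 0" and M: "M \<ge> 0" and F: "F 0 = 0" "\<And>x. (F has_real_derivative trunc_powr s M x) (at x)"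
    and t: "t \<ge> 2 * 2 powr (1/s)" "t powr s \<le> M"
  shows "t powr (s + 1) \<le> 2 powr (s + 2) * F t"
proof -
  have t_pos: "t > 0" using t(1) by (rule less_le_trans[rotated]) simp
  have "\<exists>z>t/2. z < t \<and> F t - F (t/2) = (t - t/2) * trunc_powr s M z"
    by (rule MVT2) (use t_pos F in auto)
  then obtain z where z: "t/2 < z" "z < t" "F t - F (t/2) = (t - t/2) * trunc_powr s M z" by blast
  have mono: "(t/2) powr s \<le> z powr s" "z powr s \<le> t powr s" using z t_pos s by (intro powr_mono2; simp)+
  have "(2 powr (1/s)) powr s \<le> (t/2) powr s" using t s by (intro powr_mono2) auto
  then have "2 \<le> (t/2) powr s" using s by (simp add: powr_powr)
  then have "trunc_powr s M z \<ge> (t/2) powr s / 2"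
    unfolding trunc_powr_def using mono t(2) z t_pos by (simp add: min_def max_def)
  then have "(t/2) * ((t/2) powr s / 2) \<le> F t - F (t/2)" unfolding z(3) using t_pos by (intro mult_mono) auto
  also have "\<dots> \<le> F t"
    using antiderivative_nonneg_mono[OF F(2) trunc_powr_bounds(1)[OF M], of 0 "t/2"] t_pos F(1) by simp
  finally have "(t/2) * ((t/2) powr s / 2) \<le> F t" .
  moreover have "(t/2) * ((t/2) powr s / 2) = t powr (s + 1) / 2 powr (s + 2)"
    using t_pos by (simp add: powr_divide powr_add mult.commute)
  ultimately show ?thesis by (simp add: divide_le_eq mult.commute)
qed

definition trunc_powr_const :: "real \<Rightarrow> real" where
  "trunc_powr_const s = (2 * 2 powr (1/s)) powr (s + 1) + 2 powr (s + 2)"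

lemma powr_le_trunc_powr_antiderivative:
  assumes s: "s > 0" and M: "M \<ge> 0" and F: "F 0 = 0" "\<And>x. (F has_real_derivative trunc_powr s M x) (at x)"
    and t: "\<bar>t\<bar> powr s \<le> M"
  shows "\<bar>t\<bar> powr (s + 1) \<le> trunc_powr_const s * (\<bar>F t\<bar> + 1)"
proof (cases "\<bar>t\<bar> \<ge> 2 * 2 powr (1/s)")
  case True
  have "\<bar>F t\<bar> = F \<bar>t\<bar>"
    by (rule abs_antiderivative_even_nonneg[OF F]) (use trunc_powr_bounds(1)[OF M] in \<open>simp_all add: trunc_powr_def\<close>)
  then have "\<bar>t\<bar> powr (s + 1) \<le> 2 powr (s + 2) * \<bar>F t\<bar>"
    using trunc_powr_antiderivative_ge[OF s M F True t] by simp
  also have "\<dots> \<le> trunc_powr_const s * (\<bar>F t\<bar> + 1)"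
    unfolding trunc_powr_const_def by (intro mult_mono) auto
  finally show ?thesis .
next
  case False
  then have "\<bar>t\<bar> powr (s + 1) \<le> (2 * 2 powr (1/s)) powr (s + 1) * 1"
    using s by (simp add: powr_mono2)
  also have "\<dots> \<le> trunc_powr_const s * (\<bar>F t\<bar> + 1)"
    unfolding trunc_powr_const_def by (intro mult_mono) auto
  finally show ?thesis .
qed

lemma nn_integral_le_if_sublevel_le:
  fixes w :: "'a \<Rightarrow> real" and F :: "'a \<Rightarrow> ennreal"
  assumes [measurable]: "w \<in> borel_measurable M" "F \<in> borel_measurable M" "A \<in> sets M"
    and sublevel_le: "\<And>m::nat. (\<integral>\<^sup>+x\<in>{x\<in>A. w x \<le> real m}. F x \<partial>M) \<le> K"
  shows "(\<integral>\<^sup>+x\<in>A. F x \<partial>M) \<le> K"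
proof -
  define X where "X m x = F x * indicator {x\<in>A. w x \<le> real m} x" for m :: nat and x
  have "{x\<in>A. w x \<le> real m} = A \<inter> {x\<in>space M. w x \<le> real m}" for m
    using sets.sets_into_space[OF assms(3)] by auto
  then have [measurable]: "X m \<in> borel_measurable M" for m
    unfolding X_def[abs_def] by simp
  have X_incseq: "incseq X"
    by (rule incseq_SucI) (auto simp: X_def le_fun_def indicator_def)
  have X_SUP: "(SUP m. X m x) = F x * indicator A x" for x
  proof (rule antisym)
    show "(SUP m. X m x) \<le> F x * indicator A x"
      by (rule SUP_least) (auto simp: X_def indicator_def)
    obtain m :: nat where "w x \<le> real m" using real_arch_simple by blast
    then have "X m x = F x * indicator A x" by (simp add: X_def indicator_def)
    then show "F x * indicator A x \<le> (SUP m. X m x)" by (metis SUP_upper UNIV_I)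
  qed
  have "(\<integral>\<^sup>+x\<in>A. F x \<partial>M) = (SUP m. integral\<^sup>N M (X m))"
    unfolding X_SUP[symmetric] by (rule nn_integral_monotone_convergence_SUP[OF X_incseq]) simp
  also have "\<dots> \<le> K" using sublevel_le by (intro SUP_least) (simp add: X_def[abs_def])
  finally show ?thesis .
qed

definition power_sobolev_bounded ::
    "(real^'n::finite) set \<Rightarrow> real \<Rightarrow> real \<Rightarrow> real \<Rightarrow> 'n fn \<Rightarrow> ('n \<Rightarrow> 'n fn) \<Rightarrow> bool" where
  "power_sobolev_bounded \<Omega> s b N u g \<longleftrightarrow> borel_weak_gradient \<Omega> u g \<and>
     (\<integral>\<^sup>+x\<in>\<Omega>. ennreal (\<bar>u x\<bar> powr (s + 1)) \<partial>lborel) \<le> ennreal N \<and>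
     (\<forall>i. (\<integral>\<^sup>+x\<in>{x\<in>\<Omega>. 1 \<le> \<bar>u x\<bar>}. ennreal ((\<bar>u x\<bar> powr s * \<bar>g i x\<bar>) powr b) \<partial>lborel) \<le> ennreal N)"

lemma sobolev_bounded_trunc_powr_antiderivative:
  assumes u: "power_sobolev_bounded \<Omega> s b N u g" and \<Omega>: "open \<Omega>" and s: "s > 0" and b: "b \<ge> 0" and M: "M \<ge> 0"
    and F: "F 0 = 0" "\<And>x. (F has_real_derivative trunc_powr s M x) (at x)"
  shows "sobolev_bounded \<Omega> b N (\<lambda>x. F (u x)) (\<lambda>i x. trunc_powr s M (u x) * g i x)"
  unfolding sobolev_bounded_def
proof (intro conjI allI)
  have u': "borel_weak_gradient \<Omega> u g" "(\<integral>\<^sup>+x\<in>\<Omega>. ennreal (\<bar>u x\<bar> powr (s + 1)) \<partial>lborel) \<le> ennreal N"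
    "(\<integral>\<^sup>+x\<in>{x\<in>\<Omega>. 1 \<le> \<bar>u x\<bar>}. ennreal ((\<bar>u x\<bar> powr s * \<bar>g i x\<bar>) powr b) \<partial>lborel) \<le> ennreal N" for i
    using u by (auto simp: power_sobolev_bounded_def)
  note bounds = trunc_powr_bounds[OF M, of s]
  show "borel_weak_gradient \<Omega> (\<lambda>x. F (u x)) (\<lambda>i x. trunc_powr s M (u x) * g i x)"
    by (rule borel_weak_gradient_chain[OF u'(1) \<Omega> F(2) continuous_trunc_powr[OF s], of M]) (simp add: bounds)
  show "(\<integral>\<^sup>+x\<in>\<Omega>. ennreal \<bar>F (u x)\<bar> \<partial>lborel) \<le> ennreal N"
    by (rule order_trans[OF _ u'(2)], rule nn_integral_mono)
      (simp add: indicator_def ennreal_leI trunc_powr_antiderivative_le[OF s M F])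
  fix i
  show "(\<integral>\<^sup>+x\<in>\<Omega>. ennreal (\<bar>trunc_powr s M (u x) * g i x\<bar> powr b) \<partial>lborel) \<le> ennreal N"
  proof (rule order_trans[OF nn_integral_mono u'(3)[of i]])
    fix x
    have "\<bar>trunc_powr s M (u x) * g i x\<bar> powr b \<le> (\<bar>u x\<bar> powr s * \<bar>g i x\<bar>) powr b"
      using b bounds[of "u x"] by (intro powr_mono2) (auto simp: abs_mult intro: mult_right_mono)
    then show "ennreal (\<bar>trunc_powr s M (u x) * g i x\<bar> powr b) * indicator \<Omega> x
        \<le> ennreal ((\<bar>u x\<bar> powr s * \<bar>g i x\<bar>) powr b) * indicator {x\<in>\<Omega>. 1 \<le> \<bar>u x\<bar>} x"
      using trunc_powr_eq_0[OF M s, of "u x"] by (cases "1 \<le> \<bar>u x\<bar>") (auto simp: indicator_def ennreal_leI)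
  qed
qed

lemma nn_integral_sublevel_powr_le:
  assumes [measurable]: "u \<in> borel_measurable M" "A \<in> sets M"
    and s: "s > 0" and q: "q \<ge> 0" and m: "m \<ge> 0"
    and F: "F 0 = 0" "\<And>x. (F has_real_derivative trunc_powr s m x) (at x)"
  shows "(\<integral>\<^sup>+x\<in>{x\<in>A. \<bar>u x\<bar> powr s \<le> m}. ennreal (\<bar>u x\<bar> powr ((s + 1) * q)) \<partial>M)
    \<le> ennreal (trunc_powr_const s powr q * 2 powr q) * ((\<integral>\<^sup>+x\<in>A. ennreal (\<bar>F (u x)\<bar> powr q) \<partial>M) + emeasure M A)"
proof -
  have "continuous_on UNIV F" by (rule DERIV_continuous_on) (rule has_field_derivative_at_within[OF F(2)])
  then have [measurable]: "F \<in> borel_measurable borel" by (rule borel_measurable_continuous_onI)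
  have pointwise: "\<bar>u x\<bar> powr ((s + 1) * q) \<le> trunc_powr_const s powr q * \<bar>\<bar>F (u x)\<bar> + 1\<bar> powr q"
    if "\<bar>u x\<bar> powr s \<le> m" for x
  proof -
    have "(\<bar>u x\<bar> powr (s + 1)) powr q \<le> (trunc_powr_const s * (\<bar>F (u x)\<bar> + 1)) powr q"
      using q by (intro powr_mono2 powr_le_trunc_powr_antiderivative[OF s m F that]) auto
    then show ?thesis by (simp add: powr_powr powr_mult)
  qed
  have "(\<integral>\<^sup>+x\<in>{x\<in>A. \<bar>u x\<bar> powr s \<le> m}. ennreal (\<bar>u x\<bar> powr ((s + 1) * q)) \<partial>M)
      \<le> (\<integral>\<^sup>+x. ennreal (trunc_powr_const s powr q) * (ennreal (\<bar>\<bar>F (u x)\<bar> + 1\<bar> powr q) * indicator A x) \<partial>M)"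
    using pointwise by (intro nn_integral_mono) (simp add: ennreal_mult'[symmetric] indicator_def ennreal_leI)
  also have "\<dots> = ennreal (trunc_powr_const s powr q) * (\<integral>\<^sup>+x\<in>A. ennreal (\<bar>\<bar>F (u x)\<bar> + 1\<bar> powr q) \<partial>M)"
    by (rule nn_integral_cmult) measurable
  also have "\<dots> \<le> ennreal (trunc_powr_const s powr q) * (ennreal (2 powr q) *
      ((\<integral>\<^sup>+x\<in>A. ennreal (\<bar>\<bar>F (u x)\<bar> + 1 - 1\<bar> powr q) \<partial>M) + ennreal (1 powr q) * emeasure M A))"
    using q by (intro mult_left_mono nn_integral_powr_le_if_near_bounded) auto
  finally show ?thesis by (simp add: ennreal_mult' mult.assoc)
qed

lemma (in cone_domain) power_sobolev:
  assumes fin: "emeasure lborel \<Omega> < \<infinity>" and s: "s > 0" and b: "b \<ge> 1" and q: "q \<ge> b"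
    and subcritical: "real CARD('n) / b - real CARD('n) / q < 1" and N: "N \<ge> 0"
  obtains K where "K \<ge> 0" "\<And>u g. power_sobolev_bounded \<Omega> s b N u g \<Longrightarrow>
    (\<integral>\<^sup>+x\<in>A. ennreal (\<bar>u x\<bar> powr ((s + 1) * q)) \<partial>lborel) \<le> ennreal K"
proof -
  have q_nonneg: "q \<ge> 0" using b q by simp
  obtain K where K: "K \<ge> 0" and sobolev:
    "\<And>f g. sobolev_bounded \<Omega> b N f g \<Longrightarrow> (\<integral>\<^sup>+x\<in>A. ennreal (\<bar>f x\<bar> powr q) \<partial>lborel) \<le> ennreal K"
    using subcritical_sobolev[OF fin b q subcritical N] by blast
  define C where "C = trunc_powr_const s powr q * 2 powr q"
  define mA where "mA = measure lborel A"
  have "emeasure lborel A < \<infinity>" using fin emeasure_mono[OF inner_subset, of lborel] by (auto intro: le_less_trans)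
  then have mA: "emeasure lborel A = ennreal mA" "mA \<ge> 0" by (auto simp: mA_def intro: emeasure_eq_ennreal_measure)
  show ?thesis
  proof (rule that[of "C * (K + mA)"])
    fix u g assume u: "power_sobolev_bounded \<Omega> s b N u g"
    then have [measurable]: "u \<in> borel_measurable borel"
      using borel_weak_gradientD(1) by (auto simp: power_sobolev_bounded_def)
    show "(\<integral>\<^sup>+x\<in>A. ennreal (\<bar>u x\<bar> powr ((s + 1) * q)) \<partial>lborel) \<le> ennreal (C * (K + mA))"
    proof (rule nn_integral_le_if_sublevel_le[where w="\<lambda>x. \<bar>u x\<bar> powr s"])
      fix m :: nat
      obtain F where F: "F 0 = 0" "\<And>x. (F has_real_derivative trunc_powr s (real m) x) (at x)"
        using continuous_antiderivative[OF continuous_trunc_powr[OF s]] by metis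
      have "(\<integral>\<^sup>+x\<in>{x\<in>A. \<bar>u x\<bar> powr s \<le> real m}. ennreal (\<bar>u x\<bar> powr ((s + 1) * q)) \<partial>lborel)
          \<le> ennreal C * ((\<integral>\<^sup>+x\<in>A. ennreal (\<bar>F (u x)\<bar> powr q) \<partial>lborel) + emeasure lborel A)"
        unfolding C_def by (rule nn_integral_sublevel_powr_le[OF _ _ s q_nonneg _ F]) simp_all
      also have "\<dots> \<le> ennreal C * (ennreal K + ennreal mA)"
        unfolding mA(1) using b
        by (intro mult_left_mono add_right_mono
          sobolev[OF sobolev_bounded_trunc_powr_antiderivative[OF u open_domain s _ _ F]]) auto
      also have "\<dots> = ennreal (C * (K + mA))"
        using K mA(2) by (simp add: C_def ennreal_plus[symmetric] ennreal_mult'[symmetric] del: ennreal_plus)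
      finally show "(\<integral>\<^sup>+x\<in>{x\<in>A. \<bar>u x\<bar> powr s \<le> real m}. ennreal (\<bar>u x\<bar> powr ((s + 1) * q)) \<partial>lborel)
        \<le> ennreal (C * (K + mA))" .
    qed simp_all
  qed (use K mA(2) in \<open>simp add: C_def\<close>)
qed

section \<open>Rellich compactness\<close>

lemma smooth_continuous_kernel_Lipschitz:
  fixes \<phi> :: "'n::finite fn"
  assumes \<phi>: "smooth \<phi>" "continuous_kernel c d \<phi>"
  shows "\<bar>\<phi> a - \<phi> b\<bar> \<le> (\<Sum>i\<in>UNIV. sup_norm (partial i \<phi>)) * norm (a - b)"
proof -
  have "norm (\<phi> a - \<phi> b) \<le> (\<Sum>i\<in>UNIV. sup_norm (partial i \<phi>)) * norm (a - b)"
  proof (rule differentiable_bound[OF convex_UNIV])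
    fix x :: "real^'n"
    show "(\<phi> has_derivative (\<lambda>h. \<Sum>i\<in>UNIV. h $ i * partial i \<phi> x)) (at x within UNIV)"
      using smooth_has_derivative[OF \<phi>(1)] by simp
    show "onorm (\<lambda>h. \<Sum>i\<in>UNIV. h $ i * partial i \<phi> x) \<le> (\<Sum>i\<in>UNIV. sup_norm (partial i \<phi>))"
    proof (rule onorm_le)
      fix h :: "real^'n"
      have "norm (\<Sum>i\<in>UNIV. h $ i * partial i \<phi> x) \<le> (\<Sum>i\<in>UNIV. norm h * sup_norm (partial i \<phi>))"
      proof (rule order_trans[OF norm_sum sum_mono])
        fix i
        show "norm (h $ i * partial i \<phi> x) \<le> norm h * sup_norm (partial i \<phi>)"
          unfolding norm_mult using component_le_norm_cart[of h i] abs_le_sup_norm[OF continuous_kernel_partial[OF \<phi>]]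
          by (intro mult_mono) auto
      qed
      then show "norm (\<Sum>i\<in>UNIV. h $ i * partial i \<phi> x) \<le> (\<Sum>i\<in>UNIV. sup_norm (partial i \<phi>)) * norm h"
        by (simp add: sum_distrib_left[symmetric] mult.commute)
    qed
  qed auto
  then show ?thesis by simp
qed

lemma mollify_Lipschitz:
  fixes f :: "'n::finite fn"
  assumes f: "integrable lborel f" and \<phi>: "continuous_kernel c d \<phi>"
    and L: "\<And>a b. \<bar>\<phi> a - \<phi> b\<bar> \<le> L * norm (a - b)" and t: "t > 0"
  shows "\<bar>mollify \<phi> t f x - mollify \<phi> t f y\<bar> \<le> L / t ^ Suc CARD('n) * (\<integral>z. \<bar>f z\<bar> \<partial>lborel) * norm (x - y)"
proof -
  have meas[measurable]: "f \<in> borel_measurable borel" "\<phi> \<in> borel_measurable borel"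
    using f continuous_kernelD(3)[OF \<phi>] by auto
  have int: "integrable lborel (\<lambda>z. f z * scaled_kernel \<phi> t x z)" for x
    using integrable_mult_scaled_kernel[of UNIV f c d \<phi> t x] f \<phi> t by (simp add: set_integrable_def)
  have kernel: "\<bar>scaled_kernel \<phi> t x z - scaled_kernel \<phi> t y z\<bar> \<le> L / t ^ Suc CARD('n) * norm (x - y)" for z
  proof -
    have "(1/t) *\<^sub>R (z - x) - (1/t) *\<^sub>R (z - y) = (1/t) *\<^sub>R (y - x)" by (simp add: algebra_simps)
    then have "\<bar>\<phi> ((1/t) *\<^sub>R (z - x)) - \<phi> ((1/t) *\<^sub>R (z - y))\<bar> \<le> L / t * norm (x - y)"
      using L[of "(1/t) *\<^sub>R (z - x)" "(1/t) *\<^sub>R (z - y)"] t by (simp add: norm_minus_commute)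
    from mult_left_mono[OF this, of "1 / t ^ CARD('n)"] t show ?thesis
      by (simp add: scaled_kernel_def abs_mult mult.commute[of t] flip: right_diff_distrib diff_divide_distrib)
  qed
  have "\<bar>mollify \<phi> t f x - mollify \<phi> t f y\<bar> = \<bar>\<integral>z. f z * (scaled_kernel \<phi> t x z - scaled_kernel \<phi> t y z) \<partial>lborel\<bar>"
    using int t by (simp add: mollify_eq_integral_scaled_kernel right_diff_distrib)
  also have "\<dots> \<le> (\<integral>z. \<bar>f z * (scaled_kernel \<phi> t x z - scaled_kernel \<phi> t y z)\<bar> \<partial>lborel)"
    by (rule integral_abs_bound)
  also have "\<dots> \<le> (\<integral>z. (L / t ^ Suc CARD('n) * norm (x - y)) * \<bar>f z\<bar> \<partial>lborel)"
  proof (rule integral_mono)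
    show "integrable lborel (\<lambda>z. \<bar>f z * (scaled_kernel \<phi> t x z - scaled_kernel \<phi> t y z)\<bar>)"
      using Bochner_Integration.integrable_diff[OF int[of x] int[of y]] by (simp add: right_diff_distrib)
    show "\<bar>f z * (scaled_kernel \<phi> t x z - scaled_kernel \<phi> t y z)\<bar> \<le> (L / t ^ Suc CARD('n) * norm (x - y)) * \<bar>f z\<bar>" for z
      using mult_left_mono[OF kernel, of "\<bar>f z\<bar>" z] by (simp only: abs_mult abs_ge_zero mult.commute)
  qed (use f in simp)
  finally show ?thesis by (simp add: mult_ac)
qed

lemma Lipschitz_uniformly_Cauchy_subsequence:
  fixes M :: "nat \<Rightarrow> 'a::euclidean_space \<Rightarrow> real"
  assumes K: "compact K" and bound: "\<And>k x. \<bar>M k x\<bar> \<le> B"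
    and Lipschitz: "\<And>k x y. \<bar>M k x - M k y\<bar> \<le> L * norm (x - y)" and L: "L \<ge> 0" and e: "e > 0"
  obtains r :: "nat \<Rightarrow> nat" where "strict_mono r" "\<And>i j x. x \<in> K \<Longrightarrow> \<bar>M (r i) x - M (r j) x\<bar> \<le> e"
proof -
  have equicontinuous: "\<exists>\<delta>>0. \<forall>n y. y \<in> K \<and> norm (x - y) < \<delta> \<longrightarrow> norm (M n x - M n y) < a" if "0 < a" for x a
  proof (intro exI[of _ "a / (L + 1)"] conjI allI impI)
    show "0 < a / (L + 1)" using that L by simp
    fix n y assume "y \<in> K \<and> norm (x - y) < a / (L + 1)"
    then have "(L + 1) * norm (x - y) < a" using L by (simp add: pos_less_divide_eq mult.commute)
    then have "L * norm (x - y) < a" by (simp add: distrib_right le_less_trans[rotated])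
    then show "norm (M n x - M n y) < a" using Lipschitz[of n x y] by simp
  qed
  have norm_bound: "norm (M k x) \<le> B" for k x using bound by simp
  obtain G and r :: "nat \<Rightarrow> nat" where r: "strict_mono r"
    and lim: "\<And>e. 0 < e \<Longrightarrow> \<exists>N. \<forall>n x. n \<ge> N \<and> x \<in> K \<longrightarrow> norm (M (r n) x - G x) < e"
    by (rule Arzela_Ascoli[OF K, of M B]) (use norm_bound equicontinuous in blast)+
  from lim[of "e/2"] e obtain n0 where n0: "\<And>n x. n \<ge> n0 \<Longrightarrow> x \<in> K \<Longrightarrow> \<bar>M (r n) x - G x\<bar> < e/2"
    by auto
  show ?thesis
  proof (rule that[of "\<lambda>n. r (n + n0)"])
    show "strict_mono (\<lambda>n. r (n + n0))" using r by (simp add: strict_mono_def)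
    show "\<bar>M (r (i + n0)) x - M (r (j + n0)) x\<bar> \<le> e" if "x \<in> K" for i j x
      using n0[of "i + n0" x] n0[of "j + n0" x] that by linarith
  qed
qed

lemma mollify_uniformly_Cauchy_subsequence:
  fixes f :: "nat \<Rightarrow> 'n::finite fn"
  assumes f: "\<And>k. integrable lborel (f k)" "\<And>k. (\<integral>x. \<bar>f k x\<bar> \<partial>lborel) \<le> N"
    and \<phi>: "smooth \<phi>" "continuous_kernel c d \<phi>" and t: "t > 0" and K: "compact K" and e: "e > 0"
  obtains r :: "nat \<Rightarrow> nat" where "strict_mono r"
    "\<And>i j x. x \<in> K \<Longrightarrow> \<bar>mollify \<phi> t (f (r i)) x - mollify \<phi> t (f (r j)) x\<bar> \<le> e"
proof -
  define B where "B = sup_norm \<phi> / t ^ CARD('n) * N"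
  define S where "S = (\<Sum>i\<in>UNIV. sup_norm (partial i \<phi>))"
  define L where "L = S / t ^ Suc CARD('n) * N"
  have N: "N \<ge> 0" by (rule order_trans[OF _ f(2)[of 0]]) simp
  have S_nonneg: "S \<ge> 0" unfolding S_def by (intro sum_nonneg sup_norm_nonneg[OF continuous_kernel_partial[OF \<phi>]])
  have bound: "\<bar>mollify \<phi> t (f k) x\<bar> \<le> B" for k x
  proof -
    have "\<bar>mollify \<phi> t (f k) x\<bar> \<le> sup_norm \<phi> / t ^ CARD('n) * (\<integral>x. \<bar>f k x\<bar> \<partial>lborel)"
      using mollify_bound[of UNIV "f k" c d \<phi> t x] f(1)[of k] \<phi>(2) t
      by (simp add: set_integrable_def set_lebesgue_integral_def borel_measurable_integrable[unfolded measurable_lborel1])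
    also have "\<dots> \<le> B" unfolding B_def using f(2) sup_norm_nonneg[OF \<phi>(2)] t by (intro mult_left_mono) auto
    finally show ?thesis .
  qed
  have Lipschitz: "\<bar>mollify \<phi> t (f k) x - mollify \<phi> t (f k) y\<bar> \<le> L * norm (x - y)" for k x y
  proof -
    have "\<bar>mollify \<phi> t (f k) x - mollify \<phi> t (f k) y\<bar> \<le> S / t ^ Suc CARD('n) * (\<integral>z. \<bar>f k z\<bar> \<partial>lborel) * norm (x - y)"
      unfolding S_def by (rule mollify_Lipschitz[OF f(1) \<phi>(2) smooth_continuous_kernel_Lipschitz[OF \<phi>] t])
    also have "\<dots> \<le> L * norm (x - y)"
      unfolding L_def using f(2) S_nonneg t by (intro mult_right_mono mult_left_mono) auto
    finally show ?thesis .
  qed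
  have "L \<ge> 0" using S_nonneg t N by (simp add: L_def)
  then show ?thesis using that by (rule Lipschitz_uniformly_Cauchy_subsequence[OF K bound Lipschitz _ e])
qed

lemma nn_integral_abs_diff_le:
  fixes f g f' g' :: "'a \<Rightarrow> real"
  assumes [measurable]: "f \<in> borel_measurable M" "g \<in> borel_measurable M" "f' \<in> borel_measurable M"
    "g' \<in> borel_measurable M" "A \<in> sets M"
    and e: "e \<ge> 0" and near: "\<And>x. x \<in> A \<Longrightarrow> \<bar>f' x - g' x\<bar> \<le> e"
  shows "(\<integral>\<^sup>+x\<in>A. ennreal \<bar>f x - g x\<bar> \<partial>M)
    \<le> (\<integral>\<^sup>+x\<in>A. ennreal \<bar>f x - f' x\<bar> \<partial>M) + ((\<integral>\<^sup>+x\<in>A. ennreal \<bar>g x - g' x\<bar> \<partial>M) + ennreal e * emeasure M A)"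
proof -
  have "(\<integral>\<^sup>+x\<in>A. ennreal \<bar>f x - g x\<bar> \<partial>M)
      \<le> (\<integral>\<^sup>+x. ennreal \<bar>f x - f' x\<bar> * indicator A x + (ennreal \<bar>g x - g' x\<bar> * indicator A x + ennreal e * indicator A x) \<partial>M)"
  proof (rule nn_integral_mono)
    fix x
    show "ennreal \<bar>f x - g x\<bar> * indicator A x
        \<le> ennreal \<bar>f x - f' x\<bar> * indicator A x + (ennreal \<bar>g x - g' x\<bar> * indicator A x + ennreal e * indicator A x)"
    proof (cases "x \<in> A")
      case True
      then have "\<bar>f x - g x\<bar> \<le> \<bar>f x - f' x\<bar> + (\<bar>g x - g' x\<bar> + e)" using near[of x] by linarith
      with True e show ?thesis by (simp add: ennreal_plus[symmetric] ennreal_leI del: ennreal_plus)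
    qed simp
  qed
  also have "\<dots> = (\<integral>\<^sup>+x\<in>A. ennreal \<bar>f x - f' x\<bar> \<partial>M) + ((\<integral>\<^sup>+x\<in>A. ennreal \<bar>g x - g' x\<bar> \<partial>M) + ennreal e * emeasure M A)"
    by (subst nn_integral_add, simp, simp)+ (simp add: nn_integral_cmult_indicator)
  finally show ?thesis .
qed

context cone_domain
begin

lemma mollify_error_L1:
  assumes f: "sobolev_bounded \<Omega> 1 N f g" and fin: "emeasure lborel \<Omega> < \<infinity>" and N: "N \<ge> 0" and \<tau>: "0 < \<tau>" "\<tau> \<le> T"
  shows "(\<integral>\<^sup>+x\<in>A. ennreal \<bar>f x - mollify \<phi> \<tau> f x\<bar> \<partial>lborel)
    \<le> ennreal (sobolev_const 1 1 * (real CARD('n) * (real CARD('n) * N)) * \<tau>)"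
proof -
  let ?I = "\<integral>y. grad_norm g y \<partial>lborel"
  note fg = integrable_weak_gradient_if_sobolev_bounded[OF f fin order_refl N]
  have "(\<integral>\<^sup>+x\<in>A. ennreal \<bar>f x - mollify \<phi> \<tau> f x\<bar> \<partial>lborel) \<le> ennreal (sobolev_const 1 1 * \<tau> * ?I)"
    using mollify_error_Lq[OF fg _ order_refl order_refl _ \<tau>] grad_norm_integrable[OF fg] \<tau>(1)
    by (simp add: sobolev_gain_def grad_norm_nonneg integral_nonneg_AE)
  also have "\<dots> \<le> ennreal (sobolev_const 1 1 * \<tau> * (real CARD('n) * (real CARD('n) * N)))"
    using integral_grad_norm_powr_le[OF f fin order_refl N] sobolev_const_nonneg[of 1 1] \<tau>(1)
    by (intro ennreal_leI mult_left_mono) (simp_all add: grad_norm_nonneg)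
  finally show ?thesis by (simp add: mult_ac)
qed

lemma mollify_error_L1_small:
  assumes fin: "emeasure lborel \<Omega> < \<infinity>" and N: "N \<ge> 0" and e: "e > 0"
  obtains \<tau> where "0 < \<tau>" "\<tau> \<le> T" "\<And>f g. sobolev_bounded \<Omega> 1 N f g \<Longrightarrow>
    (\<integral>\<^sup>+x\<in>A. ennreal \<bar>f x - mollify \<phi> \<tau> f x\<bar> \<partial>lborel) \<le> ennreal e"
proof -
  define Z where "Z = sobolev_const 1 1 * (real CARD('n) * (real CARD('n) * N))"
  have Z: "Z \<ge> 0" using N sobolev_const_nonneg[of 1 1] by (simp add: Z_def)
  define \<tau> where "\<tau> = min T (e / (Z + 1))"
  have \<tau>: "0 < \<tau>" "\<tau> \<le> T" using height_pos e Z by (auto simp: \<tau>_def)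
  have "Z * \<tau> \<le> (Z + 1) * (e / (Z + 1))" using Z \<tau> e by (intro mult_mono) (auto simp: \<tau>_def)
  also have "\<dots> = e" using Z by simp
  finally have "ennreal (Z * \<tau>) \<le> ennreal e" by (rule ennreal_leI)
  then show ?thesis using mollify_error_L1[OF _ fin N \<tau>] \<tau> unfolding Z_def by (intro that) (auto intro: order_trans)
qed

lemma L1_Cauchy_subsequence:
  assumes fin: "emeasure lborel \<Omega> < \<infinity>" and A: "compact A"
    and f: "\<And>k. sobolev_bounded \<Omega> 1 N (f k) (g k)" and N: "N \<ge> 0" and e: "e > 0"
  obtains r :: "nat \<Rightarrow> nat" where "strict_mono r"
    "\<And>i j. (\<integral>\<^sup>+x\<in>A. ennreal \<bar>f (r i) x - f (r j) x\<bar> \<partial>lborel) \<le> ennreal e"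
proof -
  have "e / 4 > 0" using e by simp
  then obtain \<tau> where \<tau>: "0 < \<tau>" "\<tau> \<le> T" and error: "\<And>f g. sobolev_bounded \<Omega> 1 N f g \<Longrightarrow>
      (\<integral>\<^sup>+x\<in>A. ennreal \<bar>f x - mollify \<phi> \<tau> f x\<bar> \<partial>lborel) \<le> ennreal (e / 4)"
    by (rule mollify_error_L1_small[OF fin N]) (rule that)
  define mA where "mA = measure lborel A"
  have mA: "emeasure lborel A = ennreal mA" "mA \<ge> 0"
    using emeasure_compact_finite[OF A] by (auto simp: mA_def intro: emeasure_eq_ennreal_measure)
  define \<delta> where "\<delta> = e / (2 * (mA + 1))"
  have \<delta>: "\<delta> > 0" "\<delta> * mA \<le> e / 2" using e mA(2) by (simp_all add: \<delta>_def field_simps)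
  let ?f = "\<lambda>k x. indicator \<Omega> x * f k x"
  note fD = sobolev_boundedD[OF f]
  note [measurable] = fD(2,3)
  have f_int: "integrable lborel (?f k)" "(\<integral>x. \<bar>?f k x\<bar> \<partial>lborel) \<le> N" for k
    using set_integrable_if_nn_integral_le[OF _ _ fD(4)[of k] N]
      set_integral_abs_le_if_nn_integral_le[OF _ _ fD(4)[of k] N]
    by (simp_all add: set_integrable_def set_lebesgue_integral_def abs_mult)
  obtain r :: "nat \<Rightarrow> nat" where r: "strict_mono r"
    and near: "\<And>i j x. x \<in> A \<Longrightarrow> \<bar>mollify \<phi> \<tau> (?f (r i)) x - mollify \<phi> \<tau> (?f (r j)) x\<bar> \<le> \<delta>"
    by (rule mollify_uniformly_Cauchy_subsequence[OF f_int mollifier_smooth mollifier_kernel \<tau>(1) A \<delta>(1)]) (rule that)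
  have local: "mollify \<phi> \<tau> (?f k) x = mollify \<phi> \<tau> (f k) x" if "x \<in> A" for k x
    using subsetD[OF cone[OF that \<tau>]] by (intro mollify_cong[OF mollifier_kernel \<tau>(1)]) (simp add: indicator_def)
  show ?thesis
  proof (rule that[OF r])
    fix i j
    have "(\<integral>\<^sup>+x\<in>A. ennreal \<bar>f (r i) x - f (r j) x\<bar> \<partial>lborel)
        \<le> (\<integral>\<^sup>+x\<in>A. ennreal \<bar>f (r i) x - mollify \<phi> \<tau> (f (r i)) x\<bar> \<partial>lborel) +
         ((\<integral>\<^sup>+x\<in>A. ennreal \<bar>f (r j) x - mollify \<phi> \<tau> (f (r j)) x\<bar> \<partial>lborel) + ennreal \<delta> * emeasure lborel A)"
      using near \<delta>(1) by (intro nn_integral_abs_diff_le) (simp_all add: local)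
    also have "\<dots> \<le> ennreal (e / 4) + (ennreal (e / 4) + ennreal (\<delta> * mA))"
      using mA \<delta>(1) by (intro add_mono error[OF f]) (simp add: ennreal_mult')
    also have "\<dots> \<le> ennreal e"
      using \<delta> e mA(2) by (simp add: ennreal_plus[symmetric] ennreal_leI del: ennreal_plus)
    finally show "(\<integral>\<^sup>+x\<in>A. ennreal \<bar>f (r i) x - f (r j) x\<bar> \<partial>lborel) \<le> ennreal e" .
  qed
qed

end

lemma compact_cone_domain:
  fixes \<Omega> K :: "(real^'n::finite) set"
  assumes "compact K" "open \<Omega>" "K \<subseteq> \<Omega>"
  obtains U \<phi> T where "U \<subseteq> \<Omega>" "emeasure lborel U < \<infinity>" "cone_domain U K 0 1 \<phi> T"
proof -
  obtain r where r: "r > 0" "(\<Union>x\<in>K. cball x r) \<subseteq> \<Omega>"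
    using compact_subset_open_imp_cball_epsilon_subset[OF assms] by blast
  obtain \<phi> :: "'n fn" where \<phi>: "mollifier 0 1 \<phi>" using mollifier_exists[of 1 0] by auto
  let ?U = "\<Union>x\<in>K. ball x r"
  have "?U \<subseteq> (\<Union>x\<in>K. cball x r)" by (auto intro: less_imp_le)
  then have "emeasure lborel ?U < \<infinity>" "?U \<subseteq> \<Omega>"
    using r(2) emeasure_bounded_finite
        [OF bounded_subset[OF compact_imp_bounded[OF compact_minkowski_sum_cball[OF assms(1)]]]]
    by blast+
  moreover have "cone_domain ?U K 0 1 \<phi> (r/2)"
    using r(1) \<phi> assms(1) by unfold_locales (auto simp: borel_compact intro: exI[of _ "r/2"])
  ultimately show ?thesis by (intro that)
qed

lemma sobolev_bounded_subset:
  assumes f: "sobolev_bounded \<Omega> b N f g" and U: "U \<subseteq> \<Omega>"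
  shows "sobolev_bounded U b N f g"
proof -
  have mono: "(\<integral>\<^sup>+x\<in>U. F x \<partial>lborel) \<le> (\<integral>\<^sup>+x\<in>\<Omega>. F x \<partial>lborel)" for F :: "real^'a \<Rightarrow> ennreal"
    using U by (intro nn_integral_mono) (auto simp: indicator_def)
  show ?thesis unfolding sobolev_bounded_def
    by (intro conjI allI borel_weak_gradient_subset[OF sobolev_boundedD(1)[OF f] U]
        order_trans[OF mono sobolev_boundedD(4)[OF f]] order_trans[OF mono sobolev_boundedD(5)[OF f]])
qed

lemma AE_convergent_if_geometric_increments:
  fixes f :: "nat \<Rightarrow> 'a \<Rightarrow> real"
  assumes [measurable]: "\<And>n. f n \<in> borel_measurable M" "A \<in> sets M"
    and increments_le: "\<And>n. (\<integral>\<^sup>+x\<in>A. ennreal \<bar>f (Suc n) x - f n x\<bar> \<partial>M) \<le> ennreal ((1/2) ^ n)"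
  shows "AE x in M. x \<in> A \<longrightarrow> convergent (\<lambda>n. f n x)"
proof -
  let ?X = "\<lambda>n x. ennreal \<bar>f (Suc n) x - f n x\<bar> * indicator A x"
  have "(\<integral>\<^sup>+x. (\<Sum>n. ?X n x) \<partial>M) = (\<Sum>n. \<integral>\<^sup>+x. ?X n x \<partial>M)" by (rule nn_integral_suminf) simp
  also have "\<dots> \<le> (\<Sum>n. ennreal ((1/2)^n))" by (intro suminf_le increments_le) auto
  also have "\<dots> = ennreal (\<Sum>n. (1/2)^n)" by (rule suminf_ennreal2) (auto intro: summable_geometric)
  finally have "(\<integral>\<^sup>+x. (\<Sum>n. ?X n x) \<partial>M) \<noteq> \<infinity>" by (metis ennreal_neq_top infinity_ennreal_def neq_top_trans)
  then have "AE x in M. (\<Sum>n. ?X n x) \<noteq> \<infinity>" by (intro nn_integral_noteq_infinite) auto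
  then show ?thesis
  proof eventually_elim
    case (elim x)
    show ?case
    proof
      assume "x \<in> A"
      with elim have "(\<Sum>n. ennreal \<bar>f (Suc n) x - f n x\<bar>) \<noteq> top" by simp
      then have "summable (\<lambda>n. \<bar>f (Suc n) x - f n x\<bar>)" by (intro summable_suminf_not_top) auto
      then have "summable (\<lambda>n. f (Suc n) x - f n x)" by (rule summable_rabs_cancel)
      then have "convergent (\<lambda>n. \<Sum>i<n. f (Suc i) x - f i x)" by (simp add: summable_iff_convergent)
      then have "convergent (\<lambda>n. f n x - f 0 x)" by (simp only: sum_lessThan_telescope[of "\<lambda>n. f n x"])
      from convergent_add[OF this convergent_const[of "f 0 x"]] show "convergent (\<lambda>n. f n x)" by simp
    qed
  qed
qed

lemma open_compact_exhaustion:
  fixes \<Omega> :: "'a::euclidean_space set"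
  assumes "open \<Omega>"
  obtains K :: "nat \<Rightarrow> 'a set" where "\<And>n. compact (K n)" "\<And>n. K n \<subseteq> \<Omega>" "incseq K" "\<Union>(range K) = \<Omega>"
proof -
  obtain K where K: "\<And>n. compact (K n)" "\<And>n. K n \<subseteq> \<Omega>" "\<And>n. K n \<subseteq> interior (K (Suc n))" "\<Union>(range K) = \<Omega>"
    using open_Union_compact_subsets[OF assms] by metis
  have "incseq K" by (intro incseq_SucI order_trans[OF K(3) interior_subset])
  then show ?thesis by (rule that[OF K(1,2) _ K(4)])
qed

lemma L1_Cauchy_diagonal_subsequence:
  fixes f :: "nat \<Rightarrow> 'n::finite fn"
  assumes \<Omega>: "open \<Omega>" and f: "\<And>k. sobolev_bounded \<Omega> 1 N (f k) (g k)" and N: "N \<ge> 0"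
    and K: "\<And>n::nat. compact (K n)" "\<And>n. K n \<subseteq> \<Omega>"
  obtains r :: "nat \<Rightarrow> nat" where "strict_mono r"
    "\<And>n i j. (\<integral>\<^sup>+x\<in>K n. ennreal \<bar>f (r (n + i)) x - f (r (n + j)) x\<bar> \<partial>lborel) \<le> ennreal ((1/2) ^ n)"
proof -
  let ?D = "\<lambda>n a b. \<integral>\<^sup>+x\<in>K n. ennreal \<bar>f a x - f b x\<bar> \<partial>lborel"
  define P where "P n s \<longleftrightarrow> (\<forall>i j. ?D n (s i) (s j) \<le> ennreal ((1/2)^n))" for n and s :: "nat \<Rightarrow> nat"
  interpret subseqs P
  proof
    fix n and s :: "nat \<Rightarrow> nat"
    obtain U \<phi> T where U: "U \<subseteq> \<Omega>" "emeasure lborel U < \<infinity>" "cone_domain U (K n) 0 1 \<phi> T"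
      using compact_cone_domain[OF K(1) \<Omega> K(2)] .
    show "\<exists>r'. strict_mono r' \<and> P n (s \<circ> r')"
    proof (rule cone_domain.L1_Cauchy_subsequence[where f="\<lambda>k. f (s k)" and g="\<lambda>k. g (s k)",
            OF U(3,2) K(1) sobolev_bounded_subset[OF f U(1)] N])
      show "(1/2)^n > (0::real)" by simp
      fix r :: "nat \<Rightarrow> nat" assume "strict_mono r" "\<And>i j. ?D n (s (r i)) (s (r j)) \<le> ennreal ((1/2)^n)"
      then show "\<exists>r'. strict_mono r' \<and> P n (s \<circ> r')" by (auto simp: P_def)
    qed
  qed
  have "P k (diagseq \<circ> ((+) (Suc k)))" for k
    by (rule diagseq_holds) (simp add: P_def)
  then have "?D k (diagseq (Suc (k + i))) (diagseq (Suc (k + j))) \<le> ennreal ((1/2)^k)" for k i j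
    by (simp add: P_def)
  moreover have "strict_mono (\<lambda>k. diagseq (Suc k))" using subseq_diagseq by (simp add: strict_mono_def)
  ultimately show ?thesis by (intro that[of "\<lambda>k. diagseq (Suc k)"])
qed

lemma rellich_AE_convergent_subsequence:
  fixes f :: "nat \<Rightarrow> 'n::finite fn"
  assumes \<Omega>: "open \<Omega>" and f: "\<And>k. sobolev_bounded \<Omega> 1 N (f k) (g k)" and N: "N \<ge> 0"
  obtains r :: "nat \<Rightarrow> nat" where "strict_mono r" "AE x in lborel. x \<in> \<Omega> \<longrightarrow> convergent (\<lambda>k. f (r k) x)"
proof -
  note [measurable] = sobolev_boundedD(2)[OF f]
  obtain K where K: "\<And>n. compact (K n)" "\<And>n. K n \<subseteq> \<Omega>" "incseq K" "\<Union>(range K) = \<Omega>"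
    using open_compact_exhaustion[OF \<Omega>] by metis
  have [measurable]: "K n \<in> sets borel" for n using K by (auto simp: borel_compact)
  let ?D = "\<lambda>n a b. \<integral>\<^sup>+x\<in>K n. ennreal \<bar>f a x - f b x\<bar> \<partial>lborel"
  obtain d where d: "strict_mono d" and Cauchy: "\<And>n i j. ?D n (d (n + i)) (d (n + j)) \<le> ennreal ((1/2) ^ n)"
    by (rule L1_Cauchy_diagonal_subsequence[OF \<Omega> f N K(1,2)]) (rule that)
  have "AE x in lborel. x \<in> K m \<longrightarrow> convergent (\<lambda>k. f (d k) x)" for m
  proof -
    have "?D m (d (Suc n + m)) (d (n + m)) \<le> ennreal ((1/2)^n)" for n
    proof -
      have "?D m (d (Suc n + m)) (d (n + m)) \<le> ?D (n + m) (d (Suc n + m)) (d (n + m))"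
        using incseqD[OF K(3), of m "n + m"] by (intro nn_integral_mono) (auto simp: indicator_def)
      also have "\<dots> \<le> ennreal ((1/2)^(n + m))" using Cauchy[of "n + m" 1 0] by simp
      also have "\<dots> \<le> ennreal ((1/2)^n)" by (intro ennreal_leI power_decreasing) auto
      finally show ?thesis .
    qed
    then have "AE x in lborel. x \<in> K m \<longrightarrow> convergent (\<lambda>n. f (d (n + m)) x)"
      by (intro AE_convergent_if_geometric_increments) simp_all
    then show ?thesis
      using convergent_ignore_initial_segment[where m=m and f="\<lambda>k. f (d k) _"] by simp
  qed
  then have "AE x in lborel. \<forall>m. x \<in> K m \<longrightarrow> convergent (\<lambda>k. f (d k) x)" unfolding AE_all_countable by blast
  then have "AE x in lborel. x \<in> \<Omega> \<longrightarrow> convergent (\<lambda>k. f (d k) x)"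
    by eventually_elim (use K(4) in blast)
  then show ?thesis by (rule that[OF d])
qed

section \<open>Cones in Lipschitz domains\<close>

lemma interior_cone:
  fixes \<Omega> :: "'a::real_normed_vector set"
  assumes "open \<Omega>" "x0 \<in> \<Omega>" "\<rho> > 0"
  obtains r where "0 < r" "r \<le> \<rho>"
    "\<And>x t. x \<in> ball x0 r \<Longrightarrow> t \<le> r \<Longrightarrow> cball x t \<subseteq> \<Omega> \<inter> ball x0 \<rho>"
proof -
  obtain R where R: "R > 0" "ball x0 R \<subseteq> \<Omega> \<inter> ball x0 \<rho>"
    using openE[of "\<Omega> \<inter> ball x0 \<rho>" x0] assms by (auto simp: open_Int)
  show ?thesis
  proof (rule that[of "min \<rho> R / 2"])
    fix x t assume x: "x \<in> ball x0 (min \<rho> R / 2)" and t: "t \<le> min \<rho> R / 2"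
    have "cball x t \<subseteq> ball x0 R"
    proof
      fix y assume "y \<in> cball x t"
      then show "y \<in> ball x0 R" using x t dist_triangle[of x0 y x] by auto
    qed
    with R(2) show "cball x t \<subseteq> \<Omega> \<inter> ball x0 \<rho>" by blast
  qed (use assms(3) R(1) in auto)
qed

lemma cone_below_Lipschitz_graph:
  fixes e :: "'a::real_inner" and g :: "'a \<Rightarrow> real"
  assumes e: "norm e = 1" and L: "L-lipschitz_on UNIV g" and invariant: "\<And>y t. g (y + t *\<^sub>R e) = g y"
    and x: "x \<bullet> e < g x" and t: "t > 0" and y: "y \<in> cball (x + t *\<^sub>R (- e)) (t * (1 / (2 * (1 + L))))"
  shows "y \<bullet> e < g y"
proof -
  define d where "d = 1 / (2 * (1 + L))"
  have L_nonneg: "L \<ge> 0" using L by (rule lipschitz_on_nonneg)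
  have d: "(1 + L) * d = 1/2" using L_nonneg by (simp add: d_def)
  define w where "w = y - (x + t *\<^sub>R (- e))"
  have w: "norm w \<le> t * d" using y by (simp add: w_def d_def dist_norm norm_minus_commute)
  have y_eq: "y = (x + w) + (- t) *\<^sub>R e" by (simp add: w_def)
  have "y \<bullet> e = x \<bullet> e + w \<bullet> e - t"
    using e by (simp add: y_eq inner_add_left inner_diff_left dot_square_norm)
  also have "\<dots> \<le> x \<bullet> e + t * d - t" using norm_cauchy_schwarz[of w e] w e by simp
  also have "\<dots> < g x + t * d - t" using x by simp
  finally have "y \<bullet> e < g x + t * d - t" .
  moreover have "dist (g (x + w)) (g x) \<le> L * dist (x + w) x" using L by (rule lipschitz_onD) auto
  then have "g x \<le> g (x + w) + L * (t * d)"
    using mult_left_mono[OF w L_nonneg] by (simp add: dist_real_def dist_norm)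
  moreover have "g y = g (x + w)" unfolding y_eq by (rule invariant)
  moreover have "t * d + L * (t * d) = t * ((1 + L) * d)" by (simp add: algebra_simps)
  then have "t * d + L * (t * d) = t / 2" unfolding d by simp
  ultimately show ?thesis using t by linarith
qed

lemma boundary_cone:
  fixes \<Omega> :: "(real^'n::finite) set"
  assumes lip: "lipschitz_boundary \<Omega>" and x0: "x0 \<in> frontier \<Omega>" and \<rho>: "\<rho> > 0"
  obtains r c d T where "0 < r" "r \<le> \<rho>" "d > 0" "T > 0"
    "\<And>x t. x \<in> \<Omega> \<inter> ball x0 r \<Longrightarrow> 0 < t \<Longrightarrow> t \<le> T \<Longrightarrow> cball (x + t *\<^sub>R c) (t * d) \<subseteq> \<Omega> \<inter> ball x0 \<rho>"
proof -
  obtain r0 and e :: "real^'n" and g L where r0: "r0 > 0" and e: "norm e = 1" and L: "L-lipschitz_on UNIV g"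
    and invariant: "\<forall>y t. g (y + t *\<^sub>R e) = g y" and graph: "\<Omega> \<inter> ball x0 r0 = {x \<in> ball x0 r0. x \<bullet> e < g x}"
    using bspec[OF lip[unfolded lipschitz_boundary_def] x0] by (elim exE conjE) (rule that)
  define R where "R = min r0 \<rho>"
  have R: "R > 0" "R \<le> r0" "R \<le> \<rho>" using r0 \<rho> by (auto simp: R_def)
  define d where "d = 1 / (2 * (1 + L))"
  have d: "d > 0" "d \<le> 1" using lipschitz_on_nonneg[OF L] by (simp_all add: d_def)
  have cone: "cball (x + t *\<^sub>R (- e)) (t * d) \<subseteq> \<Omega> \<inter> ball x0 \<rho>"
    if x: "x \<in> \<Omega> \<inter> ball x0 (R/2)" and t: "0 < t" "t \<le> R/8" for x t
  proof
    fix y assume y: "y \<in> cball (x + t *\<^sub>R (- e)) (t * d)"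
    have "t * d \<le> t * 1" using t d by (intro mult_left_mono) auto
    then have "dist (x + t *\<^sub>R (- e)) y \<le> R/8" using y t unfolding mem_cball by linarith
    moreover have "dist x (x + t *\<^sub>R (- e)) \<le> R/8" using t e by (simp add: dist_norm)
    ultimately have "dist x y \<le> R/4" using dist_triangle[of x y "x + t *\<^sub>R (- e)"] by linarith
    then have near: "dist x0 y < R" using x R(1) dist_triangle[of x0 y x] by auto
    have "x \<in> \<Omega> \<inter> ball x0 r0" using x R by auto
    then have below: "x \<bullet> e < g x" unfolding graph by simp
    have "y \<bullet> e < g y"
    proof (rule cone_below_Lipschitz_graph[OF e L])
      show "g (z + r *\<^sub>R e) = g z" for z r using invariant by blast
    qed (use below t(1) y in \<open>simp_all only: d_def\<close>)
    moreover have "y \<in> ball x0 r0" "y \<in> ball x0 \<rho>" using near R by auto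
    ultimately show "y \<in> \<Omega> \<inter> ball x0 \<rho>" using graph by blast
  qed
  show ?thesis by (rule that[of "R/2" d "R/8" "- e"]) (use R d cone in auto)
qed

lemma lipschitz_domain_cone:
  fixes \<Omega> :: "(real^'n::finite) set"
  assumes "open \<Omega>" "lipschitz_boundary \<Omega>" "x0 \<in> closure \<Omega>" "\<rho> > 0"
  obtains r c d T where "0 < r" "r \<le> \<rho>" "d > 0" "T > 0"
    "\<And>x t. x \<in> \<Omega> \<inter> ball x0 r \<Longrightarrow> 0 < t \<Longrightarrow> t \<le> T \<Longrightarrow> cball (x + t *\<^sub>R c) (t * d) \<subseteq> \<Omega> \<inter> ball x0 \<rho>"
proof (cases "x0 \<in> \<Omega>")
  case True
  obtain r where "0 < r" "r \<le> \<rho>" "\<And>x t. x \<in> ball x0 r \<Longrightarrow> t \<le> r \<Longrightarrow> cball x t \<subseteq> \<Omega> \<inter> ball x0 \<rho>"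
    using interior_cone[OF assms(1) True assms(4)] by blast
  then show ?thesis by (intro that[of r 1 r 0]) auto
next
  case False
  then have "x0 \<in> frontier \<Omega>" using assms by (simp add: frontier_def interior_open)
  then show ?thesis by (rule boundary_cone[OF assms(2) _ assms(4)]) (rule that)
qed

lemma power_sobolev_near_closure:
  fixes \<Omega> :: "(real^'n::finite) set"
  assumes \<Omega>: "open \<Omega>" "lipschitz_boundary \<Omega>" "emeasure lborel \<Omega> < \<infinity>" and x0: "x0 \<in> closure \<Omega>" and \<rho>: "\<rho> > 0"
    and exponents: "s > 0" "b \<ge> 1" "q \<ge> b" "real CARD('n) / b - real CARD('n) / q < 1" and N: "N \<ge> 0"
  obtains r K where "0 < r" "r \<le> \<rho>" "K \<ge> 0" "\<And>u g. power_sobolev_bounded (\<Omega> \<inter> ball x0 \<rho>) s b N u g \<Longrightarrow>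
    (\<integral>\<^sup>+x\<in>\<Omega> \<inter> ball x0 r. ennreal (\<bar>u x\<bar> powr ((s + 1) * q)) \<partial>lborel) \<le> ennreal K"
proof -
  obtain r c d T where r: "0 < r" "r \<le> \<rho>" and d: "d > 0" and T: "T > 0" and cone:
      "\<And>x t. x \<in> \<Omega> \<inter> ball x0 r \<Longrightarrow> 0 < t \<Longrightarrow> t \<le> T \<Longrightarrow> cball (x + t *\<^sub>R c) (t * d) \<subseteq> \<Omega> \<inter> ball x0 \<rho>"
    by (rule lipschitz_domain_cone[OF \<Omega>(1,2) x0 \<rho>]) (rule that)
  obtain \<phi> where \<phi>: "mollifier c d \<phi>" using mollifier_exists[OF d] by blast
  interpret cone_domain "\<Omega> \<inter> ball x0 \<rho>" "\<Omega> \<inter> ball x0 r" c d \<phi> T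
    by unfold_locales (use \<Omega> \<phi> r T cone in \<open>auto simp: open_Int\<close>)
  have "emeasure lborel (\<Omega> \<inter> ball x0 \<rho>) < \<infinity>"
    using emeasure_mono[of "\<Omega> \<inter> ball x0 \<rho>" \<Omega> lborel] \<Omega> by (auto intro: le_less_trans)
  then show ?thesis by (rule power_sobolev[OF _ exponents N]) (rule that[OF r])
qed

section \<open>Local choice of constant exponents\<close>

abbreviation nhds_within :: "'a::topological_space \<Rightarrow> 'a set \<Rightarrow> 'a filter" where
  "nhds_within x A \<equiv> inf (nhds x) (principal A)"

lemma continuous_on_tendsto_nhds_within:
  assumes "continuous_on S f" "x \<in> S" "A \<subseteq> S"
  shows "(f \<longlongrightarrow> f x) (nhds_within x A)"
proof (rule continuous_on_tendsto_compose[OF assms(1) _ assms(2)])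
  show "((\<lambda>y. y) \<longlongrightarrow> x) (nhds_within x A)" by (rule filterlim_mono[OF filterlim_ident order_refl inf_le1])
  show "\<forall>\<^sub>F y in nhds_within x A. y \<in> S" using assms(3) by (auto simp: eventually_inf_principal intro: always_eventually)
qed

lemma eventually_nhds_within_metric:
  fixes x :: "'a::metric_space"
  assumes "eventually P (nhds_within x A)"
  obtains \<rho> where "\<rho> > 0" "\<And>y. y \<in> A \<inter> ball x \<rho> \<Longrightarrow> P y"
  using assms unfolding eventually_inf_principal eventually_nhds_metric by (auto simp: dist_commute)

lemma subcritical_exponent_exists:
  fixes a b n \<epsilon> :: real
  assumes a: "a > 0" and b: "1 \<le> b" "b < n" and \<epsilon>: "\<epsilon> > 0"
  obtains q where "q \<ge> b" "n / b - n / q < 1" "(a + 1) * (n * b / (n - b)) - \<epsilon> < (a + 1) * q"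
proof (rule that)
  define qs where "qs = n * b / (n - b)"
  define q where "q = max b (qs - \<epsilon> / (2 * (a + 1)))"
  have "qs > b" using b by (simp add: qs_def pos_less_divide_eq)
  then have q: "q < qs" "q > 0" using \<epsilon> a b(1) by (auto simp: q_def)
  show "q \<ge> b" by (simp add: q_def)
  have "n / qs < n / q" using q b by (intro divide_strict_left_mono) auto
  moreover have "n / qs = n / b - 1" using b by (simp add: qs_def field_simps)
  ultimately show "n / b - n / q < 1" by simp
  have "(a + 1) * qs - \<epsilon> < (a + 1) * qs - \<epsilon> / 2" using \<epsilon> by simp
  also have "\<dots> = (a + 1) * (qs - \<epsilon> / (2 * (a + 1)))" using a by (simp add: field_simps)
  also have "\<dots> \<le> (a + 1) * q" using a by (intro mult_left_mono) (auto simp: q_def)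
  finally show "(a + 1) * (n * b / (n - b)) - \<epsilon> < (a + 1) * q" by (simp add: qs_def)
qed

text \<open>In the limiting case \<open>\<beta> x0 = n\<close> every exponent \<open>q\<close> is subcritical at \<open>x0\<close>, so \<open>q\<close> can be taken beyond
  the bound \<open>P\<close>.\<close>

lemma subcritical_exponent_at:
  fixes \<beta> \<gamma> p :: "'a::topological_space \<Rightarrow> real" and n P \<epsilon> :: real
  assumes lim: "(\<gamma> \<longlongrightarrow> \<gamma> x0) (nhds_within x0 \<Omega>)" "(\<beta> \<longlongrightarrow> \<beta> x0) (nhds_within x0 \<Omega>)"
    and \<gamma>: "1 \<le> \<gamma> x0" and \<beta>: "1 \<le> \<beta> x0" "\<beta> x0 \<le> n" and \<epsilon>: "\<epsilon> > 0"
    and crit: "\<And>x. x \<in> \<Omega> \<Longrightarrow> p x + \<epsilon> < n * (\<gamma> x + \<beta> x) / (n - \<beta> x)"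
  obtains q m where "q \<ge> \<beta> x0" "n / \<beta> x0 - n / q < 1" "m < (\<gamma> x0 / \<beta> x0 + 1) * q"
    "\<forall>\<^sub>F x in nhds_within x0 \<Omega>. p x \<le> P \<longrightarrow> p x + \<epsilon>/2 \<le> m"
proof (cases "\<beta> x0 < n")
  case True
  define pc where "pc x = n * (\<gamma> x + \<beta> x) / (n - \<beta> x)" for x
  have "\<gamma> x0 / \<beta> x0 > 0" "\<epsilon>/4 > 0" using \<gamma> \<beta> \<epsilon> by simp_all
  then obtain q where q: "q \<ge> \<beta> x0" "n / \<beta> x0 - n / q < 1"
    "(\<gamma> x0 / \<beta> x0 + 1) * (n * \<beta> x0 / (n - \<beta> x0)) - \<epsilon>/4 < (\<gamma> x0 / \<beta> x0 + 1) * q"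
    by (rule subcritical_exponent_exists[OF _ \<beta>(1) True])
  moreover have "pc x0 = (\<gamma> x0 / \<beta> x0 + 1) * (n * \<beta> x0 / (n - \<beta> x0))"
    using \<beta>(1) True by (simp add: pc_def field_simps)
  ultimately have m: "pc x0 - \<epsilon>/4 < (\<gamma> x0 / \<beta> x0 + 1) * q" by simp
  have "(pc \<longlongrightarrow> pc x0) (nhds_within x0 \<Omega>)" unfolding pc_def
    by (intro tendsto_intros lim) (use True in auto)
  then have "\<forall>\<^sub>F x in nhds_within x0 \<Omega>. pc x < pc x0 + \<epsilon>/4" by (rule order_tendstoD) (use \<epsilon> in simp)
  moreover have "\<forall>\<^sub>F x in nhds_within x0 \<Omega>. x \<in> \<Omega>" by (simp add: eventually_inf_principal)
  ultimately have "\<forall>\<^sub>F x in nhds_within x0 \<Omega>. p x \<le> P \<longrightarrow> p x + \<epsilon>/2 \<le> pc x0 - \<epsilon>/4"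
  proof eventually_elim
    case (elim x)
    then show ?case using crit[of x] unfolding pc_def by linarith
  qed
  with q(1,2) m show ?thesis by (rule that)
next
  case False
  then have \<beta>n: "\<beta> x0 = n" using \<beta> by simp
  define q where "q = max n (P + \<epsilon>) + 1"
  have q: "q \<ge> n" "q > P + \<epsilon>" "q > 0" using \<beta> by (auto simp: q_def)
  show ?thesis
  proof (rule that[of q "P + \<epsilon>/2"])
    have "0 \<le> \<gamma> x0 / \<beta> x0 * q" using \<gamma> \<beta> q by simp
    then show "P + \<epsilon>/2 < (\<gamma> x0 / \<beta> x0 + 1) * q" using q \<epsilon> unfolding distrib_right by linarith
    show "n / \<beta> x0 - n / q < 1" using q \<beta> \<beta>n by simp
  qed (use q \<beta>n in auto)
qed

lemma exponents_perturbation: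
  fixes a b n q m :: real
  assumes "a > 0" "b \<ge> 1" "n / b - n / q < 1" "m < (a + 1) * q"
  obtains \<delta> where "\<delta> > 0" "a - \<delta> > 0" "n / max 1 (b - \<delta>) - n / q < 1" "m < (a - \<delta> + 1) * q"
proof -
  have "((\<lambda>\<delta>. n / max 1 (b - \<delta>) - n / q) \<longlongrightarrow> n / max 1 (b - 0) - n / q) (at_right 0)"
    by (intro tendsto_intros) auto
  then have "\<forall>\<^sub>F \<delta> in at_right 0. n / max 1 (b - \<delta>) - n / q < 1"
    by (rule order_tendstoD(2)) (use assms in \<open>simp add: max_def\<close>)
  moreover have "((\<lambda>\<delta>. (a - \<delta> + 1) * q) \<longlongrightarrow> (a - 0 + 1) * q) (at_right 0)" by (intro tendsto_intros)
  then have "\<forall>\<^sub>F \<delta> in at_right 0. m < (a - \<delta> + 1) * q"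
    by (rule order_tendstoD(1)) (use assms in simp)
  moreover have "((\<lambda>\<delta>. a - \<delta>) \<longlongrightarrow> a - 0) (at_right 0)" by (intro tendsto_intros)
  then have "\<forall>\<^sub>F \<delta> in at_right 0. a - \<delta> > 0"
    by (rule order_tendstoD(1)) (use assms in simp)
  moreover have "\<forall>\<^sub>F \<delta>::real in at_right 0. \<delta> > 0" by (simp add: eventually_at_right_less)
  ultimately have "\<forall>\<^sub>F \<delta> in at_right 0. \<delta> > 0 \<and> a - \<delta> > 0 \<and> n / max 1 (b - \<delta>) - n / q < 1 \<and> m < (a - \<delta> + 1) * q"
    by eventually_elim auto
  from eventually_happens'[OF trivial_limit_at_right_real this] that show ?thesis by blast
qed

lemma local_constant_exponents:
  fixes \<Omega> :: "(real^'n::finite) set" and \<gamma> \<beta> p :: "'n fn" and P \<epsilon> :: real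
  assumes \<gamma>: "continuous_on (closure \<Omega>) \<gamma>" "\<forall>x\<in>\<Omega>. 1 \<le> \<gamma> x"
    and \<beta>: "continuous_on (closure \<Omega>) \<beta>" "\<forall>x\<in>\<Omega>. 1 \<le> \<beta> x \<and> \<beta> x < real CARD('n)"
    and \<epsilon>: "\<epsilon> > 0"
    and crit: "\<forall>x\<in>\<Omega>. p x + \<epsilon> < real CARD('n) * (\<gamma> x + \<beta> x) / (real CARD('n) - \<beta> x)"
    and x0: "x0 \<in> closure \<Omega>"
  obtains \<rho> s b q where "\<rho> > 0" "s > 0" "b \<ge> 1" "q \<ge> b" "real CARD('n) / b - real CARD('n) / q < 1"
    "\<And>x. x \<in> \<Omega> \<inter> ball x0 \<rho> \<Longrightarrow> s \<le> \<gamma> x / \<beta> x" "\<And>x. x \<in> \<Omega> \<inter> ball x0 \<rho> \<Longrightarrow> b \<le> \<beta> x"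
    "\<And>x. x \<in> \<Omega> \<inter> ball x0 \<rho> \<Longrightarrow> p x \<le> P \<Longrightarrow> p x + \<epsilon>/2 \<le> (s + 1) * q"
proof -
  let ?n = "real CARD('n)" and ?F = "nhds_within x0 \<Omega>"
  have x0_bounds: "1 \<le> \<gamma> x0" "1 \<le> \<beta> x0" "\<beta> x0 \<le> ?n"
    using continuous_ge_on_closure[OF \<gamma>(1) x0, of 1] continuous_ge_on_closure[OF \<beta>(1) x0, of 1]
      continuous_le_on_closure[OF \<beta>(1) x0, of ?n] \<gamma>(2) \<beta>(2) by (auto intro: less_imp_le)
  note lim = continuous_on_tendsto_nhds_within[OF \<gamma>(1) x0 closure_subset]
    continuous_on_tendsto_nhds_within[OF \<beta>(1) x0 closure_subset]
  obtain q m where q: "q \<ge> \<beta> x0" "?n / \<beta> x0 - ?n / q < 1" and m: "m < (\<gamma> x0 / \<beta> x0 + 1) * q"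
    and p_le: "\<forall>\<^sub>F x in ?F. p x \<le> P \<longrightarrow> p x + \<epsilon>/2 \<le> m"
    using subcritical_exponent_at[OF lim x0_bounds \<epsilon> bspec[OF crit]] by blast
  have "\<gamma> x0 / \<beta> x0 > 0" using x0_bounds by simp
  then obtain \<delta> where \<delta>: "\<delta> > 0" "\<gamma> x0 / \<beta> x0 - \<delta> > 0" "?n / max 1 (\<beta> x0 - \<delta>) - ?n / q < 1"
    "m < (\<gamma> x0 / \<beta> x0 - \<delta> + 1) * q"
    using exponents_perturbation[OF _ x0_bounds(2) q(2) m] by blast
  have "((\<lambda>x. \<gamma> x / \<beta> x) \<longlongrightarrow> \<gamma> x0 / \<beta> x0) ?F" by (intro tendsto_intros lim) (use x0_bounds in auto)
  then have "\<forall>\<^sub>F x in ?F. \<gamma> x0 / \<beta> x0 - \<delta> < \<gamma> x / \<beta> x" by (rule order_tendstoD(1)) (use \<delta> in simp)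
  moreover have "\<forall>\<^sub>F x in ?F. \<beta> x0 - \<delta> < \<beta> x" by (rule order_tendstoD(1)[OF lim(2)]) (use \<delta> in simp)
  ultimately have "\<forall>\<^sub>F x in ?F. \<gamma> x0 / \<beta> x0 - \<delta> \<le> \<gamma> x / \<beta> x \<and> \<beta> x0 - \<delta> \<le> \<beta> x \<and> (p x \<le> P \<longrightarrow> p x + \<epsilon>/2 \<le> m)"
    using p_le by eventually_elim auto
  then obtain \<rho> where \<rho>: "\<rho> > 0" "\<And>x. x \<in> \<Omega> \<inter> ball x0 \<rho> \<Longrightarrow>
      \<gamma> x0 / \<beta> x0 - \<delta> \<le> \<gamma> x / \<beta> x \<and> \<beta> x0 - \<delta> \<le> \<beta> x \<and> (p x \<le> P \<longrightarrow> p x + \<epsilon>/2 \<le> m)"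
    by (rule eventually_nhds_within_metric) blast
  show ?thesis
  proof (rule that[OF \<rho>(1) \<delta>(2) _ _ \<delta>(3)])
    show "max 1 (\<beta> x0 - \<delta>) \<le> q" using q(1) x0_bounds \<delta>(1) by auto
    fix x assume "x \<in> \<Omega> \<inter> ball x0 \<rho>"
    from \<rho>(2)[OF this] this \<beta>(2) \<delta>(4)
    show "\<gamma> x0 / \<beta> x0 - \<delta> \<le> \<gamma> x / \<beta> x" "max 1 (\<beta> x0 - \<delta>) \<le> \<beta> x"
      "p x \<le> P \<Longrightarrow> p x + \<epsilon>/2 \<le> (\<gamma> x0 / \<beta> x0 - \<delta> + 1) * q"
      by auto
  qed simp
qed

section \<open>Borel representatives\<close>

lemma locally_integrable_imp_measurable:
  fixes \<Omega> :: "(real^'n::finite) set"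
  assumes \<Omega>: "open \<Omega>" and g: "locally_integrable \<Omega> g"
  shows "(\<lambda>x. indicator \<Omega> x * g x) \<in> borel_measurable lebesgue"
proof -
  obtain K where K: "\<And>n. compact (K n)" "\<And>n. K n \<subseteq> \<Omega>" "incseq K" "\<Union>(range K) = \<Omega>"
    using open_compact_exhaustion[OF \<Omega>] by metis
  show ?thesis
  proof (rule borel_measurable_LIMSEQ_real)
    show "(\<lambda>x. indicator (K n) x * g x) \<in> borel_measurable lebesgue" for n
      using g K unfolding locally_integrable_def set_integrable_def by (auto dest!: borel_measurable_integrable)
    fix x :: "real^'n"
    show "(\<lambda>n. indicator (K n) x * g x) \<longlonglongrightarrow> indicator \<Omega> x * g x"
    proof (cases "x \<in> \<Omega>")
      case True
      then obtain m where "x \<in> K m" using K(4) by blast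
      then have "eventually (\<lambda>n. indicator (K n) x * g x = indicator \<Omega> x * g x) sequentially"
        using incseqD[OF K(3)] True by (intro eventually_sequentiallyI[of m]) (auto simp: indicator_def)
      then show ?thesis by (rule tendsto_eventually)
    next
      case False
      then have "indicator (K n) x = (0::real)" for n
        using K(2)[of n] by (auto simp: indicator_def)
      then show ?thesis using False by simp
    qed
  qed
qed

lemma locally_integrable_imp_set_integrable_lborel:
  fixes a b :: "'n::finite fn"
  assumes a: "locally_integrable \<Omega> a" and AE_eq: "AE x in lebesgue. indicator \<Omega> x * a x = b x"
    and [measurable]: "b \<in> borel_measurable borel" and K: "compact K" "K \<subseteq> \<Omega>"
  shows "set_integrable lborel K b"
proof -
  have [measurable]: "K \<in> sets borel" using K by (simp add: borel_compact)
  have "integrable lebesgue (\<lambda>x. indicator K x *\<^sub>R a x)"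
    using a K by (auto simp: locally_integrable_def set_integrable_def)
  moreover have "AE x in lebesgue. indicator K x *\<^sub>R a x = indicator K x *\<^sub>R b x"
    using AE_eq by eventually_elim (use K in \<open>auto simp: indicator_def split: if_splits\<close>)
  moreover have meas: "(\<lambda>x. indicator K x *\<^sub>R b x) \<in> borel_measurable lborel" by measurable
  ultimately have "integrable lebesgue (\<lambda>x. indicator K x *\<^sub>R b x)"
    by (subst integrable_cong_AE[symmetric]) (auto dest: borel_measurable_integrable intro: measurable_completion)
  then show ?thesis unfolding set_integrable_def using integrable_completion[OF meas] by blast
qed

lemma set_integral_lebesgue_eq_lborel:
  fixes a b c :: "'n::finite fn"
  assumes AE_eq: "AE x in lebesgue. indicator \<Omega> x * a x = b x"
    and a: "(\<lambda>x. indicator \<Omega> x * a x) \<in> borel_measurable lebesgue"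
    and [measurable]: "b \<in> borel_measurable borel" "c \<in> borel_measurable borel"
  shows "(LINT x:\<Omega>|lebesgue. a x * c x) = (\<integral>x. b x * c x \<partial>lborel)"
proof -
  have meas: "c \<in> borel_measurable lebesgue" "b \<in> borel_measurable lebesgue" by (simp_all add: measurable_completion)
  have "(LINT x:\<Omega>|lebesgue. a x * c x) = (\<integral>x. (indicator \<Omega> x * a x) * c x \<partial>lebesgue)"
    by (simp add: set_lebesgue_integral_def mult.assoc)
  also have "\<dots> = (\<integral>x. b x * c x \<partial>lebesgue)"
    by (rule integral_cong_AE) (use AE_eq meas a in \<open>auto elim: eventually_mono\<close>)
  also have "\<dots> = (\<integral>x. b x * c x \<partial>lborel)" by (rule integral_completion) measurable
  finally show ?thesis .
qed

lemma borel_weak_gradient_if_weak_partials: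
  fixes \<Omega> :: "(real^'n::finite) set"
  assumes \<Omega>: "open \<Omega>" and w: "\<And>i. weak_partial \<Omega> u i (g i)"
    and meas: "v \<in> borel_measurable borel" "\<And>i. h i \<in> borel_measurable borel"
    and v: "AE x in lebesgue. indicator \<Omega> x * u x = v x" and h: "\<And>i. AE x in lebesgue. indicator \<Omega> x * g i x = h i x"
  shows "borel_weak_gradient \<Omega> v h"
  unfolding borel_weak_gradient_def
proof (intro conjI allI impI)
  have u: "locally_integrable \<Omega> u" and g: "locally_integrable \<Omega> (g i)" for i using w by (auto simp: weak_partial_def)
  fix i
  show "set_integrable lborel K v" "set_integrable lborel K (h i)" if "compact K \<and> K \<subseteq> \<Omega>" for K
    using locally_integrable_imp_set_integrable_lborel[OF u v meas(1)]
      locally_integrable_imp_set_integrable_lborel[OF g h meas(2)] that by auto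
  fix \<zeta> assume \<zeta>: "test_fun \<Omega> \<zeta>"
  obtain R where k: "continuous_kernel 0 R \<zeta>" "continuous_kernel 0 R (partial i \<zeta>)"
    using test_fun_continuous_kernel[OF \<zeta>] by blast
  have "(LINT x:\<Omega>|lebesgue. u x * partial i \<zeta> x) = - (LINT x:\<Omega>|lebesgue. g i x * \<zeta> x)"
    using w \<zeta> by (auto simp: weak_partial_def)
  then show "(\<integral>x. v x * partial i \<zeta> x \<partial>lborel) = - (\<integral>x. h i x * \<zeta> x \<partial>lborel)"
    unfolding set_integral_lebesgue_eq_lborel
        [OF v locally_integrable_imp_measurable[OF \<Omega> u] meas(1) continuous_kernelD(3)[OF k(2)]]
      set_integral_lebesgue_eq_lborel
        [OF h locally_integrable_imp_measurable[OF \<Omega> g] meas(2) continuous_kernelD(3)[OF k(1)]] .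
qed (use meas in auto)

lemma weak_partial_Dw:
  assumes "has_weak_partials \<Omega> u"
  shows "weak_partial \<Omega> u i (Dw \<Omega> i u)"
  using assms someI_ex[of "weak_partial \<Omega> u i"] by (simp add: has_weak_partials_def Dw_def)

lemma borel_representative:
  fixes \<Omega> :: "(real^'n::finite) set"
  assumes \<Omega>: "open \<Omega>" and u: "has_weak_partials \<Omega> u"
  obtains v h where "borel_weak_gradient \<Omega> v h"
    "AE x in lebesgue. x \<in> \<Omega> \<longrightarrow> v x = u x \<and> (\<forall>i. h i x = Dw \<Omega> i u x)"
proof -
  note w = weak_partial_Dw[OF u]
  have meas: "(\<lambda>x. indicator \<Omega> x * u x) \<in> borel_measurable lebesgue"
    "(\<lambda>x. indicator \<Omega> x * Dw \<Omega> i u x) \<in> borel_measurable lebesgue" for i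
    using w by (auto simp: weak_partial_def intro!: locally_integrable_imp_measurable[OF \<Omega>])
  obtain v where v: "v \<in> borel_measurable lborel" "AE x in lborel. indicator \<Omega> x * u x = v x"
    using completion_ex_borel_measurable_real[OF meas(1)] by blast
  have "\<forall>i. \<exists>h\<in>borel_measurable lborel. AE x in lborel. indicator \<Omega> x * Dw \<Omega> i u x = h x"
    using completion_ex_borel_measurable_real[OF meas(2)] by blast
  then obtain h where h: "\<And>i. h i \<in> borel_measurable lborel" "\<And>i. AE x in lborel. indicator \<Omega> x * Dw \<Omega> i u x = h i x"
    by metis
  have "borel_weak_gradient \<Omega> v h"
    by (rule borel_weak_gradient_if_weak_partials[OF \<Omega> w]) (use v h in \<open>auto intro: AE_completion\<close>)
  moreover have "AE x in lborel. \<forall>i. indicator \<Omega> x * Dw \<Omega> i u x = h i x"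
    using h(2) by (intro eventually_all_finite) auto
  with v(2) have "AE x in lborel. x \<in> \<Omega> \<longrightarrow> v x = u x \<and> (\<forall>i. h i x = Dw \<Omega> i u x)"
    by eventually_elim (auto simp: indicator_def)
  ultimately show ?thesis by (intro that[of v h]) (auto intro: AE_completion)
qed

section \<open>Convergence in variable exponent spaces\<close>

lemma nn_integral_le_if_AE_tendsto:
  fixes f :: "nat \<Rightarrow> 'a \<Rightarrow> ennreal"
  assumes meas: "\<And>k. f k \<in> borel_measurable M" and lim: "AE x in M. (\<lambda>k. f k x) \<longlonglongrightarrow> g x"
    and integrals_le: "\<And>k. (\<integral>\<^sup>+x. f k x \<partial>M) \<le> K"
  shows "(\<integral>\<^sup>+x. g x \<partial>M) \<le> K"
proof -
  have "(\<integral>\<^sup>+x. g x \<partial>M) = (\<integral>\<^sup>+x. liminf (\<lambda>k. f k x) \<partial>M)"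
  proof (rule nn_integral_cong_AE)
    show "AE x in M. g x = liminf (\<lambda>k. f k x)"
      using lim by eventually_elim (metis lim_imp_Liminf sequentially_bot)
  qed
  also have "\<dots> \<le> liminf (\<lambda>k. \<integral>\<^sup>+x. f k x \<partial>M)" by (rule nn_integral_liminf[OF meas])
  also have "\<dots> \<le> liminf (\<lambda>k. K)" by (rule Liminf_mono) (simp add: integrals_le)
  finally show ?thesis by (simp add: Liminf_const)
qed

lemma nn_integral_powr_abs_diff_le:
  fixes u v e :: "'a \<Rightarrow> real"
  assumes [measurable]: "u \<in> borel_measurable M" "v \<in> borel_measurable M" "e \<in> borel_measurable M"
    and e: "AE x in M. 0 \<le> e x \<and> e x \<le> E"
  shows "(\<integral>\<^sup>+x. ennreal (\<bar>u x - v x\<bar> powr e x) \<partial>M)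
    \<le> ennreal (2 powr E) * ((\<integral>\<^sup>+x. ennreal (\<bar>u x\<bar> powr e x) \<partial>M) + (\<integral>\<^sup>+x. ennreal (\<bar>v x\<bar> powr e x) \<partial>M))"
proof -
  have "(\<integral>\<^sup>+x. ennreal (\<bar>u x - v x\<bar> powr e x) \<partial>M)
    \<le> (\<integral>\<^sup>+x. ennreal (2 powr E) * (ennreal (\<bar>u x\<bar> powr e x) + ennreal (\<bar>v x\<bar> powr e x)) \<partial>M)"
  proof (rule nn_integral_mono_AE)
    show "AE x in M. ennreal (\<bar>u x - v x\<bar> powr e x)
      \<le> ennreal (2 powr E) * (ennreal (\<bar>u x\<bar> powr e x) + ennreal (\<bar>v x\<bar> powr e x))"
      using e
    proof eventually_elim
      case (elim x)
      have "\<bar>u x - v x\<bar> powr e x \<le> (\<bar>u x\<bar> + \<bar>v x\<bar>) powr e x" using elim by (intro powr_mono2) auto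
      also have "\<dots> \<le> 2 powr e x * (\<bar>u x\<bar> powr e x + \<bar>v x\<bar> powr e x)" using elim by (intro powr_add_le) auto
      also have "\<dots> \<le> 2 powr E * (\<bar>u x\<bar> powr e x + \<bar>v x\<bar> powr e x)"
        using elim by (intro mult_right_mono powr_mono) auto
      finally show ?case by (simp add: ennreal_leI flip: ennreal_plus ennreal_mult')
    qed
  qed
  then show ?thesis by (simp add: nn_integral_cmult nn_integral_add)
qed

lemma powr_le_truncated_plus_powr:
  fixes x p \<eta> B :: real
  assumes "0 < B" "0 \<le> \<eta>"
  shows "\<bar>x\<bar> powr p \<le> min \<bar>x\<bar> B powr p + B powr (- \<eta>) * \<bar>x\<bar> powr (p + \<eta>)"
proof (cases "\<bar>x\<bar> \<le> B")
  case True
  then show ?thesis by simp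
next
  case False
  then have "\<bar>x\<bar> powr p = \<bar>x\<bar> powr (- \<eta>) * \<bar>x\<bar> powr (p + \<eta>)" using assms by (simp flip: powr_add)
  also have "\<dots> \<le> B powr (- \<eta>) * \<bar>x\<bar> powr (p + \<eta>)"
    using False assms by (intro mult_right_mono powr_mono2') auto
  finally show ?thesis by (simp add: add_increasing)
qed

lemma nn_integral_truncated_powr_tendsto_0:
  fixes d :: "nat \<Rightarrow> 'a \<Rightarrow> real"
  assumes fin: "emeasure M (space M) < \<infinity>"
    and [measurable]: "\<And>k. d k \<in> borel_measurable M" "p \<in> borel_measurable M"
    and p: "AE x in M. 1 \<le> p x \<and> p x \<le> P" and lim: "AE x in M. (\<lambda>k. d k x) \<longlonglongrightarrow> 0" and B: "B \<ge> 1"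
  shows "(\<lambda>k. \<integral>\<^sup>+x. ennreal (min \<bar>d k x\<bar> B powr p x) \<partial>M) \<longlonglongrightarrow> 0"
proof -
  have "(\<lambda>k. \<integral>\<^sup>+x. ennreal (min \<bar>d k x\<bar> B powr p x) \<partial>M) \<longlonglongrightarrow> (\<integral>\<^sup>+x. 0 \<partial>M)"
  proof (rule nn_integral_dominated_convergence[where w="\<lambda>x. ennreal (B powr P)"])
    show "(\<integral>\<^sup>+x. ennreal (B powr P) \<partial>M) < \<infinity>" using fin by (simp add: ennreal_mult_less_top)
    show "AE x in M. (\<lambda>k. ennreal (min \<bar>d k x\<bar> B powr p x)) \<longlonglongrightarrow> 0"
      using lim p
    proof eventually_elim
      case (elim x)
      then have "(\<lambda>k. min \<bar>d k x\<bar> B powr p x) \<longlonglongrightarrow> min \<bar>0\<bar> B powr p x"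
        using B by (intro tendsto_powr' tendsto_min tendsto_rabs tendsto_const) (auto simp: min_def)
      then show ?case using tendsto_ennrealI[of "\<lambda>k. min \<bar>d k x\<bar> B powr p x" 0] B by simp
    qed
    show "AE x in M. ennreal (min \<bar>d k x\<bar> B powr p x) \<le> ennreal (B powr P)" for k
      using p
    proof eventually_elim
      case (elim x)
      have "min \<bar>d k x\<bar> B powr p x \<le> B powr p x" using elim B by (intro powr_mono2) auto
      also have "\<dots> \<le> B powr P" using elim B by (intro powr_mono) auto
      finally show ?case by (rule ennreal_leI)
    qed
  qed simp_all
  then show ?thesis by simp
qed

lemma vitali_powr_tendsto_0:
  fixes d :: "nat \<Rightarrow> 'a \<Rightarrow> real"
  assumes fin: "emeasure M (space M) < \<infinity>"
    and meas[measurable]: "\<And>k. d k \<in> borel_measurable M" "p \<in> borel_measurable M"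
    and p: "AE x in M. 1 \<le> p x \<and> p x \<le> P" and lim: "AE x in M. (\<lambda>k. d k x) \<longlonglongrightarrow> 0"
    and \<eta>: "\<eta> > 0" and K: "K \<ge> 0" and bound: "\<And>k. (\<integral>\<^sup>+x. ennreal (\<bar>d k x\<bar> powr (p x + \<eta>)) \<partial>M) \<le> ennreal K"
  shows "(\<lambda>k. \<integral>\<^sup>+x. ennreal (\<bar>d k x\<bar> powr p x) \<partial>M) \<longlonglongrightarrow> 0"
proof (rule order_tendstoI)
  fix a :: ennreal assume "0 < a"
  then obtain b where b: "0 < b" "b < a" using dense by blast
  then obtain \<epsilon> where \<epsilon>: "b = ennreal \<epsilon>" "\<epsilon> > 0" by (cases b) auto
  have "((\<lambda>B. B powr (- \<eta>) * K) \<longlongrightarrow> 0 * K) at_top"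
    by (intro tendsto_mult tendsto_const tendsto_neg_powr[OF _ filterlim_ident]) (use \<eta> in simp)
  then have "\<forall>\<^sub>F B in at_top. B powr (- \<eta>) * K < \<epsilon>/2" by (rule order_tendstoD) (use \<epsilon> in simp)
  from eventually_happens'[OF trivial_limit_at_top_linorder eventually_conj[OF this eventually_ge_at_top[of 1]]]
  obtain B :: real where B: "B \<ge> 1" "B powr (- \<eta>) * K < \<epsilon>/2" by blast
  let ?m = "\<lambda>k. \<integral>\<^sup>+x. ennreal (min \<bar>d k x\<bar> B powr p x) \<partial>M"
  have truncation: "(\<integral>\<^sup>+x. ennreal (\<bar>d k x\<bar> powr p x) \<partial>M) \<le> ?m k + ennreal (\<epsilon>/2)" for k
  proof -
    have "(\<integral>\<^sup>+x. ennreal (\<bar>d k x\<bar> powr p x) \<partial>M)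
      \<le> (\<integral>\<^sup>+x. ennreal (min \<bar>d k x\<bar> B powr p x) + ennreal (B powr (- \<eta>)) * ennreal (\<bar>d k x\<bar> powr (p x + \<eta>)) \<partial>M)"
      using B(1) \<eta> by (intro nn_integral_mono)
        (simp add: ennreal_leI powr_le_truncated_plus_powr flip: ennreal_plus ennreal_mult')
    also have "\<dots> = ?m k + ennreal (B powr (- \<eta>)) * (\<integral>\<^sup>+x. ennreal (\<bar>d k x\<bar> powr (p x + \<eta>)) \<partial>M)"
      by (simp add: nn_integral_add nn_integral_cmult)
    also have "\<dots> \<le> ?m k + ennreal (B powr (- \<eta>)) * ennreal K"
      by (intro add_left_mono mult_left_mono bound) simp
    also have "\<dots> \<le> ?m k + ennreal (\<epsilon>/2)"
      using B(2) by (intro add_left_mono) (simp add: ennreal_leI flip: ennreal_mult')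
    finally show ?thesis .
  qed
  have "?m \<longlonglongrightarrow> 0" by (rule nn_integral_truncated_powr_tendsto_0[OF fin meas p lim B(1)])
  then have "\<forall>\<^sub>F k in sequentially. ?m k < ennreal (\<epsilon>/2)" by (rule order_tendstoD) (use \<epsilon> in simp)
  then show "\<forall>\<^sub>F k in sequentially. (\<integral>\<^sup>+x. ennreal (\<bar>d k x\<bar> powr p x) \<partial>M) < a"
  proof (elim eventually_mono)
    fix k assume "?m k < ennreal (\<epsilon>/2)"
    then have "?m k + ennreal (\<epsilon>/2) \<le> ennreal (\<epsilon>/2) + ennreal (\<epsilon>/2)" by (intro add_right_mono less_imp_le)
    also have "\<dots> = b" using \<epsilon> by (simp flip: ennreal_plus)
    finally show "(\<integral>\<^sup>+x. ennreal (\<bar>d k x\<bar> powr p x) \<partial>M) < a"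
      using b(2) truncation[of k] by simp
  qed
qed simp

lemma nn_integral_lebesgue_on:
  assumes "\<Omega> \<in> sets lebesgue"
  shows "(\<integral>\<^sup>+x\<in>\<Omega>. f x \<partial>lebesgue) = (\<integral>\<^sup>+x. f x \<partial>lebesgue_on \<Omega>)"
  using assms by (simp add: nn_integral_restrict_space)

lemma AE_lebesgue_on:
  assumes "\<Omega> \<in> sets lebesgue"
  shows "(AE x in lebesgue_on \<Omega>. P x) \<longleftrightarrow> (AE x in lebesgue. x \<in> \<Omega> \<longrightarrow> P x)"
  using assms by (simp add: AE_restrict_space_iff)

lemma emeasure_lebesgue_on_space:
  assumes "\<Omega> \<in> sets lebesgue"
  shows "emeasure (lebesgue_on \<Omega>) (space (lebesgue_on \<Omega>)) = emeasure lebesgue \<Omega>"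
  using assms by (simp add: emeasure_restrict_space space_restrict_space)

lemma modular_lebesgue_on:
  assumes "\<Omega> \<in> sets lebesgue"
  shows "modular \<Omega> p u = (\<integral>\<^sup>+x. ennreal (\<bar>u x\<bar> powr p x) \<partial>lebesgue_on \<Omega>)"
  by (simp only: modular_def nn_integral_lebesgue_on[OF assms])

lemma M0_bounded:
  assumes "M0 \<Omega> p" "\<Omega> \<in> sets lebesgue"
  obtains P where "AE x in lebesgue_on \<Omega>. 1 \<le> p x \<and> p x \<le> P"
  using assms unfolding M0_def AE_lebesgue_on[OF assms(2)] by blast

lemma lux_norm_bounds:
  assumes "0 < l" "modular \<Omega> p (\<lambda>x. u x / l) \<le> 1"
  shows "0 \<le> lux_norm \<Omega> p u" "lux_norm \<Omega> p u \<le> l"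
  unfolding lux_norm_def using assms by (auto intro!: cInf_greatest cInf_lower bdd_belowI[of _ 0])

lemma modular_divide_le:
  assumes \<Omega>: "\<Omega> \<in> sets lebesgue" and meas: "u \<in> borel_measurable (lebesgue_on \<Omega>)" "p \<in> borel_measurable (lebesgue_on \<Omega>)"
    and p: "AE x in lebesgue_on \<Omega>. p x \<le> P" and l: "0 < l" "l \<le> 1"
  shows "modular \<Omega> p (\<lambda>x. u x / l) \<le> ennreal (l powr (- P)) * modular \<Omega> p u"
proof -
  note [measurable] = meas
  have "modular \<Omega> p (\<lambda>x. u x / l) \<le> (\<integral>\<^sup>+x. ennreal (l powr (- P)) * ennreal (\<bar>u x\<bar> powr p x) \<partial>lebesgue_on \<Omega>)"
    unfolding modular_lebesgue_on[OF \<Omega>]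
  proof (rule nn_integral_mono_AE)
    show "AE x in lebesgue_on \<Omega>. ennreal (\<bar>u x / l\<bar> powr p x) \<le> ennreal (l powr (- P)) * ennreal (\<bar>u x\<bar> powr p x)"
      using p
    proof eventually_elim
      case (elim x)
      have "\<bar>u x / l\<bar> powr p x = l powr (- p x) * \<bar>u x\<bar> powr p x"
        using l by (simp add: powr_divide powr_minus field_simps)
      also have "\<dots> \<le> l powr (- P) * \<bar>u x\<bar> powr p x"
        using elim l by (intro mult_right_mono powr_mono') auto
      finally show ?case by (simp add: ennreal_leI flip: ennreal_mult')
    qed
  qed
  then show ?thesis by (simp add: modular_lebesgue_on[OF \<Omega>] nn_integral_cmult)
qed

lemma lux_norm_tendsto_0:
  assumes \<Omega>: "\<Omega> \<in> sets lebesgue" and p: "M0 \<Omega> p" and u: "\<And>k. u k \<in> borel_measurable (lebesgue_on \<Omega>)"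
    and lim: "(\<lambda>k. modular \<Omega> p (u k)) \<longlonglongrightarrow> 0"
  shows "(\<lambda>k. lux_norm \<Omega> p (u k)) \<longlonglongrightarrow> 0"
proof (rule tendstoI)
  obtain P where "AE x in lebesgue_on \<Omega>. 1 \<le> p x \<and> p x \<le> P" by (rule M0_bounded[OF p \<Omega>])
  then have P: "AE x in lebesgue_on \<Omega>. p x \<le> P" by eventually_elim simp
  have meas: "p \<in> borel_measurable (lebesgue_on \<Omega>)" using p by (simp add: M0_def)
  fix \<epsilon> :: real assume \<epsilon>: "\<epsilon> > 0"
  define l where "l = min 1 (\<epsilon>/2)"
  have l: "0 < l" "l \<le> 1" "l < \<epsilon>" using \<epsilon> by (auto simp: l_def)
  have "\<forall>\<^sub>F k in sequentially. modular \<Omega> p (u k) < ennreal (l powr P)"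
    using lim by (rule order_tendstoD) (use l in simp)
  then show "\<forall>\<^sub>F k in sequentially. dist (lux_norm \<Omega> p (u k)) 0 < \<epsilon>"
  proof eventually_elim
    case (elim k)
    have "modular \<Omega> p (\<lambda>x. u k x / l) \<le> ennreal (l powr (- P)) * ennreal (l powr P)"
      by (rule order_trans[OF modular_divide_le[OF \<Omega> u meas P l(1,2)] mult_left_mono]) (use elim in auto)
    also have "\<dots> = 1" using l by (simp flip: ennreal_mult' powr_add)
    finally show ?case using lux_norm_bounds[OF l(1), of \<Omega> p "u k"] l(3) by simp
  qed
qed

lemma Lpx_if_nn_integral_powr_le:
  assumes \<Omega>: "\<Omega> \<in> sets lebesgue" "emeasure lebesgue \<Omega> < \<infinity>" and p: "M0 \<Omega> p"
    and u: "u \<in> borel_measurable (lebesgue_on \<Omega>)" and \<eta>: "\<eta> \<ge> 0"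
    and bound: "(\<integral>\<^sup>+x. ennreal (\<bar>u x\<bar> powr (p x + \<eta>)) \<partial>lebesgue_on \<Omega>) \<le> ennreal K"
  shows "u \<in> Lpx \<Omega> p"
proof -
  have [measurable]: "u \<in> borel_measurable (lebesgue_on \<Omega>)" "p \<in> borel_measurable (lebesgue_on \<Omega>)"
    using u p by (simp_all add: M0_def)
  obtain P where P: "AE x in lebesgue_on \<Omega>. 1 \<le> p x \<and> p x \<le> P" by (rule M0_bounded[OF p \<Omega>(1)])
  have "modular \<Omega> p u \<le> (\<integral>\<^sup>+x. 1 + ennreal (\<bar>u x\<bar> powr (p x + \<eta>)) \<partial>lebesgue_on \<Omega>)"
    unfolding modular_lebesgue_on[OF \<Omega>(1)]
  proof (rule nn_integral_mono_AE)
    show "AE x in lebesgue_on \<Omega>. ennreal (\<bar>u x\<bar> powr p x) \<le> 1 + ennreal (\<bar>u x\<bar> powr (p x + \<eta>))"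
      using P
    proof eventually_elim
      case (elim x)
      then have "\<bar>u x\<bar> powr p x \<le> 1 + \<bar>u x\<bar> powr (p x + \<eta>)" using \<eta> by (intro powr_le_one_plus_powr) auto
      then show ?case by (simp add: ennreal_leI flip: ennreal_1 ennreal_plus)
    qed
  qed
  also have "\<dots> = emeasure lebesgue \<Omega> + (\<integral>\<^sup>+x. ennreal (\<bar>u x\<bar> powr (p x + \<eta>)) \<partial>lebesgue_on \<Omega>)"
    using \<Omega>(1) by (simp add: nn_integral_add emeasure_restrict_space space_restrict_space)
  also have "\<dots> < \<infinity>" using \<Omega>(2) le_less_trans[OF bound ennreal_less_top] by simp
  finally show ?thesis using u by (simp add: Lpx_def)
qed

lemma Lpx_convergent_if_AE_convergent:
  fixes u :: "nat \<Rightarrow> 'n::finite fn"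
  assumes \<Omega>: "\<Omega> \<in> sets lebesgue" "emeasure lebesgue \<Omega> < \<infinity>" and p: "M0 \<Omega> p" and \<eta>: "\<eta> > 0" and K: "K \<ge> 0"
    and u: "\<And>k. u k \<in> borel_measurable (lebesgue_on \<Omega>)"
    and bound: "\<And>k. (\<integral>\<^sup>+x. ennreal (\<bar>u k x\<bar> powr (p x + \<eta>)) \<partial>lebesgue_on \<Omega>) \<le> ennreal K"
    and conv: "AE x in lebesgue_on \<Omega>. convergent (\<lambda>k. u k x)"
  obtains v where "v \<in> Lpx \<Omega> p" "(\<lambda>k. lux_norm \<Omega> p (\<lambda>x. u k x - v x)) \<longlonglongrightarrow> 0"
proof -
  let ?L = "lebesgue_on \<Omega>"
  have p_measurable: "p \<in> borel_measurable ?L" using p by (simp add: M0_def)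
  obtain P where P: "AE x in ?L. 1 \<le> p x \<and> p x \<le> P" by (rule M0_bounded[OF p \<Omega>(1)])
  note [measurable] = u p_measurable
  define v where "v x = lim (\<lambda>k. u k x)" for x
  have [measurable]: "v \<in> borel_measurable ?L" unfolding v_def[abs_def] by measurable
  have lim: "AE x in ?L. (\<lambda>k. u k x) \<longlonglongrightarrow> v x"
    using conv by eventually_elim (simp add: v_def convergent_LIMSEQ_iff)
  have v_bound: "(\<integral>\<^sup>+x. ennreal (\<bar>v x\<bar> powr (p x + \<eta>)) \<partial>?L) \<le> ennreal K"
  proof (rule nn_integral_le_if_AE_tendsto[OF _ _ bound])
    show "AE x in ?L. (\<lambda>k. ennreal (\<bar>u k x\<bar> powr (p x + \<eta>))) \<longlonglongrightarrow> ennreal (\<bar>v x\<bar> powr (p x + \<eta>))"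
      using lim P by eventually_elim
        (use \<eta> in \<open>intro tendsto_ennrealI tendsto_powr' tendsto_rabs tendsto_const; auto\<close>)
  qed measurable
  have "(\<integral>\<^sup>+x. ennreal (\<bar>u k x - v x\<bar> powr (p x + \<eta>)) \<partial>?L) \<le> ennreal (2 powr (P + \<eta>) * (K + K))" for k
  proof -
    have "(\<integral>\<^sup>+x. ennreal (\<bar>u k x - v x\<bar> powr (p x + \<eta>)) \<partial>?L)
      \<le> ennreal (2 powr (P + \<eta>)) * ((\<integral>\<^sup>+x. ennreal (\<bar>u k x\<bar> powr (p x + \<eta>)) \<partial>?L) +
          (\<integral>\<^sup>+x. ennreal (\<bar>v x\<bar> powr (p x + \<eta>)) \<partial>?L))"
      by (rule nn_integral_powr_abs_diff_le; measurable?) (use P \<eta> in \<open>auto elim: eventually_mono\<close>)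
    also have "\<dots> \<le> ennreal (2 powr (P + \<eta>)) * (ennreal K + ennreal K)"
      by (intro mult_left_mono add_mono bound v_bound) simp
    finally show ?thesis using K by (simp flip: ennreal_plus ennreal_mult')
  qed
  then have "(\<lambda>k. \<integral>\<^sup>+x. ennreal (\<bar>u k x - v x\<bar> powr p x) \<partial>?L) \<longlonglongrightarrow> 0"
  proof (intro vitali_powr_tendsto_0[OF _ _ p_measurable P _ \<eta>])
    show "emeasure ?L (space ?L) < \<infinity>" unfolding emeasure_lebesgue_on_space[OF \<Omega>(1)] by (rule \<Omega>(2))
    show "AE x in ?L. (\<lambda>k. u k x - v x) \<longlonglongrightarrow> 0" using lim by eventually_elim (simp add: LIM_zero)
    show "0 \<le> 2 powr (P + \<eta>) * (K + K)" using K by simp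
  qed measurable
  then have "(\<lambda>k. lux_norm \<Omega> p (\<lambda>x. u k x - v x)) \<longlonglongrightarrow> 0"
    by (intro lux_norm_tendsto_0[OF \<Omega>(1) p]) (simp_all add: modular_lebesgue_on[OF \<Omega>(1)])
  moreover have "v \<in> Lpx \<Omega> p" by (rule Lpx_if_nn_integral_powr_le[OF \<Omega> p _ less_imp_le[OF \<eta>] v_bound]) measurable
  ultimately show ?thesis by (intro that)
qed

section \<open>A slowly growing change of variable\<close>

text \<open>As \<open>capped_powr Q t \<le> \<bar>t\<bar> powr a\<close> for every \<open>a \<le> Q\<close>, composition with an antiderivative turns a bound
  on \<open>\<bar>u\<bar> powr \<gamma> * \<bar>D u\<bar> powr \<beta>\<close> into one on \<open>D (F \<circ> u)\<close> with constant exponent 1.\<close>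

definition capped_powr :: "real \<Rightarrow> real \<Rightarrow> real" where
  "capped_powr Q t = min (\<bar>t\<bar> powr Q) 1"

lemma continuous_capped_powr: "Q > 0 \<Longrightarrow> continuous_on UNIV (capped_powr Q)"
  unfolding capped_powr_def[abs_def]
  by (intro continuous_on_min continuous_on_const continuous_on_powr' continuous_on_rabs continuous_on_id) auto

lemma capped_powr_bounds: "0 \<le> capped_powr Q t" "capped_powr Q t \<le> 1"
  by (simp_all add: capped_powr_def)

lemma capped_powr_pos: "t \<noteq> 0 \<Longrightarrow> 0 < capped_powr Q t"
  by (simp add: capped_powr_def)

lemma capped_powr_minus: "capped_powr Q (- t) = capped_powr Q t"
  by (simp add: capped_powr_def)

lemma capped_powr_eq_1: "Q > 0 \<Longrightarrow> 1 \<le> t \<Longrightarrow> capped_powr Q t = 1"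
  by (simp add: capped_powr_def min_def ge_one_powr_ge_zero antisym)

lemma capped_powr_le_powr:
  assumes "0 \<le> a" "a \<le> Q"
  shows "capped_powr Q t \<le> \<bar>t\<bar> powr a"
proof (cases "\<bar>t\<bar> \<le> 1")
  case True
  then have "\<bar>t\<bar> powr Q \<le> \<bar>t\<bar> powr a" using assms by (intro powr_mono') auto
  then show ?thesis by (simp add: capped_powr_def)
next
  case False
  then show ?thesis using assms by (simp add: capped_powr_def ge_one_powr_ge_zero min.coboundedI2)
qed

lemma antiderivative_strict_mono:
  fixes F :: "real \<Rightarrow> real"
  assumes F: "\<And>t. (F has_real_derivative f t) (at t)" and pos: "\<And>t. t \<noteq> 0 \<Longrightarrow> f t > 0"
  shows "strict_mono F"
proof (rule strict_monoI)
  fix x y :: real assume xy: "x < y"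
  have less: "F a < F b" if "a < b" "0 \<notin> {a<..<b}" for a b
  proof (rule DERIV_pos_imp_increasing_open[OF that(1)])
    show "\<exists>y. (F has_real_derivative y) (at t) \<and> 0 < y" if "a < t" "t < b" for t
      using F pos[of t] that \<open>0 \<notin> {a<..<b}\<close> by (intro exI[of _ "f t"]) auto
    show "continuous_on {a..b} F" by (rule DERIV_continuous_on) (rule has_field_derivative_at_within[OF F])
  qed
  show "F x < F y"
  proof (cases "0 \<in> {x<..<y}")
    case True
    then show ?thesis using less[of x 0] less[of 0 y] by simp
  qed (use less xy in blast)
qed

lemma surj_if_odd_and_lower_bound:
  fixes F :: "real \<Rightarrow> real"
  assumes cont: "continuous_on UNIV F" and odd: "\<And>t. F (- t) = - F t" and lower: "\<And>t. t \<ge> 1 \<Longrightarrow> F t \<ge> t - 1"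
  shows "surj F"
proof -
  have "\<exists>x\<ge>- (\<bar>l\<bar> + 1). x \<le> \<bar>l\<bar> + 1 \<and> F x = l" for l
    by (rule IVT'[OF _ _ _ continuous_on_subset[OF cont]])
      (use lower[of "\<bar>l\<bar> + 1"] odd[of "\<bar>l\<bar> + 1"] in auto)
  then show ?thesis unfolding surj_def by metis
qed

lemma convergent_if_strict_mono_image_convergent:
  fixes F :: "real \<Rightarrow> real"
  assumes mono: "strict_mono F" and surj: "surj F" and conv: "convergent (\<lambda>k. F (a k))"
  shows "convergent a"
proof -
  obtain x where lim: "(\<lambda>k. F (a k)) \<longlonglongrightarrow> F x" using conv surj unfolding convergent_def by (metis surjD)
  have "a \<longlonglongrightarrow> x"
  proof (rule order_tendstoI)
    show "\<forall>\<^sub>F k in sequentially. y < a k" if "y < x" for y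
      using order_tendstoD(1)[OF lim, of "F y"] that by (simp add: strict_mono_less[OF mono])
    show "\<forall>\<^sub>F k in sequentially. a k < y" if "x < y" for y
      using order_tendstoD(2)[OF lim, of "F y"] that by (simp add: strict_mono_less[OF mono])
  qed
  then show ?thesis by (auto simp: convergent_def)
qed

lemma capped_powr_antiderivative:
  assumes Q: "Q > 0"
  obtains F where "\<And>t. (F has_real_derivative capped_powr Q t) (at t)" "\<And>t. \<bar>F t\<bar> \<le> \<bar>t\<bar>" "strict_mono F" "surj F"
proof -
  obtain F where F: "F 0 = 0" "\<And>t. (F has_real_derivative capped_powr Q t) (at t)"
    by (rule continuous_antiderivative[OF continuous_capped_powr[OF Q]]) (rule that)
  have abs_F: "\<bar>F t\<bar> = F \<bar>t\<bar>" for t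
    by (rule abs_antiderivative_even_nonneg[OF F capped_powr_minus capped_powr_bounds(1)])
  have "((\<lambda>t. t - F t) has_real_derivative 1 - capped_powr Q t) (at t)" for t
    by (intro DERIV_diff DERIV_ident F(2))
  from antiderivative_nonneg_mono[OF this, of 0] have "F \<bar>t\<bar> \<le> \<bar>t\<bar>" for t
    using F(1) capped_powr_bounds(2)[of Q] by fastforce
  then have "\<bar>F t\<bar> \<le> \<bar>t\<bar>" for t by (simp only: abs_F)
  moreover have mono: "strict_mono F" by (rule antiderivative_strict_mono[OF F(2) capped_powr_pos])
  moreover have "surj F"
  proof (rule surj_if_odd_and_lower_bound)
    show "F (- t) = - F t" for t by (rule antiderivative_even_odd[OF F capped_powr_minus])
    show "continuous_on UNIV F" using F(2) by (intro DERIV_continuous_on) blast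
    show "F t \<ge> t - 1" if "t \<ge> 1" for t
    proof (cases "t = 1")
      case False
      then have "1 < t" using that by simp
      from MVT2[OF this F(2)] obtain z where "1 < z" "F t - F 1 = (t - 1) * capped_powr Q z" by blast
      moreover have "F 0 < F 1" using mono by (rule strict_monoD) simp
      ultimately show ?thesis using F(1) capped_powr_eq_1[OF Q, of z] by simp
    qed (use strict_monoD[OF mono, of 0 1] F(1) in simp)
  qed
  ultimately show ?thesis by (rule that[OF F(2)])
qed

section \<open>The embedding\<close>

lemma powr_divide_mult_powr:
  fixes a d \<beta> \<gamma> :: real
  assumes "\<beta> > 0"
  shows "(a powr (\<gamma> / \<beta>) * d) powr \<beta> = a powr \<gamma> * d powr \<beta>"
  using assms by (simp add: powr_mult powr_powr)

lemma weighted_powr_le_one_plus: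
  fixes a b d w \<beta> \<gamma> :: real
  assumes "0 \<le> w" "w \<le> a powr (\<gamma> / \<beta>)" "0 \<le> d" "0 < b" "b \<le> \<beta>"
  shows "(w * d) powr b \<le> 1 + a powr \<gamma> * d powr \<beta>"
proof -
  have "(w * d) powr b \<le> (a powr (\<gamma> / \<beta>) * d) powr b" using assms by (intro powr_mono2 mult_right_mono) auto
  also have "\<dots> \<le> 1 + (a powr (\<gamma> / \<beta>) * d) powr \<beta>" using assms by (intro powr_le_one_plus_powr) auto
  also have "(a powr (\<gamma> / \<beta>) * d) powr \<beta> = a powr \<gamma> * d powr \<beta>" using assms by (intro powr_divide_mult_powr) simp
  finally show ?thesis .
qed

lemma nn_integral_powr_scaled_le:
  fixes e f :: "'a \<Rightarrow> real"
  assumes [measurable]: "f \<in> borel_measurable M" and f: "\<And>x. f x \<ge> 0" and e: "AE x in M. 1 \<le> e x" and l: "l \<ge> 1"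
  shows "(\<integral>\<^sup>+x. ennreal (l powr (- e x) * f x) \<partial>M) \<le> ennreal (1 / l) * (\<integral>\<^sup>+x. ennreal (f x) \<partial>M)"
proof -
  have "(\<integral>\<^sup>+x. ennreal (l powr (- e x) * f x) \<partial>M) \<le> (\<integral>\<^sup>+x. ennreal (1 / l) * ennreal (f x) \<partial>M)"
  proof (rule nn_integral_mono_AE)
    show "AE x in M. ennreal (l powr (- e x) * f x) \<le> ennreal (1 / l) * ennreal (f x)"
      using e
    proof eventually_elim
      case (elim x)
      have "l powr (- e x) \<le> l powr (- 1)" using elim l by (intro powr_mono) auto
      also have "\<dots> = 1 / l" using l by (simp add: powr_minus_divide)
      finally have "l powr (- e x) * f x \<le> 1 / l * f x" using f by (intro mult_right_mono) auto
      from ennreal_leI[OF this] show ?case using l by (subst ennreal_mult'[symmetric]) auto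
    qed
  qed
  then show ?thesis by (simp add: nn_integral_cmult)
qed

lemma nn_integral_le_powr_scaled:
  fixes e f :: "'a \<Rightarrow> real"
  assumes [measurable]: "f \<in> borel_measurable M" "e \<in> borel_measurable M"
    and f: "\<And>x. f x \<ge> 0" and e: "AE x in M. 0 \<le> e x \<and> e x \<le> Q" and l: "0 < l" "l \<le> \<mu>" and \<mu>: "\<mu> \<ge> 1"
  shows "(\<integral>\<^sup>+x. ennreal (f x) \<partial>M) \<le> ennreal (\<mu> powr Q) * (\<integral>\<^sup>+x. ennreal (l powr (- e x) * f x) \<partial>M)"
proof -
  have "(\<integral>\<^sup>+x. ennreal (f x) \<partial>M) \<le> (\<integral>\<^sup>+x. ennreal (\<mu> powr Q) * ennreal (l powr (- e x) * f x) \<partial>M)"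
  proof (rule nn_integral_mono_AE)
    show "AE x in M. ennreal (f x) \<le> ennreal (\<mu> powr Q) * ennreal (l powr (- e x) * f x)"
      using e
    proof eventually_elim
      case (elim x)
      have "l powr e x \<le> \<mu> powr e x" using elim l by (intro powr_mono2) auto
      also have "\<dots> \<le> \<mu> powr Q" using elim \<mu> by (intro powr_mono) auto
      finally have "1 \<le> \<mu> powr Q * l powr (- e x)" using l by (simp add: powr_minus field_simps)
      from mult_right_mono[OF this f[of x]] show ?case by (simp add: ennreal_leI mult.assoc flip: ennreal_mult')
    qed
  qed
  then show ?thesis by (simp add: nn_integral_cmult)
qed

lemma set_nn_integral_le_if_le_one_plus:
  assumes [measurable]: "f \<in> borel_measurable M" and F_le: "AE x in M. x \<in> A \<longrightarrow> F x \<le> 1 + f x"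
  shows "(\<integral>\<^sup>+x\<in>A. F x \<partial>M) \<le> emeasure M (space M) + (\<integral>\<^sup>+x. f x \<partial>M)"
proof -
  have "(\<integral>\<^sup>+x\<in>A. F x \<partial>M) \<le> (\<integral>\<^sup>+x. 1 + f x \<partial>M)"
    by (rule nn_integral_mono_AE) (use F_le in \<open>auto elim!: eventually_mono simp: indicator_def\<close>)
  then show ?thesis by (simp add: nn_integral_add)
qed

lemma set_nn_integral_lborel_eq_lebesgue_on:
  assumes "\<Omega> \<in> sets lebesgue" "A \<subseteq> \<Omega>"
  shows "(\<integral>\<^sup>+x\<in>A. F x \<partial>lborel) = (\<integral>\<^sup>+x\<in>A. F x \<partial>lebesgue_on \<Omega>)"
proof -
  have "(\<integral>\<^sup>+x\<in>A. F x \<partial>lborel) = (\<integral>\<^sup>+x\<in>A. F x \<partial>lebesgue)" by (simp add: nn_integral_completion)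
  also have "\<dots> = (\<integral>\<^sup>+x\<in>\<Omega>. F x * indicator A x \<partial>lebesgue)"
    using assms(2) by (intro nn_integral_cong) (auto simp: indicator_def)
  finally show ?thesis by (simp only: nn_integral_lebesgue_on[OF assms(1)])
qed

lemma nn_integral_le_sum_cover:
  assumes [measurable]: "F \<in> borel_measurable M" "\<And>i. i \<in> D \<Longrightarrow> B i \<in> sets M"
    and D: "finite D" and cover: "space M \<subseteq> (\<Union>i\<in>D. B i)"
  shows "(\<integral>\<^sup>+x. F x \<partial>M) \<le> (\<Sum>i\<in>D. \<integral>\<^sup>+x\<in>B i. F x \<partial>M)"
proof -
  have "(\<integral>\<^sup>+x. F x \<partial>M) \<le> (\<integral>\<^sup>+x. (\<Sum>i\<in>D. F x * indicator (B i) x) \<partial>M)"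
  proof (rule nn_integral_mono)
    fix x assume "x \<in> space M"
    then obtain i where i: "i \<in> D" "x \<in> B i" using cover by blast
    have "F x * indicator (B i) x \<le> (\<Sum>i\<in>D. F x * indicator (B i) x)" by (rule member_le_sum) (use i D in auto)
    with i show "F x \<le> (\<Sum>i\<in>D. F x * indicator (B i) x)" by simp
  qed
  then show ?thesis by (subst (asm) nn_integral_sum) auto
qed

locale embedding_setting =
  fixes \<Omega> :: "(real^'n::finite) set" and \<gamma> \<beta> \<theta> p :: "'n fn" and \<epsilon> :: real
  assumes open_domain: "open \<Omega>" and bounded_domain: "bounded \<Omega>" and Lipschitz_domain: "lipschitz_boundary \<Omega>"
    and \<gamma>_continuous: "continuous_on (closure \<Omega>) \<gamma>" and \<gamma>_ge: "\<forall>x\<in>\<Omega>. 1 \<le> \<gamma> x"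
    and \<beta>_continuous: "continuous_on (closure \<Omega>) \<beta>" and \<beta>_bounds: "\<forall>x\<in>\<Omega>. 1 \<le> \<beta> x \<and> \<beta> x < real CARD('n)"
    and \<theta>_M0: "M0 \<Omega> \<theta>" and \<theta>_ge: "AE x in lebesgue. x \<in> \<Omega> \<longrightarrow> \<gamma> x + \<beta> x \<le> \<theta> x"
    and p_M0: "M0 \<Omega> p" and \<epsilon>_pos: "\<epsilon> > 0"
    and p_subcritical: "\<forall>x\<in>\<Omega>. p x + \<epsilon> < real CARD('n) * (\<gamma> x + \<beta> x) / (real CARD('n) - \<beta> x)"
begin

abbreviation S :: "'n fn set" where "S \<equiv> S_space \<Omega> \<gamma> \<beta> \<theta>"

lemma domain_measurable: "\<Omega> \<in> sets borel" "\<Omega> \<in> sets lebesgue"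
  using open_domain by auto

lemma domain_finite: "emeasure lborel \<Omega> < \<infinity>" "emeasure lebesgue \<Omega> < \<infinity>"
  using emeasure_bounded_finite[OF bounded_domain] domain_measurable by auto

lemma emeasure_space: "emeasure (lebesgue_on \<Omega>) (space (lebesgue_on \<Omega>)) = ennreal (measure lborel \<Omega>)"
  unfolding emeasure_lebesgue_on_space[OF domain_measurable(2)]
  using domain_finite(1) domain_measurable(1) by (simp add: emeasure_eq_ennreal_measure)

lemma exponents_measurable[measurable]:
  "\<gamma> \<in> borel_measurable (lebesgue_on \<Omega>)" "\<beta> \<in> borel_measurable (lebesgue_on \<Omega>)"
  "\<theta> \<in> borel_measurable (lebesgue_on \<Omega>)" "p \<in> borel_measurable (lebesgue_on \<Omega>)"
  using continuous_on_subset[OF \<gamma>_continuous closure_subset] continuous_on_subset[OF \<beta>_continuous closure_subset]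
    \<theta>_M0 p_M0 domain_measurable
  by (auto intro!: continuous_imp_measurable_on_sets_lebesgue simp: M0_def)

lemma AE_exponents: "AE x in lebesgue_on \<Omega>. x \<in> \<Omega> \<and> 1 \<le> \<gamma> x \<and> 1 \<le> \<beta> x \<and> \<gamma> x + \<beta> x \<le> \<theta> x"
  unfolding AE_lebesgue_on[OF domain_measurable(2)]
  using \<theta>_ge by eventually_elim (use \<gamma>_ge \<beta>_bounds in auto)

lemma AE_exponents_bounded:
  obtains Q where "Q \<ge> 1" "AE x in lebesgue_on \<Omega>. \<gamma> x + \<beta> x \<le> Q \<and> \<theta> x \<le> Q"
proof -
  obtain P where P: "AE x in lebesgue_on \<Omega>. 1 \<le> \<theta> x \<and> \<theta> x \<le> P"
    by (rule M0_bounded[OF \<theta>_M0 domain_measurable(2)])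
  have "AE x in lebesgue_on \<Omega>. \<gamma> x + \<beta> x \<le> max 1 P \<and> \<theta> x \<le> max 1 P"
    using P AE_exponents by eventually_elim auto
  then show ?thesis by (intro that[of "max 1 P"]) auto
qed

definition energy :: "'n fn \<Rightarrow> 'n \<Rightarrow> ennreal" where
  "energy u i = (\<integral>\<^sup>+x. ennreal (\<bar>u x\<bar> powr \<gamma> x * \<bar>Dw \<Omega> i u x\<bar> powr \<beta> x) \<partial>lebesgue_on \<Omega>)"

lemma S_iff: "u \<in> S \<longleftrightarrow> set_integrable lebesgue \<Omega> u \<and> has_weak_partials \<Omega> u \<and>
    modular \<Omega> \<theta> u + (\<Sum>i\<in>UNIV. energy u i) < \<infinity>"
  by (simp only: S_space_def energy_def nn_integral_lebesgue_on[OF domain_measurable(2)] mem_Collect_eq)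

lemma S_measurable:
  assumes u: "u \<in> S"
  shows "u \<in> borel_measurable (lebesgue_on \<Omega>)" "Dw \<Omega> i u \<in> borel_measurable (lebesgue_on \<Omega>)"
proof -
  have "(\<lambda>x. indicator \<Omega> x *\<^sub>R u x) \<in> borel_measurable lebesgue"
    using u by (auto simp: S_iff set_integrable_def dest: borel_measurable_integrable)
  then show "u \<in> borel_measurable (lebesgue_on \<Omega>)"
    using domain_measurable by (simp add: borel_measurable_restrict_space_iff)
  have "locally_integrable \<Omega> (Dw \<Omega> i u)" using u weak_partial_Dw[of \<Omega> u i] by (simp add: S_iff weak_partial_def)
  from locally_integrable_imp_measurable[OF open_domain this] show "Dw \<Omega> i u \<in> borel_measurable (lebesgue_on \<Omega>)"
    using domain_measurable by (simp add: borel_measurable_restrict_space_iff)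
qed

definition S_bounded :: "real \<Rightarrow> 'n fn \<Rightarrow> bool" where
  "S_bounded \<Lambda> u \<longleftrightarrow> u \<in> S \<and> modular \<Omega> \<theta> u \<le> ennreal \<Lambda> \<and> (\<forall>i. energy u i \<le> ennreal \<Lambda>)"

lemma S_boundedD:
  assumes "S_bounded \<Lambda> u"
  shows "u \<in> S" "u \<in> borel_measurable (lebesgue_on \<Omega>)" "Dw \<Omega> i u \<in> borel_measurable (lebesgue_on \<Omega>)"
    "(\<integral>\<^sup>+x. ennreal (\<bar>u x\<bar> powr \<theta> x) \<partial>lebesgue_on \<Omega>) \<le> ennreal \<Lambda>"
    "(\<integral>\<^sup>+x. ennreal (\<bar>u x\<bar> powr \<gamma> x * \<bar>Dw \<Omega> i u x\<bar> powr \<beta> x) \<partial>lebesgue_on \<Omega>) \<le> ennreal \<Lambda>"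
  using assms S_measurable[of u]
  by (auto simp: S_bounded_def energy_def modular_lebesgue_on[OF domain_measurable(2)])

lemma energy_le_sum: "energy u i \<le> (\<Sum>i\<in>UNIV. energy u i)"
  by (rule member_le_sum) auto

lemma S_bounded_exists:
  assumes "u \<in> S"
  obtains \<Lambda> where "\<Lambda> \<ge> 0" "S_bounded \<Lambda> u"
proof -
  define total where "total = modular \<Omega> \<theta> u + (\<Sum>i\<in>UNIV. energy u i)"
  have "total < \<infinity>" using assms by (simp add: S_iff total_def)
  then have total: "total = ennreal (enn2real total)" by simp
  have "modular \<Omega> \<theta> u \<le> total" by (simp add: total_def)
  moreover have "energy u i \<le> total" for i
    unfolding total_def by (rule order_trans[OF energy_le_sum]) simp
  ultimately have "S_bounded (enn2real total) u" using assms by (simp add: S_bounded_def flip: total)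
  then show ?thesis by (rule that[rotated]) simp
qed

definition scaled_modular :: "real \<Rightarrow> 'n fn \<Rightarrow> ennreal" where
  "scaled_modular l u = modular \<Omega> \<theta> (\<lambda>x. u x / l)
     + (\<Sum>i\<in>UNIV. \<integral>\<^sup>+x\<in>\<Omega>. ennreal (\<bar>\<bar>u x\<bar> powr (\<gamma> x / \<beta> x) * Dw \<Omega> i u x
            / l powr (\<gamma> x / \<beta> x + 1)\<bar> powr \<beta> x) \<partial>lebesgue)"

lemma S_pnorm_eq: "S_pnorm \<Omega> \<gamma> \<beta> \<theta> u = Inf {l. l > 0 \<and> scaled_modular l u \<le> 1}"
  by (simp only: S_pnorm_def scaled_modular_def)

lemma scaled_energy_density:
  assumes "l > 0" "\<beta> x > 0"
  shows "\<bar>\<bar>u x\<bar> powr (\<gamma> x / \<beta> x) * Dw \<Omega> i u x / l powr (\<gamma> x / \<beta> x + 1)\<bar> powr \<beta> x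
    = l powr (- (\<gamma> x + \<beta> x)) * (\<bar>u x\<bar> powr \<gamma> x * \<bar>Dw \<Omega> i u x\<bar> powr \<beta> x)"
proof -
  have "(\<gamma> x / \<beta> x + 1) * \<beta> x = \<gamma> x + \<beta> x" using assms by (simp add: distrib_right)
  then have "(l powr (\<gamma> x / \<beta> x + 1)) powr \<beta> x = l powr (\<gamma> x + \<beta> x)" by (simp only: powr_powr)
  moreover have "\<bar>\<bar>u x\<bar> powr (\<gamma> x / \<beta> x) * Dw \<Omega> i u x / l powr (\<gamma> x / \<beta> x + 1)\<bar>
      = \<bar>u x\<bar> powr (\<gamma> x / \<beta> x) * \<bar>Dw \<Omega> i u x\<bar> / l powr (\<gamma> x / \<beta> x + 1)"
    by (simp add: abs_mult)
  ultimately show ?thesis by (simp only: powr_divide powr_divide_mult_powr[OF assms(2)] powr_minus_divide) simp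
qed

lemma scaled_modular_eq:
  assumes l: "l > 0"
  shows "scaled_modular l u = (\<integral>\<^sup>+x. ennreal (l powr (- \<theta> x) * \<bar>u x\<bar> powr \<theta> x) \<partial>lebesgue_on \<Omega>)
    + (\<Sum>i\<in>UNIV. \<integral>\<^sup>+x. ennreal (l powr (- (\<gamma> x + \<beta> x)) * (\<bar>u x\<bar> powr \<gamma> x * \<bar>Dw \<Omega> i u x\<bar> powr \<beta> x)) \<partial>lebesgue_on \<Omega>)"
proof -
  have "\<bar>u x / l\<bar> powr \<theta> x = l powr (- \<theta> x) * \<bar>u x\<bar> powr \<theta> x" for x
    using l by (simp add: powr_divide powr_minus field_simps)
  then have "modular \<Omega> \<theta> (\<lambda>x. u x / l) = (\<integral>\<^sup>+x. ennreal (l powr (- \<theta> x) * \<bar>u x\<bar> powr \<theta> x) \<partial>lebesgue_on \<Omega>)"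
    by (simp only: modular_lebesgue_on[OF domain_measurable(2)])
  moreover have "(\<integral>\<^sup>+x\<in>\<Omega>. ennreal (\<bar>\<bar>u x\<bar> powr (\<gamma> x / \<beta> x) * Dw \<Omega> i u x / l powr (\<gamma> x / \<beta> x + 1)\<bar> powr \<beta> x) \<partial>lebesgue)
    = (\<integral>\<^sup>+x. ennreal (l powr (- (\<gamma> x + \<beta> x)) * (\<bar>u x\<bar> powr \<gamma> x * \<bar>Dw \<Omega> i u x\<bar> powr \<beta> x)) \<partial>lebesgue_on \<Omega>)" for i
    unfolding nn_integral_lebesgue_on[OF domain_measurable(2)]
  proof (rule nn_integral_cong)
    fix x assume "x \<in> space (lebesgue_on \<Omega>)"
    then have "\<beta> x > 0" using \<beta>_bounds by force
    then show "ennreal (\<bar>\<bar>u x\<bar> powr (\<gamma> x / \<beta> x) * Dw \<Omega> i u x / l powr (\<gamma> x / \<beta> x + 1)\<bar> powr \<beta> x)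
      = ennreal (l powr (- (\<gamma> x + \<beta> x)) * (\<bar>u x\<bar> powr \<gamma> x * \<bar>Dw \<Omega> i u x\<bar> powr \<beta> x))"
      by (simp only: scaled_energy_density[OF l])
  qed
  ultimately show ?thesis by (simp only: scaled_modular_def)
qed

lemma scaled_modular_le:
  assumes u: "u \<in> S" and l: "l \<ge> 1"
  shows "scaled_modular l u \<le> ennreal (1 / l) * (modular \<Omega> \<theta> u + (\<Sum>i\<in>UNIV. energy u i))"
proof -
  note [measurable] = S_measurable[OF u]
  have \<theta>_ge: "AE x in lebesgue_on \<Omega>. 1 \<le> \<theta> x" and \<gamma>\<beta>_ge: "AE x in lebesgue_on \<Omega>. 1 \<le> \<gamma> x + \<beta> x"
    using AE_exponents by (eventually_elim, linarith)+
  have l_pos: "l > 0" using l by simp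
  show ?thesis
    unfolding distrib_left sum_distrib_left modular_lebesgue_on[OF domain_measurable(2)] energy_def
      scaled_modular_eq[OF l_pos]
    by (intro add_mono sum_mono nn_integral_powr_scaled_le[OF _ _ \<theta>_ge l] nn_integral_powr_scaled_le[OF _ _ \<gamma>\<beta>_ge l])
      simp_all
qed

lemma modular_energy_le_scaled_modular:
  obtains Q where "\<And>u l \<mu>. u \<in> S \<Longrightarrow> 0 < l \<Longrightarrow> l \<le> \<mu> \<Longrightarrow> 1 \<le> \<mu> \<Longrightarrow> modular \<Omega> \<theta> u \<le> ennreal (\<mu> powr Q) * scaled_modular l u"
    "\<And>u l \<mu> i. u \<in> S \<Longrightarrow> 0 < l \<Longrightarrow> l \<le> \<mu> \<Longrightarrow> 1 \<le> \<mu> \<Longrightarrow> energy u i \<le> ennreal (\<mu> powr Q) * scaled_modular l u"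
proof -
  obtain Q where Q: "AE x in lebesgue_on \<Omega>. \<gamma> x + \<beta> x \<le> Q \<and> \<theta> x \<le> Q" by (rule AE_exponents_bounded)
  have \<theta>_bounds: "AE x in lebesgue_on \<Omega>. 0 \<le> \<theta> x \<and> \<theta> x \<le> Q"
    and \<gamma>\<beta>_bounds: "AE x in lebesgue_on \<Omega>. 0 \<le> \<gamma> x + \<beta> x \<and> \<gamma> x + \<beta> x \<le> Q"
    using Q AE_exponents by (eventually_elim, auto)+
  show ?thesis
  proof (rule that[of Q])
    fix u and l \<mu> :: real and i assume u: "u \<in> S" and l: "0 < l" "l \<le> \<mu>" "1 \<le> \<mu>"
    note [measurable] = S_measurable[OF u]
    let ?mass = "\<integral>\<^sup>+x. ennreal (l powr (- \<theta> x) * \<bar>u x\<bar> powr \<theta> x) \<partial>lebesgue_on \<Omega>"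
    let ?energy = "\<lambda>i. \<integral>\<^sup>+x. ennreal (l powr (- (\<gamma> x + \<beta> x)) * (\<bar>u x\<bar> powr \<gamma> x * \<bar>Dw \<Omega> i u x\<bar> powr \<beta> x)) \<partial>lebesgue_on \<Omega>"
    have "modular \<Omega> \<theta> u \<le> ennreal (\<mu> powr Q) * ?mass"
      unfolding modular_lebesgue_on[OF domain_measurable(2)]
      by (rule nn_integral_le_powr_scaled[OF _ _ _ \<theta>_bounds l]) simp_all
    also have "\<dots> \<le> ennreal (\<mu> powr Q) * scaled_modular l u"
      unfolding scaled_modular_eq[OF l(1)] by (intro mult_left_mono) simp_all
    finally show "modular \<Omega> \<theta> u \<le> ennreal (\<mu> powr Q) * scaled_modular l u" .
    have "energy u i \<le> ennreal (\<mu> powr Q) * ?energy i"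
      unfolding energy_def by (rule nn_integral_le_powr_scaled[OF _ _ _ \<gamma>\<beta>_bounds l]) simp_all
    also have "?energy i \<le> (\<Sum>i\<in>UNIV. ?energy i)" by (rule member_le_sum) auto
    then have "ennreal (\<mu> powr Q) * ?energy i \<le> ennreal (\<mu> powr Q) * scaled_modular l u"
      unfolding scaled_modular_eq[OF l(1)] by (intro mult_left_mono add_increasing) simp_all
    finally show "energy u i \<le> ennreal (\<mu> powr Q) * scaled_modular l u" .
  qed
qed

text \<open>Some scaling is admissible, so the infimum defining \<open>S_pnorm\<close> is not a junk value.\<close>

lemma S_pnorm_lessD:
  assumes u: "u \<in> S" and less: "S_pnorm \<Omega> \<gamma> \<beta> \<theta> u < C"
  obtains l where "0 < l" "l < C" "scaled_modular l u \<le> 1"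
proof -
  define total where "total = modular \<Omega> \<theta> u + (\<Sum>i\<in>UNIV. energy u i)"
  have "total < \<infinity>" using u by (simp add: S_iff total_def)
  then have total: "total = ennreal (enn2real total)" by simp
  define L where "L = max 1 (enn2real total)"
  have L: "L \<ge> 1" by (simp add: L_def)
  have "scaled_modular L u \<le> ennreal (1 / L) * total" unfolding total_def by (rule scaled_modular_le[OF u L])
  also have "\<dots> \<le> ennreal (1 / L) * ennreal L"
    by (subst total, intro mult_left_mono ennreal_leI) (simp_all add: L_def)
  also have "\<dots> = 1" using L by (simp flip: ennreal_mult')
  finally have "{l. l > 0 \<and> scaled_modular l u \<le> 1} \<noteq> {}" using L by (auto intro: exI[of _ L])
  with less show ?thesis unfolding S_pnorm_eq by (elim cInf_lessD[elim_format]) (use that in auto)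
qed

lemma S_bounded_if_S_pnorm_le:
  obtains \<Lambda> where "\<Lambda> \<ge> 0" "\<And>u. u \<in> S \<Longrightarrow> S_pnorm \<Omega> \<gamma> \<beta> \<theta> u \<le> C \<Longrightarrow> S_bounded \<Lambda> u"
proof -
  obtain Q where Q: "\<And>u l \<mu>. u \<in> S \<Longrightarrow> 0 < l \<Longrightarrow> l \<le> \<mu> \<Longrightarrow> 1 \<le> \<mu> \<Longrightarrow> modular \<Omega> \<theta> u \<le> ennreal (\<mu> powr Q) * scaled_modular l u"
    "\<And>u l \<mu> i. u \<in> S \<Longrightarrow> 0 < l \<Longrightarrow> l \<le> \<mu> \<Longrightarrow> 1 \<le> \<mu> \<Longrightarrow> energy u i \<le> ennreal (\<mu> powr Q) * scaled_modular l u"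
    by (rule modular_energy_le_scaled_modular) (rule that)
  define \<mu> where "\<mu> = max 1 (C + 1)"
  have "S_bounded (\<mu> powr Q) u" if u: "u \<in> S" "S_pnorm \<Omega> \<gamma> \<beta> \<theta> u \<le> C" for u
  proof -
    have "S_pnorm \<Omega> \<gamma> \<beta> \<theta> u < C + 1" using u(2) by simp
    then obtain l where l: "0 < l" "l < C + 1" "scaled_modular l u \<le> 1" by (rule S_pnorm_lessD[OF u(1)])
    then have "ennreal (\<mu> powr Q) * scaled_modular l u \<le> ennreal (\<mu> powr Q)"
      using mult_left_mono[OF l(3), of "ennreal (\<mu> powr Q)"] by simp
    moreover have "l \<le> \<mu>" "1 \<le> \<mu>" using l by (auto simp: \<mu>_def)
    ultimately show ?thesis unfolding S_bounded_def using u(1) Q[OF u(1) l(1)] order_trans by blast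
  qed
  then show ?thesis by (rule that[rotated]) simp_all
qed

lemma set_nn_integral_le_measure_plus:
  assumes "f \<in> borel_measurable (lebesgue_on \<Omega>)" "(\<integral>\<^sup>+x. f x \<partial>lebesgue_on \<Omega>) \<le> ennreal \<Lambda>" "\<Lambda> \<ge> 0"
    and "AE x in lebesgue_on \<Omega>. x \<in> A \<longrightarrow> F x \<le> 1 + f x"
  shows "(\<integral>\<^sup>+x\<in>A. F x \<partial>lebesgue_on \<Omega>) \<le> ennreal (measure lborel \<Omega> + \<Lambda>)"
proof -
  have "(\<integral>\<^sup>+x\<in>A. F x \<partial>lebesgue_on \<Omega>) \<le> ennreal (measure lborel \<Omega>) + (\<integral>\<^sup>+x. f x \<partial>lebesgue_on \<Omega>)"
    using set_nn_integral_le_if_le_one_plus[OF assms(1,4)] unfolding emeasure_space .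
  also have "\<dots> \<le> ennreal (measure lborel \<Omega>) + ennreal \<Lambda>" by (rule add_left_mono[OF assms(2)])
  finally show ?thesis using assms(3) by simp
qed

lemma S_borel_representative:
  assumes "u \<in> S"
  obtains v h where "borel_weak_gradient \<Omega> v h" "AE x in lebesgue_on \<Omega>. v x = u x \<and> (\<forall>i. h i x = Dw \<Omega> i u x)"
  using borel_representative[OF open_domain, of u] assms
  unfolding S_iff AE_lebesgue_on[OF domain_measurable(2)] by blast

lemma power_sobolev_bounded_representative:
  assumes u: "S_bounded \<Lambda> u" and \<Lambda>: "\<Lambda> \<ge> 0" and A: "A \<subseteq> \<Omega>" and sb_bounds: "s > 0" "b \<ge> 1"
    and local: "\<And>x. x \<in> A \<Longrightarrow> s \<le> \<gamma> x / \<beta> x" "\<And>x. x \<in> A \<Longrightarrow> b \<le> \<beta> x"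
    and v: "borel_weak_gradient \<Omega> v h" "AE x in lebesgue_on \<Omega>. v x = u x \<and> (\<forall>i. h i x = Dw \<Omega> i u x)"
  shows "power_sobolev_bounded A s b (measure lborel \<Omega> + \<Lambda>) v h"
  unfolding power_sobolev_bounded_def
proof (intro conjI allI)
  note [measurable] = S_boundedD(2,3)[OF u]
  show "borel_weak_gradient A v h" by (rule borel_weak_gradient_subset[OF v(1) A])
  have "AE x in lebesgue_on \<Omega>. x \<in> A \<longrightarrow> ennreal (\<bar>v x\<bar> powr (s + 1)) \<le> 1 + ennreal (\<bar>u x\<bar> powr \<theta> x)"
    using v(2) AE_exponents
  proof (eventually_elim, intro impI)
    fix x assume x: "v x = u x \<and> (\<forall>i. h i x = Dw \<Omega> i u x)"
      "x \<in> \<Omega> \<and> 1 \<le> \<gamma> x \<and> 1 \<le> \<beta> x \<and> \<gamma> x + \<beta> x \<le> \<theta> x" "x \<in> A"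
    have "s \<le> \<gamma> x / \<beta> x" by (rule local(1)[OF x(3)])
    also have "\<dots> \<le> \<gamma> x" using x by (simp add: divide_le_eq)
    finally have "\<bar>u x\<bar> powr (s + 1) \<le> 1 + \<bar>u x\<bar> powr \<theta> x" using sb_bounds x by (intro powr_le_one_plus_powr) auto
    then show "ennreal (\<bar>v x\<bar> powr (s + 1)) \<le> 1 + ennreal (\<bar>u x\<bar> powr \<theta> x)"
      using x by (simp add: ennreal_leI flip: ennreal_1 ennreal_plus)
  qed
  then show "(\<integral>\<^sup>+x\<in>A. ennreal (\<bar>v x\<bar> powr (s + 1)) \<partial>lborel) \<le> ennreal (measure lborel \<Omega> + \<Lambda>)"
    unfolding set_nn_integral_lborel_eq_lebesgue_on[OF domain_measurable(2) A]
    by (intro set_nn_integral_le_measure_plus[OF _ S_boundedD(4)[OF u] \<Lambda>]) simp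
  fix i
  let ?A1 = "{x\<in>A. 1 \<le> \<bar>v x\<bar>}"
  have A1_subset: "?A1 \<subseteq> \<Omega>" using A by blast
  have "AE x in lebesgue_on \<Omega>. x \<in> ?A1 \<longrightarrow>
      ennreal ((\<bar>v x\<bar> powr s * \<bar>h i x\<bar>) powr b) \<le> 1 + ennreal (\<bar>u x\<bar> powr \<gamma> x * \<bar>Dw \<Omega> i u x\<bar> powr \<beta> x)"
    using v(2) AE_exponents
  proof (eventually_elim, intro impI)
    fix x assume x: "v x = u x \<and> (\<forall>i. h i x = Dw \<Omega> i u x)"
      "x \<in> \<Omega> \<and> 1 \<le> \<gamma> x \<and> 1 \<le> \<beta> x \<and> \<gamma> x + \<beta> x \<le> \<theta> x" "x \<in> ?A1"
    then have "(\<bar>u x\<bar> powr s * \<bar>Dw \<Omega> i u x\<bar>) powr b \<le> 1 + \<bar>u x\<bar> powr \<gamma> x * \<bar>Dw \<Omega> i u x\<bar> powr \<beta> x"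
      using sb_bounds local[of x] by (intro weighted_powr_le_one_plus powr_mono) auto
    then show "ennreal ((\<bar>v x\<bar> powr s * \<bar>h i x\<bar>) powr b) \<le> 1 + ennreal (\<bar>u x\<bar> powr \<gamma> x * \<bar>Dw \<Omega> i u x\<bar> powr \<beta> x)"
      using x by (simp add: ennreal_leI flip: ennreal_1 ennreal_plus)
  qed
  then show "(\<integral>\<^sup>+x\<in>?A1. ennreal ((\<bar>v x\<bar> powr s * \<bar>h i x\<bar>) powr b) \<partial>lborel) \<le> ennreal (measure lborel \<Omega> + \<Lambda>)"
    unfolding set_nn_integral_lborel_eq_lebesgue_on[OF domain_measurable(2) A1_subset]
    by (intro set_nn_integral_le_measure_plus[OF _ S_boundedD(5)[OF u] \<Lambda>]) simp
qed

lemma local_higher_integrability: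
  assumes \<Lambda>: "\<Lambda> \<ge> 0" and x0: "x0 \<in> closure \<Omega>"
  obtains r K where "r > 0" "K \<ge> 0"
    "\<And>u. S_bounded \<Lambda> u \<Longrightarrow> (\<integral>\<^sup>+x\<in>\<Omega> \<inter> ball x0 r. ennreal (\<bar>u x\<bar> powr (p x + \<epsilon>/2)) \<partial>lebesgue_on \<Omega>) \<le> ennreal K"
proof -
  let ?L = "lebesgue_on \<Omega>" and ?n = "real CARD('n)"
  obtain P where P: "AE x in ?L. 1 \<le> p x \<and> p x \<le> P" by (rule M0_bounded[OF p_M0 domain_measurable(2)])
  obtain \<rho> s b q where exponents: "\<rho> > 0" "s > 0" "b \<ge> 1" "q \<ge> b" "?n / b - ?n / q < 1"
    and local: "\<And>x. x \<in> \<Omega> \<inter> ball x0 \<rho> \<Longrightarrow> s \<le> \<gamma> x / \<beta> x" "\<And>x. x \<in> \<Omega> \<inter> ball x0 \<rho> \<Longrightarrow> b \<le> \<beta> x"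
      "\<And>x. x \<in> \<Omega> \<inter> ball x0 \<rho> \<Longrightarrow> p x \<le> P \<Longrightarrow> p x + \<epsilon>/2 \<le> (s + 1) * q"
    by (rule local_constant_exponents[OF \<gamma>_continuous \<gamma>_ge \<beta>_continuous \<beta>_bounds \<epsilon>_pos p_subcritical x0]) (rule that)
  have "measure lborel \<Omega> + \<Lambda> \<ge> 0" using \<Lambda> by simp
  then obtain r K where r: "0 < r" "r \<le> \<rho>" and K: "K \<ge> 0"
    "\<And>v h. power_sobolev_bounded (\<Omega> \<inter> ball x0 \<rho>) s b (measure lborel \<Omega> + \<Lambda>) v h \<Longrightarrow>
      (\<integral>\<^sup>+x\<in>\<Omega> \<inter> ball x0 r. ennreal (\<bar>v x\<bar> powr ((s + 1) * q)) \<partial>lborel) \<le> ennreal K"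
    by (rule power_sobolev_near_closure[OF open_domain Lipschitz_domain domain_finite(1) x0 exponents]) (rule that)
  let ?A = "\<Omega> \<inter> ball x0 r"
  have [measurable]: "?A \<in> sets borel" using open_domain by (simp add: open_Int)
  have "(\<integral>\<^sup>+x\<in>?A. ennreal (\<bar>u x\<bar> powr (p x + \<epsilon>/2)) \<partial>?L) \<le> ennreal (measure lborel \<Omega> + K)" if u: "S_bounded \<Lambda> u" for u
  proof -
    obtain v h where v: "borel_weak_gradient \<Omega> v h" "AE x in ?L. v x = u x \<and> (\<forall>i. h i x = Dw \<Omega> i u x)"
      by (rule S_borel_representative[OF S_boundedD(1)[OF u]])
    have "power_sobolev_bounded (\<Omega> \<inter> ball x0 \<rho>) s b (measure lborel \<Omega> + \<Lambda>) v h"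
      by (rule power_sobolev_bounded_representative[OF u \<Lambda> _ exponents(2,3) local(1,2) v]) auto
    from K(2)[OF this] have "(\<integral>\<^sup>+x\<in>?A. ennreal (\<bar>v x\<bar> powr ((s + 1) * q)) \<partial>?L) \<le> ennreal K"
      by (subst set_nn_integral_lborel_eq_lebesgue_on[symmetric]) (auto simp: domain_measurable)
    moreover have [measurable]: "v \<in> borel_measurable borel" by (rule borel_weak_gradientD(1)[OF v(1)])
    have "(\<lambda>x. ennreal (\<bar>v x\<bar> powr ((s + 1) * q)) * indicator ?A x) \<in> borel_measurable ?L"
      by (intro measurable_restrict_space1 measurable_completion) measurable
    moreover have "AE x in ?L. x \<in> ?A \<longrightarrow> ennreal (\<bar>u x\<bar> powr (p x + \<epsilon>/2))
        \<le> 1 + ennreal (\<bar>v x\<bar> powr ((s + 1) * q)) * indicator ?A x"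
      using v(2) P
    proof (eventually_elim, intro impI)
      fix x assume x: "v x = u x \<and> (\<forall>i. h i x = Dw \<Omega> i u x)" "1 \<le> p x \<and> p x \<le> P" "x \<in> ?A"
      then have "\<bar>u x\<bar> powr (p x + \<epsilon>/2) \<le> 1 + \<bar>u x\<bar> powr ((s + 1) * q)"
        using local(3)[of x] r \<epsilon>_pos by (intro powr_le_one_plus_powr) auto
      from ennreal_leI[OF this]
      show "ennreal (\<bar>u x\<bar> powr (p x + \<epsilon>/2)) \<le> 1 + ennreal (\<bar>v x\<bar> powr ((s + 1) * q)) * indicator ?A x"
        using x by (simp add: ennreal_plus)
    qed
    ultimately show ?thesis using K(1) by (intro set_nn_integral_le_measure_plus)
  qed
  then show ?thesis using r(1) K(1) by (intro that[of r "measure lborel \<Omega> + K"]) auto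
qed

lemma higher_integrability:
  assumes \<Lambda>: "\<Lambda> \<ge> 0"
  obtains K where "K \<ge> 0"
    "\<And>u. S_bounded \<Lambda> u \<Longrightarrow> (\<integral>\<^sup>+x. ennreal (\<bar>u x\<bar> powr (p x + \<epsilon>/2)) \<partial>lebesgue_on \<Omega>) \<le> ennreal K"
proof -
  let ?L = "lebesgue_on \<Omega>"
  have "\<forall>x0\<in>closure \<Omega>. \<exists>r K. r > 0 \<and> K \<ge> 0 \<and> (\<forall>u. S_bounded \<Lambda> u \<longrightarrow>
      (\<integral>\<^sup>+x\<in>\<Omega> \<inter> ball x0 r. ennreal (\<bar>u x\<bar> powr (p x + \<epsilon>/2)) \<partial>?L) \<le> ennreal K)"
    using local_higher_integrability[OF \<Lambda>] by blast
  then obtain r K where "\<forall>x0\<in>closure \<Omega>. r x0 > 0 \<and> K x0 \<ge> 0 \<and> (\<forall>u. S_bounded \<Lambda> u \<longrightarrow>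
      (\<integral>\<^sup>+x\<in>\<Omega> \<inter> ball x0 (r x0). ennreal (\<bar>u x\<bar> powr (p x + \<epsilon>/2)) \<partial>?L) \<le> ennreal (K x0))"
    unfolding bchoice_iff by (elim exE) (rule that)
  then have r: "\<And>x0. x0 \<in> closure \<Omega> \<Longrightarrow> r x0 > 0" and K: "\<And>x0. x0 \<in> closure \<Omega> \<Longrightarrow> K x0 \<ge> 0"
    and local: "\<And>x0 u. x0 \<in> closure \<Omega> \<Longrightarrow> S_bounded \<Lambda> u \<Longrightarrow>
      (\<integral>\<^sup>+x\<in>\<Omega> \<inter> ball x0 (r x0). ennreal (\<bar>u x\<bar> powr (p x + \<epsilon>/2)) \<partial>?L) \<le> ennreal (K x0)"
    by simp_all
  have "compact (closure \<Omega>)" using bounded_domain by simp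
  then obtain D where D: "D \<subseteq> closure \<Omega>" "finite D" "closure \<Omega> \<subseteq> (\<Union>x0\<in>D. ball x0 (r x0))"
    by (rule compactE_image[of _ "closure \<Omega>" "\<lambda>x0. ball x0 (r x0)"]) (use r in force)+
  show ?thesis
  proof (rule that)
    show "(\<Sum>x0\<in>D. K x0) \<ge> 0" using D(1) K by (intro sum_nonneg) auto
    fix u assume u: "S_bounded \<Lambda> u"
    note [measurable] = S_boundedD(2)[OF u]
    have "(\<integral>\<^sup>+x. ennreal (\<bar>u x\<bar> powr (p x + \<epsilon>/2)) \<partial>?L)
      \<le> (\<Sum>x0\<in>D. \<integral>\<^sup>+x\<in>\<Omega> \<inter> ball x0 (r x0). ennreal (\<bar>u x\<bar> powr (p x + \<epsilon>/2)) \<partial>?L)"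
    proof (rule nn_integral_le_sum_cover[OF _ _ D(2)])
      show "space ?L \<subseteq> (\<Union>x0\<in>D. \<Omega> \<inter> ball x0 (r x0))" using D(3) closure_subset[of \<Omega>] by auto
      show "\<Omega> \<inter> ball x0 (r x0) \<in> sets ?L" for x0 using domain_measurable by (simp add: sets_restrict_space)
    qed measurable
    also have "\<dots> \<le> (\<Sum>x0\<in>D. ennreal (K x0))" using D(1) u by (intro sum_mono local) auto
    also have "\<dots> = ennreal (\<Sum>x0\<in>D. K x0)" using D(1) K by (intro sum_ennreal) auto
    finally show "(\<integral>\<^sup>+x. ennreal (\<bar>u x\<bar> powr (p x + \<epsilon>/2)) \<partial>?L) \<le> ennreal (\<Sum>x0\<in>D. K x0)" .
  qed
qed

lemma sobolev_bounded_capped_powr_antiderivative: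
  assumes u: "S_bounded \<Lambda> u" and \<Lambda>: "\<Lambda> \<ge> 0"
    and Q: "Q \<ge> 1" "AE x in lebesgue_on \<Omega>. \<gamma> x + \<beta> x \<le> Q \<and> \<theta> x \<le> Q"
    and F: "\<And>t. (F has_real_derivative capped_powr Q t) (at t)" "\<And>t. \<bar>F t\<bar> \<le> \<bar>t\<bar>"
    and v: "borel_weak_gradient \<Omega> v h" "AE x in lebesgue_on \<Omega>. v x = u x \<and> (\<forall>i. h i x = Dw \<Omega> i u x)"
  shows "sobolev_bounded \<Omega> 1 (measure lborel \<Omega> + \<Lambda>) (\<lambda>x. F (v x)) (\<lambda>i x. capped_powr Q (v x) * h i x)"
  unfolding sobolev_bounded_def
proof (intro conjI allI)
  note [measurable] = S_boundedD(2,3)[OF u]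
  have "continuous_on UNIV (capped_powr Q)" using Q(1) by (intro continuous_capped_powr) simp
  moreover have "\<bar>capped_powr Q t\<bar> \<le> 1" for t using capped_powr_bounds[of Q t] by simp
  ultimately show "borel_weak_gradient \<Omega> (\<lambda>x. F (v x)) (\<lambda>i x. capped_powr Q (v x) * h i x)"
    by (rule borel_weak_gradient_chain[OF v(1) open_domain F(1)])
  have "AE x in lebesgue_on \<Omega>. x \<in> \<Omega> \<longrightarrow> ennreal \<bar>F (v x)\<bar> \<le> 1 + ennreal (\<bar>u x\<bar> powr \<theta> x)"
    using v(2) AE_exponents
  proof eventually_elim
    case (elim x)
    have "\<bar>F (v x)\<bar> \<le> \<bar>u x\<bar> powr 1" using F(2)[of "v x"] elim by simp
    also have "\<dots> \<le> 1 + \<bar>u x\<bar> powr \<theta> x" using elim by (intro powr_le_one_plus_powr) auto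
    finally show ?case by (simp add: ennreal_leI flip: ennreal_1 ennreal_plus)
  qed
  then show "(\<integral>\<^sup>+x\<in>\<Omega>. ennreal \<bar>F (v x)\<bar> \<partial>lborel) \<le> ennreal (measure lborel \<Omega> + \<Lambda>)"
    unfolding set_nn_integral_lborel_eq_lebesgue_on[OF domain_measurable(2) order_refl]
    by (intro set_nn_integral_le_measure_plus[OF _ S_boundedD(4)[OF u] \<Lambda>]) simp
  fix i
  have "AE x in lebesgue_on \<Omega>. x \<in> \<Omega> \<longrightarrow>
      ennreal (\<bar>capped_powr Q (v x) * h i x\<bar> powr 1) \<le> 1 + ennreal (\<bar>u x\<bar> powr \<gamma> x * \<bar>Dw \<Omega> i u x\<bar> powr \<beta> x)"
    using v(2) AE_exponents Q(2)
  proof eventually_elim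
    case (elim x)
    let ?D = "\<bar>Dw \<Omega> i u x\<bar>"
    have "\<gamma> x / \<beta> x \<le> \<gamma> x" using elim by (simp add: divide_le_eq)
    then have "(capped_powr Q (u x) * ?D) powr 1 \<le> 1 + \<bar>u x\<bar> powr \<gamma> x * ?D powr \<beta> x"
      using elim by (intro weighted_powr_le_one_plus capped_powr_le_powr capped_powr_bounds) auto
    then show ?case
      using elim capped_powr_bounds(1)[of Q "u x"] by (simp add: ennreal_leI abs_mult flip: ennreal_1 ennreal_plus)
  qed
  then show "(\<integral>\<^sup>+x\<in>\<Omega>. ennreal (\<bar>capped_powr Q (v x) * h i x\<bar> powr 1) \<partial>lborel) \<le> ennreal (measure lborel \<Omega> + \<Lambda>)"
    unfolding set_nn_integral_lborel_eq_lebesgue_on[OF domain_measurable(2) order_refl]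
    by (intro set_nn_integral_le_measure_plus[OF _ S_boundedD(5)[OF u] \<Lambda>]) simp
qed

lemma S_bounded_AE_convergent_subsequence:
  assumes u: "\<And>k::nat. S_bounded \<Lambda> (u k)" and \<Lambda>: "\<Lambda> \<ge> 0"
  obtains r :: "nat \<Rightarrow> nat" where "strict_mono r" "AE x in lebesgue_on \<Omega>. convergent (\<lambda>k. u (r k) x)"
proof -
  let ?L = "lebesgue_on \<Omega>"
  obtain Q where Q: "Q \<ge> 1" "AE x in ?L. \<gamma> x + \<beta> x \<le> Q \<and> \<theta> x \<le> Q" by (rule AE_exponents_bounded)
  have "\<forall>k. \<exists>v h. borel_weak_gradient \<Omega> v h \<and> (AE x in ?L. v x = u k x \<and> (\<forall>i. h i x = Dw \<Omega> i (u k) x))"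
    using S_borel_representative[OF S_boundedD(1)[OF u]] by blast
  then obtain v h where v: "\<And>k. borel_weak_gradient \<Omega> (v k) (h k)"
    and v_eq: "\<And>k. AE x in ?L. v k x = u k x \<and> (\<forall>i. h k i x = Dw \<Omega> i (u k) x)"
    unfolding choice_iff by (elim exE) (rule that, blast+)
  obtain F where F: "\<And>t. (F has_real_derivative capped_powr Q t) (at t)" "\<And>t. \<bar>F t\<bar> \<le> \<bar>t\<bar>" "strict_mono F" "surj F"
    using capped_powr_antiderivative[of Q] Q(1) by auto
  have "sobolev_bounded \<Omega> 1 (measure lborel \<Omega> + \<Lambda>) (\<lambda>x. F (v k x)) (\<lambda>i x. capped_powr Q (v k x) * h k i x)" for k
    by (rule sobolev_bounded_capped_powr_antiderivative[OF u \<Lambda> Q F(1,2) v v_eq])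
  moreover have "measure lborel \<Omega> + \<Lambda> \<ge> 0" using \<Lambda> by simp
  ultimately obtain r where r: "strict_mono r" "AE x in lborel. x \<in> \<Omega> \<longrightarrow> convergent (\<lambda>k. F (v (r k) x))"
    by (rule rellich_AE_convergent_subsequence[OF open_domain])
  have "AE x in ?L. \<forall>k. v k x = u k x"
    unfolding AE_all_countable
  proof
    show "AE x in ?L. v k x = u k x" for k using v_eq[of k] by eventually_elim simp
  qed
  moreover have "AE x in ?L. convergent (\<lambda>k. F (v (r k) x))"
    unfolding AE_lebesgue_on[OF domain_measurable(2)] by (rule AE_completion[OF r(2)])
  ultimately have "AE x in ?L. convergent (\<lambda>k. u (r k) x)"
    by eventually_elim (rule convergent_if_strict_mono_image_convergent[OF F(3,4)], simp)
  with r(1) show ?thesis by (rule that)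
qed

lemma S_subset_Lpx: "S \<subseteq> Lpx \<Omega> p"
proof
  fix u assume u: "u \<in> S"
  obtain \<Lambda> where \<Lambda>: "\<Lambda> \<ge> 0" "S_bounded \<Lambda> u" by (rule S_bounded_exists[OF u])
  obtain K where "\<And>u. S_bounded \<Lambda> u \<Longrightarrow> (\<integral>\<^sup>+x. ennreal (\<bar>u x\<bar> powr (p x + \<epsilon>/2)) \<partial>lebesgue_on \<Omega>) \<le> ennreal K"
    by (rule higher_integrability[OF \<Lambda>(1)]) (rule that)
  from this[OF \<Lambda>(2)] show "u \<in> Lpx \<Omega> p"
    by (rule Lpx_if_nn_integral_powr_le[OF domain_measurable(2) domain_finite(2) p_M0 S_measurable(1)[OF u], rotated])
      (use \<epsilon>_pos in simp)
qed

lemma compact_embedding: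
  assumes u: "\<And>k::nat. u k \<in> S" and bounded: "\<And>k. S_pnorm \<Omega> \<gamma> \<beta> \<theta> (u k) \<le> C"
  obtains r v where "strict_mono r" "v \<in> Lpx \<Omega> p" "(\<lambda>k. lux_norm \<Omega> p (\<lambda>x. u (r k) x - v x)) \<longlonglongrightarrow> 0"
proof -
  obtain \<Lambda> where \<Lambda>: "\<Lambda> \<ge> 0" "\<And>u. u \<in> S \<Longrightarrow> S_pnorm \<Omega> \<gamma> \<beta> \<theta> u \<le> C \<Longrightarrow> S_bounded \<Lambda> u"
    by (rule S_bounded_if_S_pnorm_le) (rule that)
  have u_bounded: "S_bounded \<Lambda> (u k)" for k by (rule \<Lambda>(2)[OF u bounded])
  obtain K where K: "K \<ge> 0"
    "\<And>u. S_bounded \<Lambda> u \<Longrightarrow> (\<integral>\<^sup>+x. ennreal (\<bar>u x\<bar> powr (p x + \<epsilon>/2)) \<partial>lebesgue_on \<Omega>) \<le> ennreal K"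
    by (rule higher_integrability[OF \<Lambda>(1)]) (rule that)
  obtain r where r: "strict_mono r" "AE x in lebesgue_on \<Omega>. convergent (\<lambda>k. u (r k) x)"
    by (rule S_bounded_AE_convergent_subsequence[OF u_bounded \<Lambda>(1)])
  have "\<epsilon>/2 > 0" using \<epsilon>_pos by simp
  then obtain v where "v \<in> Lpx \<Omega> p" "(\<lambda>k. lux_norm \<Omega> p (\<lambda>x. u (r k) x - v x)) \<longlonglongrightarrow> 0"
    by (rule Lpx_convergent_if_AE_convergent[OF domain_measurable(2) domain_finite(2) p_M0 _ K(1)
        S_measurable(1)[OF u] K(2)[OF u_bounded] r(2)])
  with r(1) show ?thesis by (rule that)
qed

end

theorem theorem3p11:
  fixes \<Omega> :: "(real^'n) set" and \<gamma> \<beta> \<theta> p :: "real^'n \<Rightarrow> real"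
    and \<epsilon>0 \<epsilon> :: real
  assumes n2: "CARD('n) \<ge> 2"
    and dom: "bounded_lipschitz_domain \<Omega>"
    and gamma: "C1_closure \<Omega> \<gamma>" "\<forall>x\<in>\<Omega>. 1 \<le> \<gamma> x"
    and beta: "C1_closure \<Omega> \<beta>" "\<forall>x\<in>\<Omega>. 1 \<le> \<beta> x \<and> \<beta> x < real CARD('n)"
    and theta: "M0 \<Omega> \<theta>" "\<epsilon>0 > 0"
      "AE x in lebesgue. x \<in> \<Omega> \<longrightarrow> \<theta> x \<ge> \<gamma> x + \<beta> x + \<epsilon>0"
    and pM: "M0 \<Omega> p"
    and eps: "\<epsilon> > 0"
    and pcrit: "\<forall>x\<in>\<Omega>. p x + \<epsilon> < real CARD('n) * (\<gamma> x + \<beta> x) / (real CARD('n) - \<beta> x)"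
  shows "S_space \<Omega> \<gamma> \<beta> \<theta> \<subseteq> Lpx \<Omega> p \<and>
    (\<forall>u::nat \<Rightarrow> real^'n \<Rightarrow> real.
       (\<forall>k. u k \<in> S_space \<Omega> \<gamma> \<beta> \<theta>) \<and> (\<exists>C. \<forall>k. S_pnorm \<Omega> \<gamma> \<beta> \<theta> (u k) \<le> C) \<longrightarrow>
       (\<exists>r v. strict_mono r \<and> v \<in> Lpx \<Omega> p \<and>
          (\<lambda>k. lux_norm \<Omega> p (\<lambda>x. u (r k) x - v x)) \<longlonglongrightarrow> 0))"
proof -
  have "AE x in lebesgue. x \<in> \<Omega> \<longrightarrow> \<gamma> x + \<beta> x \<le> \<theta> x"
    using theta(3) by eventually_elim (use theta(2) in auto)
  then interpret embedding_setting \<Omega> \<gamma> \<beta> \<theta> p \<epsilon>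
    using dom gamma beta theta(1) pM eps pcrit
    by unfold_locales (simp_all add: bounded_lipschitz_domain_def C1_closure_def)
  show ?thesis
  proof (intro conjI allI impI)
    show "S \<subseteq> Lpx \<Omega> p" by (rule S_subset_Lpx)
    fix u :: "nat \<Rightarrow> real^'n \<Rightarrow> real"
    assume "(\<forall>k. u k \<in> S) \<and> (\<exists>C. \<forall>k. S_pnorm \<Omega> \<gamma> \<beta> \<theta> (u k) \<le> C)"
    then obtain C where u: "\<And>k. u k \<in> S" "\<And>k. S_pnorm \<Omega> \<gamma> \<beta> \<theta> (u k) \<le> C" by blast
    obtain r v where "strict_mono r" "v \<in> Lpx \<Omega> p" "(\<lambda>k. lux_norm \<Omega> p (\<lambda>x. u (r k) x - v x)) \<longlonglongrightarrow> 0"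
      by (rule compact_embedding[OF u])
    then show "\<exists>r v. strict_mono r \<and> v \<in> Lpx \<Omega> p \<and> (\<lambda>k. lux_norm \<Omega> p (\<lambda>x. u (r k) x - v x)) \<longlonglongrightarrow> 0"
      by blast
  qed
qed

end
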